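(* Let $X$ be a non-degenerate self-decomposable random vector in $\mathbb{R}^d$ without Gaussian component, with parameter $b\in\mathbb{R}^d$, law $\mu_X$, characteristic function $\varphi$, and Lévy measure $\nu$ with polar decomposition $\nu(du)=\mathbf 1_{(0,+\infty)}(r)\mathbf 1_{\mathbb{S}^{d-1}}(x)\frac{k_x(r)}{r}dr\,\sigma(dx)$, where $\sigma$ is a finite positive measure on $\mathbb{S}^{d-1}$ and the nonnegative function $k_x(r)$, decreasing in $r$, is continuous in $r\in(0,+\infty)$, continuous in $x\in\mathbb{S}^{d-1}$ and satisfies $\lim_{r\to0^+}r^2k_x(r)=0$ and $\lim_{r\to+\infty}k_x(r)=0$ for $x\in\mathbb{S}^{d-1}$. Assume that there exists $\varepsilon\in(0,1)$ such that $\mathbb{E}\|X\|^\varepsilon<+\infty$ and that there exist $\beta_1>0$, $\beta_2>0$ and $\beta_3\in(0,1)$ such that $$\gamma_1=\sup_{t\ge0}\Big(e^{\beta_1t}\int_{(1,+\infty)\times\mathbb{S}^{d-1}}\frac{k_x(e^tr)}{r}dr\,\sigma(dx)\Big)<+\infty,\qquad \gamma_2=\sup_{t\ge0}\Big(e^{\beta_2t}\int_{(0,1)\times\mathbb{S}^{d-1}}r\,k_x(e^tr)dr\,\sigma(dx)\Big)<+\infty,$$ $$\gamma_3=\sup_{t\ge0}\Big(e^{-(1-\beta_3)t}\Big\|\int_{\mathbb{S}^{d-1}}x\Big(\int_1^{e^t}k_x(r)dr\Big)\sigma(dx)\Big\|\Big)<+\infty.$$ For $t\ge0$ let $X_t$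 be a random vector with characteristic function $\varphi_t(\xi)=\varphi(\xi)/\varphi(e^{-t}\xi)$ and law $\mu_t$, and assume that $\sup_{t\ge0}\mathbb{E}\|X_t\|^\varepsilon<+\infty$. Let $P_t^\nu(h)(x)=\int_{\mathbb{R}^d}h(xe^{-t}+y)\mu_t(dy)$ for $h$ bounded and continuous, $x\in\mathbb{R}^d$, $t\ge0$. Then: (1) for any $h\in\mathcal{H}_1$, the function $f_h$ given, for all $x\in\mathbb{R}^d$, by $$f_h(x)=-\int_0^{+\infty}\big(P_t^\nu(h)(x)-\mathbb{E}h(X)\big)dt$$ is well defined and continuously differentiable on $\mathbb{R}^d$ with $M_1(f_h)\le1$; (2) for any $h\in\mathcal{H}_2\cap\mathcal{C}_c^\infty(\mathbb{R}^d)$, $f_h$ is twice continuously differentiable on $\mathbb{R}^d$, $M_2(f_h)\le1/2$, and $$\langle\tilde b-x;\nabla f_h(x)\rangle+\int_{\mathbb{R}^d}\big(f_h(x+u)-f_h(x)-\langle\nabla f_h(x);u\rangle\mathbf 1_{\|u\|\le1}\big)\tilde\nu(du)=h(x)-\mathbb{E}h(X),\quad x\in\mathbb{R}^d,$$ where $\tilde\nu(du)=\mathbf 1_{(0,+\infty)}(r)\mathbf 1_{\mathbb{S}^{d-1}}(x)(-dk_x(r))\sigma(dx)$ and $\tilde b=b-\int_{\mathbb{S}^{d-1}}k_y(1)\,y\,\sigma(dy)$.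
   Context: $\|\cdot\|$, $\langle\cdot;\cdot\rangle$: Euclidean norm and inner product on $\mathbb{R}^d$; $\mathbb{S}^{d-1}$: Euclidean unit sphere. A Lévy measure is a positive Borel measure $\nu$ with $\nu(\{0\})=0$ and $\int(1\wedge\|u\|^2)\nu(du)<+\infty$; polar coordinates are $u=rx$. A self-decomposable (SD) random vector without Gaussian component with parameter $b$ and Lévy measure $\nu$ has characteristic function $\varphi(\xi)=\exp\big(i\langle b;\xi\rangle+\int(e^{i\langle\xi;u\rangle}-1-i\langle\xi;u\rangle\mathbf 1_{\|u\|\le1})\nu(du)\big)$ with $\nu$ of the stated polar form, $k_x(r)\ge0$ non-increasing in $r$ and measurable in $x$. For SD $X$, $\varphi_t$ is a characteristic function for every $t\ge 0$ ($\mu_0=\delta_0$). Non-degenerate means that the law is not concentrated on a proper affine hyperplane. $-dk_x(r)$ is the positive Lebesgue–Stieltjes measure of the decreasing function $k_x$; under the stated assumptions $\tilde\nu$ is a Lévy measure. For an $r$-times continuously differentiable $h$ and $1\le\ell\le r$, $M_\ell(h)=\sup_{x}\|\mathbf D^\ell(h)(x)\|_{op}$, where $\mathbf D^\ell(h)(x)$ is the $\ell$-th derivative viewed as an $\ell$-linear form and $\|F\|_{op}=\sup\{|F(v_1,\dots,v_\ell)|:\|v_j\|=1\}$; $M_0(h)=\sup_x|h(x)|$. $\mathcal{H}_r$ is the set of bounded continuous functions on $\mathbb{R}^d$, continuously differentiable up to order $r$, with $\max_{0\le\ell\le r}M_\ell(h)\le1$. $\mathcal{C}_c^\infty(\mathbb{R}^d)$: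 infinitely differentiable compactly supported functions. *)

theory Defs
  imports "HOL-Probability.Probability"
begin

subsection \<open>Laws on a Euclidean space\<close>

definition cf :: "'a::euclidean_space measure \<Rightarrow> 'a \<Rightarrow> complex" where
  "cf \<mu> \<xi> = (CLINT u|\<mu>. iexp (\<xi> \<bullet> u))"

definition nondegenerate :: "'a::euclidean_space measure \<Rightarrow> bool" where
  "nondegenerate \<mu> \<longleftrightarrow> \<not> (\<exists>a c. a \<noteq> 0 \<and> (AE u in \<mu>. a \<bullet> u = c))"

definition levy_measure :: "'a::euclidean_space measure \<Rightarrow> bool" where
  "levy_measure \<nu> \<longleftrightarrow> sets \<nu> = sets borel \<and> emeasure \<nu> {0} = 0 \<and>
     (\<integral>\<^sup>+u. ennreal (min 1 ((norm u)\<^sup>2)) \<partial>\<nu>) < \<infinity>"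


subsection \<open>Measures in polar coordinates\<close>

text \<open>
  The measure \<open>A \<mapsto> \<integral> \<kappa>\<^sub>x({r. r x \<in> A}) \<sigma>(dx)\<close>. As \<^const>\<open>measure_of\<close> returns
  the zero measure if the given set function is not countably additive, the formula is only
  meaningful for a measurable family of radial measures \<open>\<kappa>\<close>; see \<open>emeasure_polar_measure\<close>.
\<close>

definition polar_measure ::
    "'a::euclidean_space measure \<Rightarrow> ('a \<Rightarrow> real measure) \<Rightarrow> 'a measure" where
  "polar_measure \<sigma> \<kappa> =
     measure_of UNIV (sets borel) (\<lambda>A. \<integral>\<^sup>+x. emeasure (\<kappa> x) ((\<lambda>r. r *\<^sub>R x) -` A) \<partial>\<sigma>)"

lemma sets_polar_measure [simp]: "sets (polar_measure \<sigma> \<kappa>) = sets borel"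
  by (metis polar_measure_def sets.sigma_sets_eq sets.space_closed sets_measure_of space_borel)

lemma emeasure_polar_measure:
  assumes \<kappa>: "\<And>x. x \<in> space \<sigma> \<Longrightarrow> sets (\<kappa> x) = sets borel"
    and meas: "\<And>A. A \<in> sets borel \<Longrightarrow>
      (\<lambda>x. emeasure (\<kappa> x) ((\<lambda>r. r *\<^sub>R x) -` A)) \<in> borel_measurable \<sigma>"
    and A: "A \<in> sets borel"
  shows "emeasure (polar_measure \<sigma> \<kappa>) A = (\<integral>\<^sup>+x. emeasure (\<kappa> x) ((\<lambda>r. r *\<^sub>R x) -` A) \<partial>\<sigma>)"
proof (rule emeasure_measure_of[OF polar_measure_def])
  have vim: "(\<lambda>r. r *\<^sub>R x) -` B \<in> sets borel" if "B \<in> sets borel" for B and x :: 'a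
    using measurable_sets[OF _ that, of "\<lambda>r. r *\<^sub>R x" borel] by simp
  show "countably_additive (sets (polar_measure \<sigma> \<kappa>))
      (\<lambda>A. \<integral>\<^sup>+x. emeasure (\<kappa> x) ((\<lambda>r. r *\<^sub>R x) -` A) \<partial>\<sigma>)"
  proof (rule countably_additiveI)
    fix B :: "nat \<Rightarrow> 'a set"
    assume B: "range B \<subseteq> sets (polar_measure \<sigma> \<kappa>)" "disjoint_family B"
    have "(\<Sum>i. \<integral>\<^sup>+x. emeasure (\<kappa> x) ((\<lambda>r. r *\<^sub>R x) -` B i) \<partial>\<sigma>)
        = (\<integral>\<^sup>+x. (\<Sum>i. emeasure (\<kappa> x) ((\<lambda>r. r *\<^sub>R x) -` B i)) \<partial>\<sigma>)"
      by (rule nn_integral_suminf[symmetric]) (use B meas in auto)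
    also have "\<dots> = (\<integral>\<^sup>+x. emeasure (\<kappa> x) ((\<lambda>r. r *\<^sub>R x) -` (\<Union>i. B i)) \<partial>\<sigma>)"
    proof (rule nn_integral_cong)
      fix x assume x: "x \<in> space \<sigma>"
      have "range (\<lambda>i. (\<lambda>r. r *\<^sub>R x) -` B i) \<subseteq> sets (\<kappa> x)"
        using B vim \<kappa>[OF x] by auto
      moreover have "disjoint_family (\<lambda>i. (\<lambda>r. r *\<^sub>R x) -` B i)"
        using B(2) by (auto simp: disjoint_family_on_def)
      ultimately show "(\<Sum>i. emeasure (\<kappa> x) ((\<lambda>r. r *\<^sub>R x) -` B i))
          = emeasure (\<kappa> x) ((\<lambda>r. r *\<^sub>R x) -` (\<Union>i. B i))"
        by (subst suminf_emeasure) (auto simp: vimage_UN)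
    qed
    finally show "(\<Sum>i. \<integral>\<^sup>+x. emeasure (\<kappa> x) ((\<lambda>r. r *\<^sub>R x) -` B i) \<partial>\<sigma>)
        = (\<integral>\<^sup>+x. emeasure (\<kappa> x) ((\<lambda>r. r *\<^sub>R x) -` (\<Union>i. B i)) \<partial>\<sigma>)" .
  qed
qed (use A in \<open>auto simp: positive_def\<close>)

text \<open>
  The Lebesgue--Stieltjes measure \<open>-dg\<close> on \<open>(0,\<infinity>)\<close> of a non-increasing function
  \<open>g\<close> on \<open>(0,\<infinity>)\<close>. Since \<open>g\<close> may be unbounded at \<open>0\<close>, \<^const>\<open>interval_measure\<close> is not
  applicable to \<open>-g\<close> itself; it is applied in the coordinate \<open>s = ln r\<close> and transported back.
\<close>

definition neg_stieltjes :: "(real \<Rightarrow> real) \<Rightarrow> real measure" where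
  "neg_stieltjes g = distr (interval_measure (\<lambda>s. - g (exp s))) borel exp"

lemma emeasure_neg_stieltjes_Ioc:
  assumes "antimono_on {0<..} g" "continuous_on {0<..} g" "0 < a" "a \<le> b"
  shows "emeasure (neg_stieltjes g) {a<..b} = ennreal (g a - g b)"
proof -
  have "exp -` {a<..b} = {ln a<..ln b}"
    using exp_less_cancel_iff[of "ln a"] exp_le_cancel_iff[of _ "ln b"] assms(3,4) by auto
  moreover have "continuous_on UNIV (\<lambda>s. - g (exp s))"
    by (intro continuous_intros continuous_on_compose2[OF assms(2)]) auto
  then have "continuous (at_right s) (\<lambda>s. - g (exp s))" for s
    by (simp add: continuous_on_eq_continuous_within continuous_at_imp_continuous_at_within)
  moreover have "- g (exp s) \<le> - g (exp t)" if "s \<le> t" for s t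
    using assms(1) that by (auto simp: monotone_on_def)
  ultimately show ?thesis
    using assms(3,4) unfolding neg_stieltjes_def
    by (subst emeasure_distr) (auto simp: emeasure_interval_measure_Ioc)
qed

lemma emeasure_neg_stieltjes_nonpos: "emeasure (neg_stieltjes g) {..0} = 0"
proof -
  have "exp -` {..0::real} = {}"
    by (auto simp: not_le)
  then show ?thesis
    unfolding neg_stieltjes_def by (subst emeasure_distr) auto
qed


subsection \<open>Self-decomposable laws without Gaussian component\<close>

definition sd_without_gaussian ::
    "'a::euclidean_space measure \<Rightarrow> 'a \<Rightarrow> 'a measure \<Rightarrow> 'a measure \<Rightarrow> ('a \<Rightarrow> real \<Rightarrow> real) \<Rightarrow> bool" where
  "sd_without_gaussian \<mu> b \<nu> \<sigma> k \<longleftrightarrow>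
     levy_measure \<nu> \<and>
     finite_measure \<sigma> \<and> sets \<sigma> = sets (restrict_space borel (sphere 0 1)) \<and>
     (\<forall>x\<in>sphere 0 1. \<forall>r>0. 0 \<le> k x r) \<and>
     (\<forall>x\<in>sphere 0 1. antimono_on {0<..} (k x)) \<and>
     (\<forall>r>0. (\<lambda>x. k x r) \<in> borel_measurable \<sigma>) \<and>
     \<nu> = polar_measure \<sigma> (\<lambda>x. density lborel (\<lambda>r. indicator {0<..} r * ennreal (k x r / r))) \<and>
     (\<forall>\<xi>. cf \<mu> \<xi> = exp (\<i> * complex_of_real (b \<bullet> \<xi>) +
        (CLINT u|\<nu>. iexp (\<xi> \<bullet> u) - 1 - \<i> * complex_of_real (\<xi> \<bullet> u) * indicator (cball 0 1) u)))"

definition nu_tilde :: "'a::euclidean_space measure \<Rightarrow> ('a \<Rightarrow> real \<Rightarrow> real) \<Rightarrow> 'a measure" where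
  "nu_tilde \<sigma> k = polar_measure \<sigma> (\<lambda>x. neg_stieltjes (k x))"

definition b_tilde :: "'a::euclidean_space \<Rightarrow> 'a measure \<Rightarrow> ('a \<Rightarrow> real \<Rightarrow> real) \<Rightarrow> 'a" where
  "b_tilde b \<sigma> k = b - (LINT y|\<sigma>. k y 1 *\<^sub>R y)"

definition gamma1 :: "'a::euclidean_space measure \<Rightarrow> ('a \<Rightarrow> real \<Rightarrow> real) \<Rightarrow> real \<Rightarrow> ennreal" where
  "gamma1 \<sigma> k \<beta> = (SUP t\<in>{0..}. ennreal (exp (\<beta> * t)) *
     (\<integral>\<^sup>+x. (\<integral>\<^sup>+r\<in>{1<..}. ennreal (k x (exp t * r) / r) \<partial>lborel) \<partial>\<sigma>))"

definition gamma2 :: "'a::euclidean_space measure \<Rightarrow> ('a \<Rightarrow> real \<Rightarrow> real) \<Rightarrow> real \<Rightarrow> ennreal" where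
  "gamma2 \<sigma> k \<beta> = (SUP t\<in>{0..}. ennreal (exp (\<beta> * t)) *
     (\<integral>\<^sup>+x. (\<integral>\<^sup>+r\<in>{0<..<1}. ennreal (r * k x (exp t * r)) \<partial>lborel) \<partial>\<sigma>))"

definition gamma3 :: "'a::euclidean_space measure \<Rightarrow> ('a \<Rightarrow> real \<Rightarrow> real) \<Rightarrow> real \<Rightarrow> ennreal" where
  "gamma3 \<sigma> k \<beta> = (SUP t\<in>{0..}. ennreal (exp (- (1 - \<beta>) * t) *
     norm (LINT x|\<sigma>. (LINT r:{1..exp t}|lborel. k x r) *\<^sub>R x)))"


subsection \<open>Derivatives of higher order\<close>

text \<open>
  \<open>iter_deriv h [v\<^sub>1, \<dots>, v\<^sub>l] x\<close> is the value at \<open>(v\<^sub>1, \<dots>, v\<^sub>l)\<close> of the \<open>l\<close>-th derivative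
  of \<open>h\<close> at \<open>x\<close>, viewed as an \<open>l\<close>-linear form.
\<close>

fun iter_deriv :: "('a::euclidean_space \<Rightarrow> real) \<Rightarrow> 'a list \<Rightarrow> 'a \<Rightarrow> real" where
  "iter_deriv h [] = h"
| "iter_deriv h (v # vs) = (\<lambda>x. frechet_derivative (iter_deriv h vs) (at x) v)"

text \<open>
  In finite dimension, differentiability and continuity of the \<open>l\<close>-th derivative as a map into the
  \<open>l\<close>-linear forms amount to those of its evaluations at fixed vectors.
\<close>

definition cont_diff :: "nat \<Rightarrow> ('a::euclidean_space \<Rightarrow> real) \<Rightarrow> bool" where
  "cont_diff n h \<longleftrightarrow>
     (\<forall>vs. length vs < n \<longrightarrow> (\<forall>x. iter_deriv h vs differentiable (at x))) \<and>
     (\<forall>vs. length vs \<le> n \<longrightarrow> continuous_on UNIV (iter_deriv h vs))"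

definition form_norm :: "nat \<Rightarrow> ('a::euclidean_space list \<Rightarrow> real) \<Rightarrow> ennreal" where
  "form_norm l F = (SUP vs\<in>{vs. length vs = l \<and> (\<forall>v\<in>set vs. norm v = 1)}. ennreal \<bar>F vs\<bar>)"

definition deriv_bound :: "nat \<Rightarrow> ('a::euclidean_space \<Rightarrow> real) \<Rightarrow> ennreal" where
  "deriv_bound l h = (SUP x. form_norm l (\<lambda>vs. iter_deriv h vs x))"

lemma deriv_bound_0: "deriv_bound 0 h = (SUP x. ennreal \<bar>h x\<bar>)"
proof -
  have "{vs :: 'a list. length vs = 0 \<and> (\<forall>v\<in>set vs. norm v = 1)} = {[]}"
    by auto
  then show ?thesis
    by (simp add: deriv_bound_def form_norm_def)
qed

definition H_class :: "nat \<Rightarrow> ('a::euclidean_space \<Rightarrow> real) set" where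
  "H_class n = {h. bounded (range h) \<and> cont_diff n h \<and> (\<forall>l\<le>n. deriv_bound l h \<le> 1)}"

definition Cc_infty :: "('a::euclidean_space \<Rightarrow> real) set" where
  "Cc_infty = {h. (\<forall>n. cont_diff n h) \<and> compact (closure {x. h x \<noteq> 0})}"

definition gradient :: "('a::euclidean_space \<Rightarrow> real) \<Rightarrow> 'a \<Rightarrow> 'a" where
  "gradient f x = (THE D. GDERIV f x :> D)"


subsection \<open>The semigroup and the solution of the Stein equation\<close>

definition P_nu :: "(real \<Rightarrow> 'a::euclidean_space measure) \<Rightarrow> real \<Rightarrow> ('a \<Rightarrow> real) \<Rightarrow> 'a \<Rightarrow> real" where
  "P_nu \<mu> t h x = (LINT y|\<mu> t. h (exp (- t) *\<^sub>R x + y))"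

definition stein_solution ::
    "(real \<Rightarrow> 'a::euclidean_space measure) \<Rightarrow> 'w measure \<Rightarrow> ('w \<Rightarrow> 'a) \<Rightarrow> ('a \<Rightarrow> real) \<Rightarrow> 'a \<Rightarrow> real" where
  "stein_solution \<mu> M X h x =
     - (LINT t:{0..}|lborel. P_nu \<mu> t h x - (LINT w|M. h (X w)))"

end

theory Submission
  imports Defs
begin

text \<open>
  Since the random vector \<open>X\<close> and \<open>e\<^sup>-\<^sup>t X' + X\<^sub>t\<close> have the same law, a bounded Lipschitz \<open>h\<close> satisfies
  \<open>\<bar>P\<^sub>t h(x) - E h(X)\<bar> \<le> E min(2, e\<^sup>-\<^sup>t \<bar>x - X\<bar>)\<close>, which decays like \<open>e\<^sup>-\<^sup>\<epsilon>\<^sup>t\<close> by the moment of order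
  \<open>\<epsilon>\<close>; differentiating \<open>P\<^sub>t h\<close> gains a factor \<open>e\<^sup>-\<^sup>t\<close> each time.

  The link between \<open>\<nu>\<close> and the jump measure \<open>\<nu>'\<close> is that \<open>\<nu>\<close> is the image of \<open>dt \<otimes> \<nu>'\<close> under
  \<open>(t, u) \<mapsto> e\<^sup>-\<^sup>t u\<close>. It makes \<open>t \<mapsto> \<psi>(e\<^sup>-\<^sup>t \<xi>)\<close>, where \<open>\<psi>\<close> is the exponent of the law of \<open>X\<close>,
  differentiable with derivative given by the symbol of the Stein operator, and this is the Stein
  equation integrated in time for \<open>h(x) = cos (\<xi> \<bullet> x + \<theta>)\<close>. Both sides are continuous under
  pointwise convergence of \<open>h\<close> and its gradient with bounds on \<open>h\<close>, its gradient and the Lipschitz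
  constant of the gradient. Convolution with trigonometric kernels produces such an
  approximation of a smooth compactly supported \<open>h\<close> by trigonometric polynomials.
\<close>

subsection \<open>The radial parts of the two measures\<close>

text \<open>No density of \<open>-dk_x\<close> is at hand, since \<open>k x\<close> is merely
  continuous and monotone, and measurability in \<open>x\<close> is known only one radius at a time.
  The remedy is the layer cake: the radius becomes the generalised inverse \<open>q (x, y)\<close>
  of \<open>k x\<close> at a level \<open>y\<close>, and the pair \<open>(x, y)\<close> carries
  \<open>\<sigma>\<close> times Lebesgue measure. Both radial measures are read off from this one
  variable: \<open>-dk_x\<close> is the image of Lebesgue measure under \<open>q (x, y)\<close>, and
  k_x(r)/r dr is dr/r on (0, q(x,y)) integrated over y, which r = e^(-t) q(x,y) turns into an
  integral over time. The equation to be proved is kept integrated over time and jumps jointly. In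
  this form it is dominated by a bound that depends only on the constant \<open>C\<close> of the
  test function, hence survives limits, and it can be read in two orders: jumps first gives the time
  derivative of the semigroup, time first gives the Stein operator applied to the solution. Cosines
  need only the first reading, where everything is explicit; the second is used once, at the
  end.\<close>

definition nonneg_time :: "real measure" where
  "nonneg_time = restrict_space lborel {0..}"

lemma space_nonneg_time [simp]: "space nonneg_time = {0..}"
  by (simp add: nonneg_time_def)

lemma id_nonneg_time_borel [measurable]: "(\<lambda>t. t) \<in> borel_measurable nonneg_time"
  unfolding nonneg_time_def by (rule measurable_restrict_space1) simp

lemma sigma_finite_nonneg_time: "sigma_finite_measure nonneg_time"
  unfolding nonneg_time_def
  by (rule sigma_finite_measure_restrict_space) (auto simp: lborel.sigma_finite_measure_axioms)

lemma nn_integral_nonneg_time: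
  "(\<integral>\<^sup>+t. f t \<partial>nonneg_time) = (\<integral>\<^sup>+t. f t * indicator {0..} t \<partial>lborel)"
  unfolding nonneg_time_def by (subst nn_integral_restrict_space) auto

text \<open>Levels \<open>y \<le> 0\<close> receive the default 0. Levels above all values of
  \<open>g\<close> also receive 0, as the infimum of the whole half-line. The condition that the
  inverse be positive thus singles out the levels under the graph of \<open>g\<close>.\<close>

definition radial_inverse :: "(real \<Rightarrow> real) \<Rightarrow> real \<Rightarrow> real" where
  "radial_inverse g y = (if 0 < y then Inf {r. 0 < r \<and> g r \<le> y} else 0)"

context
  fixes g :: "real \<Rightarrow> real"
  assumes anti: "antimono_on {0<..} g"
    and cont: "continuous_on {0<..} g"
    and lim: "(g \<longlongrightarrow> 0) at_top"
begin

lemma sublevel_nonempty: "0 < y \<Longrightarrow> \<exists>r>0. g r \<le> y"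
proof -
  assume "0 < y"
  then have "\<forall>\<^sub>F r in at_top. g r < y"
    using lim by (simp add: order_tendstoD(2))
  then have "\<forall>\<^sub>F r in at_top. g r < y \<and> 0 < r"
    using eventually_gt_at_top[of 0] by eventually_elim auto
  then show ?thesis
    by (metis (no_types, lifting) eventually_at_top_linorder le_less order_refl)
qed

lemma radial_inverse_nonneg: "0 \<le> radial_inverse g y"
  unfolding radial_inverse_def using sublevel_nonempty[of y]
  by (auto intro!: cInf_greatest)

text \<open>Continuity makes this an equivalence even at the boundary: if \<open>g b\<close> exceeds
  \<open>y\<close>, then \<open>g\<close> still exceeds \<open>y\<close> a little to the right of
  \<open>b\<close>, and by monotonicity the infimum lies strictly beyond \<open>b\<close>. A
  downward jump at \<open>b\<close> would let the infimum equal \<open>b\<close>.\<close>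

lemma radial_inverse_le_iff:
  assumes "0 < y" "0 < b"
  shows "radial_inverse g y \<le> b \<longleftrightarrow> g b \<le> y"
proof
  assume "g b \<le> y"
  then show "radial_inverse g y \<le> b"
    unfolding radial_inverse_def using assms by (auto intro!: cInf_lower bdd_belowI[of _ 0])
next
  assume le: "radial_inverse g y \<le> b"
  show "g b \<le> y"
  proof (rule ccontr)
    assume "\<not> g b \<le> y"
    then have gb: "y < g b" by simp
    have "isCont g b"
      using cont assms(2) by (simp add: continuous_on_eq_continuous_at)
    then have "\<forall>\<^sub>F r in at b. y < g r"
      using gb by (simp add: isCont_def order_tendstoD(1))
    then obtain d where d: "d > 0" "\<And>r. r \<noteq> b \<Longrightarrow> dist r b < d \<Longrightarrow> y < g r"
      unfolding eventually_at by auto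
    have "b + d / 2 \<le> radial_inverse g y"
      unfolding radial_inverse_def
    proof (simp add: assms, rule cInf_greatest)
      show "{r. 0 < r \<and> g r \<le> y} \<noteq> {}"
        using sublevel_nonempty[OF assms(1)] by auto
      fix r assume r: "r \<in> {r. 0 < r \<and> g r \<le> y}"
      show "b + d / 2 \<le> r"
      proof (rule ccontr)
        assume "\<not> b + d / 2 \<le> r"
        then have "g (b + d / 2) \<le> g r"
          using anti r assms(2) d(1) by (auto simp: monotone_on_def)
        moreover have "y < g (b + d / 2)"
          using d(1) by (intro d(2)) (auto simp: dist_real_def)
        ultimately show False using r by auto
      qed
    qed
    then show False using le d(1) by simp
  qed
qed

text \<open>The layer-cake form: for fixed \<open>b\<close> the admissible levels fill the interval
  from 0 to \<open>g b\<close>, so their Lebesgue measure recovers \<open>g b\<close>.\<close>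

lemma less_radial_inverse_iff:
  assumes "0 < b" shows "b < radial_inverse g y \<longleftrightarrow> 0 < y \<and> y < g b"
  using radial_inverse_le_iff[of y b] assms by (force simp: radial_inverse_def)

text \<open>The image of Lebesgue measure under the inverse gives \<open>{a<..b}\<close> the length
  of the levels between \<open>g b\<close> and \<open>g a\<close>, which is the Stieltjes mass. The
  comparison is made after taking \<open>ln\<close>, the coordinate in which
  \<open>neg_stieltjes\<close> is an \<open>interval_measure\<close>, and half-open intervals
  generate the Borel sets.\<close>

lemma emeasure_neg_stieltjes:
  assumes q [measurable]: "radial_inverse g \<in> borel_measurable borel" and A: "A \<in> sets borel"
    and nonneg: "\<And>r. 0 < r \<Longrightarrow> 0 \<le> g r"
  shows "emeasure (neg_stieltjes g) A =
    (\<integral>\<^sup>+y. indicator {0<..} (radial_inverse g y) * indicator A (radial_inverse g y) \<partial>lborel)"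
proof -
  let ?D = "density lborel (\<lambda>y. indicator {0<..} (radial_inverse g y))"
  let ?M = "distr ?D borel (\<lambda>y. ln (radial_inverse g y))"
  let ?F = "\<lambda>s. - g (exp s)"
  have mono: "?F s \<le> ?F t" if "s \<le> t" for s t
    using anti that by (auto simp: monotone_on_def)
  have "continuous_on UNIV ?F"
    by (intro continuous_intros continuous_on_compose2[OF cont]) auto
  then have rc: "continuous (at_right s) ?F" for s
    by (simp add: continuous_on_eq_continuous_within continuous_at_imp_continuous_at_within)
  have M: "emeasure ?M {a<..b} = emeasure (interval_measure ?F) {a<..b}" if "a \<le> b" for a b
  proof -
    have iff: "(0 < radial_inverse g y \<and> a < ln (radial_inverse g y) \<and> ln (radial_inverse g y) \<le> b)
        \<longleftrightarrow> y \<in> {y. 0 < y \<and> g (exp b) \<le> y \<and> y < g (exp a)}" for y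
    proof -
      have "(0 < radial_inverse g y \<and> a < ln (radial_inverse g y) \<and> ln (radial_inverse g y) \<le> b)
          \<longleftrightarrow> (exp a < radial_inverse g y \<and> \<not> exp b < radial_inverse g y)"
        by (smt (verit) exp_gt_zero exp_less_mono exp_ln ln_exp ln_less_cancel_iff)
      then show ?thesis
        by (auto simp: less_radial_inverse_iff)
    qed
    have "emeasure ?M {a<..b} = emeasure ?D ((\<lambda>y. ln (radial_inverse g y)) -` {a<..b})"
      by (subst emeasure_distr) (auto simp: space_density)
    also have "\<dots> = (\<integral>\<^sup>+y. indicator {0<..} (radial_inverse g y) *
        indicator ((\<lambda>y. ln (radial_inverse g y)) -` {a<..b}) y \<partial>lborel)"
      by (rule emeasure_density)
        (use measurable_sets_borel[of "\<lambda>y. ln (radial_inverse g y)" borel "{a<..b}"] in auto)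
    also have "\<dots> = (\<integral>\<^sup>+y. indicator {y. 0 < y \<and> g (exp b) \<le> y \<and> y < g (exp a)} y \<partial>lborel)"
      by (rule nn_integral_cong) (use iff in \<open>auto simp: indicator_def\<close>)
    also have "\<dots> = emeasure lborel {y. 0 < y \<and> g (exp b) \<le> y \<and> y < g (exp a)}"
      by simp
    also have "\<dots> = ennreal (g (exp a) - g (exp b))"
    \<comment> \<open>When \<open>g (exp b)\<close> vanishes, the level 0 is excluded because its
      inverse is the default 0; the length of the interval is the same.\<close>
    proof (cases "0 < g (exp b)")
      case True
      then have "{y. 0 < y \<and> g (exp b) \<le> y \<and> y < g (exp a)} = {g (exp b)..<g (exp a)}" by auto
      then show ?thesis using mono[OF that] by simp
    next
      case False
      then have "g (exp b) = 0" using nonneg[of "exp b"] by simp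
      then have "{y. 0 < y \<and> g (exp b) \<le> y \<and> y < g (exp a)} = {g (exp b)<..<g (exp a)}" by auto
      then show ?thesis using mono[OF that] by simp
    qed
    also have "\<dots> = emeasure (interval_measure ?F) {a<..b}"
      using emeasure_interval_measure_Ioc[where F="?F", OF that mono rc] by simp
    finally show ?thesis .
  qed
  have eq: "interval_measure ?F = ?M"
  proof (rule measure_eqI_generator_eq[where \<Omega>=UNIV and E="range (\<lambda>(a, b). {a<..b::real})"
        and A="\<lambda>i. {- real (i::nat)<..real i}"])
    fix X assume "X \<in> range (\<lambda>(a, b). {a<..b::real})"
    then obtain a b where X: "X = {a<..b}" by auto
    then show "emeasure (interval_measure ?F) X = emeasure ?M X"
      using M[of a b] by (cases "a \<le> b") auto
  next
    show "(\<Union>i. {- real (i::nat)<..real i}) = UNIV"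
      by (rule UN_Ioc_eq_UNIV)
    fix i :: nat
    show "emeasure (interval_measure ?F) {- real i<..real i} \<noteq> \<infinity>"
      using emeasure_interval_measure_Ioc[where F="?F", OF _ mono rc, of "- real i" "real i"] by simp
  qed (auto simp: Int_stable_def borel_sigma_sets_Ioc)
  have "emeasure (neg_stieltjes g) A = emeasure (distr ?M borel exp) A"
    by (simp add: neg_stieltjes_def eq)
  also have "\<dots> = (\<integral>\<^sup>+y. indicator {0<..} (radial_inverse g y) * indicator A (radial_inverse g y) \<partial>lborel)"
  proof -
    have [measurable]: "exp -` A \<in> sets borel" "A \<in> sets borel"
      using A measurable_sets_borel[of exp borel A] by simp_all
    have "emeasure (distr ?M borel exp) A = emeasure ?M (exp -` A)"
      by (subst emeasure_distr) auto
    also have "\<dots> = emeasure ?D ((\<lambda>y. ln (radial_inverse g y)) -` exp -` A)"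
      by (subst emeasure_distr) (auto simp: space_density)
    also have "\<dots> = (\<integral>\<^sup>+y. indicator {0<..} (radial_inverse g y) *
        indicator ((\<lambda>y. ln (radial_inverse g y)) -` exp -` A) y \<partial>lborel)"
      by (rule emeasure_density)
        (use measurable_sets_borel[of "\<lambda>y. ln (radial_inverse g y)" borel "exp -` A"] in auto)
    finally show ?thesis
      by (auto intro!: nn_integral_cong simp: indicator_def)
  qed
  finally show ?thesis .
qed

end


text \<open>The substitution r = e^(-t) q sends dr/r on (0, q) to dt on the half-line. It is carried
  out on compact pieces that exhaust (0, q] and extended by monotone convergence.\<close>

lemma nn_integral_exp_substitution:
  fixes f :: "real \<Rightarrow> ennreal"
  assumes [measurable]: "f \<in> borel_measurable borel" and q: "0 < q"
  shows "(\<integral>\<^sup>+r. indicator {0<..<q} r * ennreal (1 / r) * f r \<partial>lborel) =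
    (\<integral>\<^sup>+t. f (exp (- t) * q) \<partial>nonneg_time)"
proof -
  \<comment> \<open>\<open>Suc n\<close> instead of \<open>n\<close> keeps the piece a nondegenerate
    interval for every \<open>n\<close>.\<close>
  have sub: "(\<integral>\<^sup>+r. (ennreal (1 / r) * f r) * indicator {q * exp (- real (Suc n))..q} r \<partial>lborel) =
      (\<integral>\<^sup>+s. f (q * exp s) * indicator {- real (Suc n)..0} s \<partial>lborel)" for n
  proof -
    have "(\<integral>\<^sup>+r. (ennreal (1 / r) * f r) * indicator {q * exp (- real (Suc n))..q * exp 0} r \<partial>lborel) =
      (\<integral>\<^sup>+s. ennreal (1 / (q * exp s)) * f (q * exp s) * ennreal (q * exp s) * indicator {- real (Suc n)..0} s \<partial>lborel)"
      by (rule nn_integral_substitution_aux)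
        (auto intro!: derivative_eq_intros continuous_intros simp: less_imp_le[OF q] q set_borel_measurable_def)
    also have "\<dots> = (\<integral>\<^sup>+s. f (q * exp s) * indicator {- real (Suc n)..0} s \<partial>lborel)"
    proof (rule nn_integral_cong)
      fix s
      have "ennreal (1 / (q * exp s)) * f (q * exp s) * ennreal (q * exp s) =
          (ennreal (1 / (q * exp s)) * ennreal (q * exp s)) * f (q * exp s)"
        by (simp add: ac_simps)
      also have "ennreal (1 / (q * exp s)) * ennreal (q * exp s) = 1"
        using q by (simp flip: ennreal_mult)
      finally show "ennreal (1 / (q * exp s)) * f (q * exp s) * ennreal (q * exp s) * indicator {- real (Suc n)..0} s
          = f (q * exp s) * indicator {- real (Suc n)..0} s" by simp
    qed
    finally show ?thesis by simp
  qed
  have "(\<integral>\<^sup>+r. indicator {0<..<q} r * ennreal (1 / r) * f r \<partial>lborel)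
      = (\<integral>\<^sup>+r. (SUP n. (ennreal (1 / r) * f r) * indicator {q * exp (- real (Suc n))..q} r) \<partial>lborel)"
  \<comment> \<open>The closed pieces contain the endpoint \<open>q\<close>, so the two integrands
    agree only off the null set \<open>{q}\<close>.\<close>
  proof (rule nn_integral_cong_AE)
    show "AE r in lborel. indicator {0<..<q} r * ennreal (1 / r) * f r =
        (SUP n. ennreal (1 / r) * f r * indicator {q * exp (- real (Suc n))..q} r)"
      using AE_lborel_singleton[of q]
    proof eventually_elim
      case (elim r)
      have "(SUP n. indicator {q * exp (- real (Suc n))..q} r) = (indicator {0<..<q} r :: ennreal)"
      proof (cases "0 < r \<and> r < q")
        case True
        obtain n where n: "ln (q / r) \<le> real n"
          using real_arch_simple by blast
        have "q / r = exp (ln (q / r))"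
          using True q by simp
        also have "\<dots> \<le> exp (real (Suc n))"
          using n by (subst exp_le_cancel_iff) simp
        finally have "q / r \<le> exp (real (Suc n))" .
        then have "q * exp (- real (Suc n)) \<le> r"
          using True by (simp add: exp_minus field_simps del: of_nat_Suc)
        then have "indicator {q * exp (- real (Suc n))..q} r = (1::ennreal)"
          using True by (simp del: of_nat_Suc)
        then show ?thesis
          using True by (intro antisym SUP_least SUP_upper2[of n]) (auto simp: indicator_def)
      next
        case False
        have "indicator {q * exp (- real (Suc n))..q} r = (0::ennreal)" for n
        proof -
          have "0 < q * exp (- real (Suc n))" using q by simp
          then show ?thesis using False elim by (auto simp: indicator_def)
        qed
        then show ?thesis using False by auto
      qed
      then show ?case
        by (simp add: SUP_mult_left_ennreal[symmetric] ac_simps)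
    qed
  qed
  also have "\<dots> = (SUP n. \<integral>\<^sup>+r. (ennreal (1 / r) * f r) * indicator {q * exp (- real (Suc n))..q} r \<partial>lborel)"
  proof (rule nn_integral_monotone_convergence_SUP)
    show "incseq (\<lambda>n r. ennreal (1 / r) * f r * indicator {q * exp (- real (Suc n))..q} r)"
      using q by (intro incseq_SucI le_funI mult_left_mono) (auto simp: indicator_def elim: order_trans[rotated])
  qed auto
  also have "\<dots> = (SUP n. \<integral>\<^sup>+s. f (q * exp s) * indicator {- real (Suc n)..0} s \<partial>lborel)"
    by (simp only: sub)
  also have "\<dots> = (\<integral>\<^sup>+s. (SUP n. f (q * exp s) * indicator {- real (Suc n)..0} s) \<partial>lborel)"
  proof (rule nn_integral_monotone_convergence_SUP[symmetric])
    show "incseq (\<lambda>n s. f (q * exp s) * indicator {- real (Suc n)..0} s)"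
      by (intro incseq_SucI le_funI mult_left_mono) (auto simp: indicator_def)
  qed auto
  also have "\<dots> = (\<integral>\<^sup>+s. f (q * exp s) * indicator {..0} s \<partial>lborel)"
  proof (rule nn_integral_cong)
    fix s :: real
    obtain n where n: "- s \<le> real n"
      using real_arch_simple by blast
    have "(SUP n. indicator {- real (Suc n)..0} s) = (indicator {..0} s :: ennreal)"
      using n by (intro antisym SUP_least SUP_upper2[of n]) (auto simp: indicator_def)
    then show "(SUP n. f (q * exp s) * indicator {- real (Suc n)..0} s) = f (q * exp s) * indicator {..0} s"
      by (simp add: SUP_mult_left_ennreal[symmetric])
  qed
  also have "\<dots> = (\<integral>\<^sup>+t. f (q * exp (- t)) * indicator {..0} (- t) \<partial>lborel)"
    by (subst nn_integral_real_affine[where c="-1" and t=0]) auto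
  also have "\<dots> = (\<integral>\<^sup>+t. f (exp (- t) * q) \<partial>nonneg_time)"
    by (subst nn_integral_nonneg_time) (auto intro!: nn_integral_cong simp: indicator_def ac_simps)
  finally show ?thesis .
qed

section \<open>Polar measures as images of a product measure\<close>

locale polar_family =
  fixes \<sigma> :: "'a::euclidean_space measure" and k :: "'a \<Rightarrow> real \<Rightarrow> real"
  assumes finite_\<sigma>: "finite_measure \<sigma>"
    and sets_\<sigma>: "sets \<sigma> = sets (restrict_space borel (sphere 0 1))"
    and k_nonneg: "\<And>x r. x \<in> sphere 0 1 \<Longrightarrow> 0 < r \<Longrightarrow> 0 \<le> k x r"
    and k_antimono: "\<And>x. x \<in> sphere 0 1 \<Longrightarrow> antimono_on {0<..} (k x)"
    and k_continuous: "\<And>x. x \<in> sphere 0 1 \<Longrightarrow> continuous_on {0<..} (k x)"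
    and k_tendsto: "\<And>x. x \<in> sphere 0 1 \<Longrightarrow> (k x \<longlongrightarrow> 0) at_top"
    and k_measurable: "\<And>r. 0 < r \<Longrightarrow> (\<lambda>x. k x r) \<in> borel_measurable \<sigma>"
begin

sublocale finite_measure \<sigma> by (rule finite_\<sigma>)

sublocale P: pair_sigma_finite \<sigma> lborel ..

lemma space_\<sigma>: "space \<sigma> = sphere 0 1"
  using sets_eq_imp_space_eq[OF sets_\<sigma>] by (simp add: space_restrict_space)

lemma id_measurable_\<sigma> [measurable]: "(\<lambda>x. x) \<in> borel_measurable \<sigma>"
  by (subst measurable_cong_sets[OF sets_\<sigma> refl], rule measurable_restrict_space1) simp

abbreviation q :: "'a \<times> real \<Rightarrow> real" where
  "q p \<equiv> radial_inverse (k (fst p)) (snd p)"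

lemma q_nonneg: "x \<in> sphere 0 1 \<Longrightarrow> 0 \<le> q (x, y)"
  using radial_inverse_nonneg[OF k_antimono k_continuous k_tendsto] by simp

lemma less_q_iff: "x \<in> sphere 0 1 \<Longrightarrow> 0 < b \<Longrightarrow> b < q (x, y) \<longleftrightarrow> 0 < y \<and> y < k x b"
  using less_radial_inverse_iff[OF k_antimono k_continuous k_tendsto] by simp

text \<open>Joint measurability in direction and level comes from measurability of \<open>k\<close>
  at fixed radii: by \<open>less_q_iff\<close> the set where \<open>q\<close> exceeds
  \<open>b > 0\<close> involves \<open>k\<close> only at the radius \<open>b\<close>. The level 0 is
  reached by a countable union, and negative levels give the whole space.\<close>

lemma q_measurable [measurable]: "q \<in> borel_measurable (\<sigma> \<Otimes>\<^sub>M lborel)"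
proof (rule borel_measurableI_greater)
  fix a :: real
  have pos: "{p \<in> space (\<sigma> \<Otimes>\<^sub>M lborel). b < q p} \<in> sets (\<sigma> \<Otimes>\<^sub>M lborel)" if "0 < b" for b
  proof -
    have [measurable]: "(\<lambda>x. k x b) \<in> borel_measurable \<sigma>"
      by (rule k_measurable) fact
    have "{p \<in> space (\<sigma> \<Otimes>\<^sub>M lborel). b < q p} =
        {p \<in> space (\<sigma> \<Otimes>\<^sub>M lborel). 0 < snd p \<and> snd p < k (fst p) b}"
      using less_q_iff[OF _ that] by (auto simp: space_pair_measure space_\<sigma>)
    also have "\<dots> \<in> sets (\<sigma> \<Otimes>\<^sub>M lborel)" by measurable
    finally show ?thesis .
  qed
  consider "0 < a" | "a = 0" | "a < 0" by linarith
  then show "{p \<in> space (\<sigma> \<Otimes>\<^sub>M lborel). a < q p} \<in> sets (\<sigma> \<Otimes>\<^sub>M lborel)"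
  proof cases
    case 2
    have "{p \<in> space (\<sigma> \<Otimes>\<^sub>M lborel). a < q p} =
        (\<Union>n. {p \<in> space (\<sigma> \<Otimes>\<^sub>M lborel). inverse (real (Suc n)) < q p})"
      using 2 by (auto simp del: of_nat_Suc dest: reals_Archimedean intro: less_trans[rotated])
    also have "\<dots> \<in> sets (\<sigma> \<Otimes>\<^sub>M lborel)"
      using pos by (intro sets.countable_UN) (auto simp del: of_nat_Suc)
    finally show ?thesis .
  next
    case 3
    then have "{p \<in> space (\<sigma> \<Otimes>\<^sub>M lborel). a < q p} = space (\<sigma> \<Otimes>\<^sub>M lborel)"
      by (auto simp: space_pair_measure space_\<sigma> intro: less_le_trans[OF _ q_nonneg])
    then show ?thesis by (metis sets.top)
  qed (rule pos)
qed

lemma q_measurable' [measurable]: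
  assumes "f \<in> measurable M \<sigma>" "g \<in> borel_measurable M"
  shows "(\<lambda>w. radial_inverse (k (f w)) (g w)) \<in> borel_measurable M"
proof -
  have "(\<lambda>w. (f w, g w)) \<in> measurable M (\<sigma> \<Otimes>\<^sub>M lborel)"
    using assms by simp
  from measurable_compose[OF this q_measurable] show ?thesis by simp
qed

text \<open>Restriction of \<open>\<sigma> \<Otimes>\<^sub>M lborel\<close> to the region under the
  graphs of the functions \<open>k x\<close>; elsewhere the inverse is 0 and would put spurious mass
  at the origin.\<close>

definition W :: "('a \<times> real) measure" where
  "W = density (\<sigma> \<Otimes>\<^sub>M lborel) (\<lambda>p. indicator {0<..} (q p))"

lemma sets_W [measurable_cong]: "sets W = sets (\<sigma> \<Otimes>\<^sub>M lborel)"
  by (simp add: W_def)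

lemma nn_integral_W:
  assumes [measurable]: "F \<in> borel_measurable (\<sigma> \<Otimes>\<^sub>M lborel)"
  shows "(\<integral>\<^sup>+p. F p \<partial>W) = (\<integral>\<^sup>+x. \<integral>\<^sup>+y. indicator {0<..} (q (x, y)) * F (x, y) \<partial>lborel \<partial>\<sigma>)"
  unfolding W_def
  by (subst nn_integral_density, measurable) (simp add: lborel.nn_integral_fst[symmetric])

abbreviation polar_map :: "'a \<times> real \<Rightarrow> 'a" where
  "polar_map p \<equiv> q p *\<^sub>R fst p"

lemma polar_map_measurable [measurable]: "polar_map \<in> measurable W borel"
  by measurable

lemma radial_inverse_measurable_y: "x \<in> sphere 0 1 \<Longrightarrow> radial_inverse (k x) \<in> borel_measurable borel"
  using measurable_compose[OF measurable_Pair1' q_measurable, of x] by (simp add: space_\<sigma>)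

lemma emeasure_neg_stieltjes_k:
  assumes "x \<in> sphere 0 1" and A: "A \<in> sets borel"
  shows "emeasure (neg_stieltjes (k x)) ((\<lambda>r. r *\<^sub>R x) -` A) =
    (\<integral>\<^sup>+y. indicator {0<..} (q (x, y)) * indicator A (polar_map (x, y)) \<partial>lborel)"
proof -
  have "(\<lambda>r. r *\<^sub>R x) -` A \<in> sets borel"
    using measurable_sets_borel[of "\<lambda>r. r *\<^sub>R x" borel A] A by simp
  then show ?thesis
    by (subst emeasure_neg_stieltjes[OF k_antimono k_continuous k_tendsto radial_inverse_measurable_y])
      (use assms k_nonneg in \<open>auto intro!: nn_integral_cong simp: indicator_def\<close>)
qed

text \<open>Replaces the measure built from a family of Stieltjes measures by an image of a product
  measure, which is what makes Tonelli applicable. The measurability in \<open>x\<close> required by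
  \<open>emeasure_polar_measure\<close> comes for free from the integral over levels.\<close>

lemma nu_tilde_eq: "nu_tilde \<sigma> k = distr W borel polar_map"
proof (rule measure_eqI)
  fix A assume "A \<in> sets (nu_tilde \<sigma> k)"
  then have A [measurable]: "A \<in> sets borel" by (simp add: nu_tilde_def)
  have "(\<lambda>x. emeasure (neg_stieltjes (k x)) ((\<lambda>r. r *\<^sub>R x) -` B)) \<in> borel_measurable \<sigma>"
    if [measurable]: "B \<in> sets borel" for B
    by (subst measurable_cong[OF emeasure_neg_stieltjes_k]) (auto simp: space_\<sigma>)
  then have "emeasure (nu_tilde \<sigma> k) A =
      (\<integral>\<^sup>+x. emeasure (neg_stieltjes (k x)) ((\<lambda>r. r *\<^sub>R x) -` A) \<partial>\<sigma>)"
    unfolding nu_tilde_def by (intro emeasure_polar_measure A) (simp_all add: neg_stieltjes_def)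
  also have "\<dots> = (\<integral>\<^sup>+x. \<integral>\<^sup>+y. indicator {0<..} (q (x, y)) * indicator A (polar_map (x, y)) \<partial>lborel \<partial>\<sigma>)"
    by (intro nn_integral_cong emeasure_neg_stieltjes_k) (auto simp: space_\<sigma>)
  also have "\<dots> = (\<integral>\<^sup>+p. indicator A (polar_map p) \<partial>W)"
    by (subst nn_integral_W) auto
  also have "\<dots> = (\<integral>\<^sup>+p. indicator A p \<partial>distr W borel polar_map)"
    by (subst nn_integral_distr) auto
  also have "\<dots> = emeasure (distr W borel polar_map) A"
    by simp
  finally show "emeasure (nu_tilde \<sigma> k) A = emeasure (distr W borel polar_map) A" .
qed (simp add: nu_tilde_def)

abbreviation "\<nu>' \<equiv> nu_tilde \<sigma> k"

lemma sets_nu_tilde [simp, measurable_cong]: "sets \<nu>' = sets borel"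
  by (simp add: nu_tilde_def)

lemma nn_integral_nu_tilde:
  assumes [measurable]: "F \<in> borel_measurable borel"
  shows "(\<integral>\<^sup>+u. F u \<partial>\<nu>') = (\<integral>\<^sup>+x. \<integral>\<^sup>+y. indicator {0<..} (q (x, y)) * F (polar_map (x, y)) \<partial>lborel \<partial>\<sigma>)"
  unfolding nu_tilde_eq by (subst nn_integral_distr) (auto simp: nn_integral_W)

lemma nu_tilde_zero: "emeasure \<nu>' {0} = 0"
proof -
  have "emeasure \<nu>' {0} = (\<integral>\<^sup>+u. indicator {0} u \<partial>\<nu>')" by simp
  also have "\<dots> = (\<integral>\<^sup>+x. \<integral>\<^sup>+y. indicator {0<..} (q (x, y)) * indicator {0} (polar_map (x, y)) \<partial>lborel \<partial>\<sigma>)"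
    by (subst nn_integral_nu_tilde) auto
  also have "\<dots> = (\<integral>\<^sup>+x. \<integral>\<^sup>+(y::real). 0 \<partial>lborel \<partial>\<sigma>)"
  proof (intro nn_integral_cong)
    fix x y assume "x \<in> space \<sigma>"
    then have "norm x = 1" by (simp add: space_\<sigma>)
    then have "x \<noteq> 0" by auto
    then show "indicator {0<..} (q (x, y)) * indicator {0} (polar_map (x, y)) = (0::ennreal)"
      by (simp add: indicator_def)
  qed
  finally show ?thesis by simp
qed

abbreviation "radial_density x \<equiv> density lborel (\<lambda>r. indicator {0<..} r * ennreal (k x r / r))"

text \<open>Layer cake: \<open>k x r\<close> is the length of the set of levels \<open>y\<close>
  with \<open>r < q (x, y)\<close>.\<close>

lemma radial_density_eq:
  assumes "x \<in> sphere 0 1"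
  shows "indicator {0<..} r * ennreal (k x r / r) =
    (\<integral>\<^sup>+y. indicator {0<..<q (x, y)} r * ennreal (1 / r) \<partial>lborel)"
proof (cases "0 < r")
  case True
  have "(\<integral>\<^sup>+y. indicator {0<..<q (x, y)} r * ennreal (1 / r) \<partial>lborel) =
      (\<integral>\<^sup>+y. ennreal (1 / r) * indicator {0<..<k x r} y \<partial>lborel)"
    using less_q_iff[OF assms True] True by (intro nn_integral_cong) (auto simp: indicator_def)
  also have "\<dots> = ennreal (1 / r) * ennreal (k x r)"
    using k_nonneg[OF assms True] by (subst nn_integral_cmult_indicator) auto
  also have "\<dots> = ennreal (k x r / r)"
    using True k_nonneg[OF assms True] by (subst ennreal_mult[symmetric]) auto
  finally show ?thesis using True by simp
qed (simp add: indicator_def)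

lemma emeasure_radial_density:
  assumes x: "x \<in> sphere 0 1" and A [measurable]: "A \<in> sets borel"
  shows "emeasure (radial_density x) ((\<lambda>r. r *\<^sub>R x) -` A) =
    (\<integral>\<^sup>+y. indicator {0<..} (q (x, y)) *
       (\<integral>\<^sup>+t. indicator A (exp (- t) *\<^sub>R polar_map (x, y)) \<partial>nonneg_time) \<partial>lborel)"
proof -
  note [measurable] = radial_inverse_measurable_y[OF x]
  have [measurable]: "(\<lambda>r. r *\<^sub>R x) -` A \<in> sets borel"
    using measurable_sets_borel[of "\<lambda>r. r *\<^sub>R x" borel A] A by simp
  have "emeasure (radial_density x) ((\<lambda>r. r *\<^sub>R x) -` A) =
      (\<integral>\<^sup>+r. indicator {0<..} r * ennreal (k x r / r) * indicator ((\<lambda>r. r *\<^sub>R x) -` A) r \<partial>lborel)"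
    unfolding radial_density_eq[OF x] by (subst emeasure_density) (auto simp: indicator_def)
  also have "\<dots> = (\<integral>\<^sup>+r. \<integral>\<^sup>+y. indicator {0<..<q (x, y)} r * ennreal (1 / r) * indicator A (r *\<^sub>R x) \<partial>lborel \<partial>lborel)"
    unfolding radial_density_eq[OF x]
    by (intro nn_integral_cong, subst nn_integral_multc) (auto simp: indicator_def)
  also have "\<dots> = (\<integral>\<^sup>+y. \<integral>\<^sup>+r. indicator {0<..<q (x, y)} r * ennreal (1 / r) * indicator A (r *\<^sub>R x) \<partial>lborel \<partial>lborel)"
    by (rule lborel_pair.Fubini') (simp add: indicator_def)
  also have "\<dots> = (\<integral>\<^sup>+y. indicator {0<..} (q (x, y)) *
       (\<integral>\<^sup>+t. indicator A (exp (- t) *\<^sub>R polar_map (x, y)) \<partial>nonneg_time) \<partial>lborel)"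
  proof (rule nn_integral_cong)
    fix y :: real
    show "(\<integral>\<^sup>+r. indicator {0<..<q (x, y)} r * ennreal (1 / r) * indicator A (r *\<^sub>R x) \<partial>lborel) =
      indicator {0<..} (q (x, y)) * (\<integral>\<^sup>+t. indicator A (exp (- t) *\<^sub>R polar_map (x, y)) \<partial>nonneg_time)"
    proof (cases "0 < q (x, y)")
      case True
      then show ?thesis
        using nn_integral_exp_substitution[of "\<lambda>r. indicator A (r *\<^sub>R x)" "q (x, y)"] by simp
    qed simp
  qed
  finally show ?thesis .
qed

text \<open>A jump of size q travels through all radii below q, and uniform time along e^(-t) q has
  radial density 1/r; summing over the levels gives k_x(r)/r. Time is interchanged with level and
  direction separately, because \<open>\<nu>'\<close> is not yet known to be sigma-finite at this
  point.\<close>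

lemma emeasure_polar_density:
  assumes A [measurable]: "A \<in> sets borel"
  shows "emeasure (polar_measure \<sigma> radial_density) A =
    (\<integral>\<^sup>+t. \<integral>\<^sup>+u. indicator A (exp (- t) *\<^sub>R u) \<partial>\<nu>' \<partial>nonneg_time)"
proof -
  interpret T: sigma_finite_measure nonneg_time by (rule sigma_finite_nonneg_time)
  interpret Tl: pair_sigma_finite lborel nonneg_time ..
  interpret Ts: pair_sigma_finite \<sigma> nonneg_time ..
  have "emeasure (polar_measure \<sigma> radial_density) A =
      (\<integral>\<^sup>+x. emeasure (radial_density x) ((\<lambda>r. r *\<^sub>R x) -` A) \<partial>\<sigma>)"
  proof (intro emeasure_polar_measure A)
    fix B :: "'a set" assume [measurable]: "B \<in> sets borel"
    show "(\<lambda>x. emeasure (radial_density x) ((\<lambda>r. r *\<^sub>R x) -` B)) \<in> borel_measurable \<sigma>"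
      by (subst measurable_cong[OF emeasure_radial_density]) (auto simp: space_\<sigma>)
  qed simp
  also have "\<dots> = (\<integral>\<^sup>+x. \<integral>\<^sup>+y. indicator {0<..} (q (x, y)) *
       (\<integral>\<^sup>+t. indicator A (exp (- t) *\<^sub>R polar_map (x, y)) \<partial>nonneg_time) \<partial>lborel \<partial>\<sigma>)"
    by (intro nn_integral_cong emeasure_radial_density) (auto simp: space_\<sigma>)
  also have "\<dots> = (\<integral>\<^sup>+x. \<integral>\<^sup>+y. \<integral>\<^sup>+t. indicator {0<..} (q (x, y)) *
       indicator A (exp (- t) *\<^sub>R polar_map (x, y)) \<partial>nonneg_time \<partial>lborel \<partial>\<sigma>)"
  proof (intro nn_integral_cong)
    fix x y assume x: "x \<in> space \<sigma>"
    show "indicator {0<..} (q (x, y)) * (\<integral>\<^sup>+t. indicator A (exp (- t) *\<^sub>R polar_map (x, y)) \<partial>nonneg_time) =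
      (\<integral>\<^sup>+t. indicator {0<..} (q (x, y)) * indicator A (exp (- t) *\<^sub>R polar_map (x, y)) \<partial>nonneg_time)"
      by (subst nn_integral_cmult) auto
  qed
  also have "\<dots> = (\<integral>\<^sup>+x. \<integral>\<^sup>+t. \<integral>\<^sup>+y. indicator {0<..} (q (x, y)) *
       indicator A (exp (- t) *\<^sub>R polar_map (x, y)) \<partial>lborel \<partial>nonneg_time \<partial>\<sigma>)"
  proof (intro nn_integral_cong Tl.Fubini'[symmetric])
    fix x assume x: "x \<in> space \<sigma>"
    define R where "R = radial_inverse (k x)"
    have [measurable]: "R \<in> borel_measurable borel"
      unfolding R_def using x by (intro radial_inverse_measurable_y) (simp add: space_\<sigma>)
    show "(\<lambda>(y, t). indicator {0<..} (q (x, y)) * indicator A (exp (- t) *\<^sub>R polar_map (x, y)) :: ennreal)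
        \<in> borel_measurable (lborel \<Otimes>\<^sub>M nonneg_time)"
      unfolding fst_conv snd_conv R_def[symmetric] by measurable
  qed
  also have "\<dots> = (\<integral>\<^sup>+t. \<integral>\<^sup>+x. \<integral>\<^sup>+y. indicator {0<..} (q (x, y)) *
       indicator A (exp (- t) *\<^sub>R polar_map (x, y)) \<partial>lborel \<partial>\<sigma> \<partial>nonneg_time)"
    by (intro Ts.Fubini'[symmetric]) simp
  also have "\<dots> = (\<integral>\<^sup>+t. \<integral>\<^sup>+u. indicator A (exp (- t) *\<^sub>R u) \<partial>\<nu>' \<partial>nonneg_time)"
    by (intro nn_integral_cong) (subst nn_integral_nu_tilde, auto)
  finally show ?thesis .
qed

end

subsection \<open>The original measure as an image of the jump measure\<close>

locale polar_levy = polar_family \<sigma> k for \<sigma> :: "'a::euclidean_space measure" and k +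
  fixes \<nu> :: "'a measure"
  assumes nu_def: "\<nu> = polar_measure \<sigma> radial_density"
    and levy: "levy_measure \<nu>"
begin

lemma sets_nu [simp, measurable_cong]: "sets \<nu> = sets borel"
  using levy by (simp add: levy_measure_def)

declare id_measurable_\<sigma> [measurable del]

lemma nu_tail_finite:
  assumes "0 < r"
  shows "emeasure \<nu> {u. r < norm u} < \<infinity>"
proof -
  let ?c = "min 1 (r\<^sup>2)"
  have "ennreal ?c * emeasure \<nu> {u. r < norm u} = (\<integral>\<^sup>+u. ennreal ?c * indicator {u. r < norm u} u \<partial>\<nu>)"
    by (subst nn_integral_cmult_indicator) auto
  also have "\<dots> \<le> (\<integral>\<^sup>+u. ennreal (min 1 ((norm u)\<^sup>2)) \<partial>\<nu>)"
  proof (intro nn_integral_mono)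
    fix u :: 'a
    have "r\<^sup>2 \<le> (norm u)\<^sup>2" if "r < norm u"
      using that assms by (intro power_mono) auto
    then show "ennreal ?c * indicator {u. r < norm u} u \<le> ennreal (min 1 ((norm u)\<^sup>2))"
      by (auto simp: indicator_def intro!: ennreal_leI)
  qed
  also have "\<dots> < \<infinity>"
    using levy by (simp add: levy_measure_def)
  finally have "ennreal ?c * emeasure \<nu> {u. r < norm u} < \<infinity>" .
  moreover have "0 < ?c"
    using assms by simp
  ultimately show ?thesis
    by (auto simp: ennreal_mult_less_top ennreal_eq_0_iff)
qed

text \<open>Within the first unit of time the flow contracts by at most the factor e. Every jump
  larger than \<open>r\<close> therefore spends a full unit of time outside the ball of radius r/e,
  and the time average of this is a tail of \<open>\<nu>\<close>.\<close>

lemma nu_tilde_tail_finite: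
  assumes "0 < r"
  shows "emeasure \<nu>' {u. r < norm u} < \<infinity>"
proof -
  have "emeasure \<nu>' {u. r < norm u} = (\<integral>\<^sup>+t. emeasure \<nu>' {u. r < norm u} * indicator {0..1::real} t \<partial>lborel)"
    by (subst nn_integral_cmult_indicator) auto
  also have "\<dots> \<le> (\<integral>\<^sup>+t. (\<integral>\<^sup>+u. indicator {u. r / exp 1 < norm u} (exp (- t) *\<^sub>R u) \<partial>\<nu>') * indicator {0..} t \<partial>lborel)"
  proof (rule nn_integral_mono)
    fix t :: real
    show "emeasure \<nu>' {u. r < norm u} * indicator {0..1} t \<le>
        (\<integral>\<^sup>+u. indicator {u. r / exp 1 < norm u} (exp (- t) *\<^sub>R u) \<partial>\<nu>') * indicator {0..} t"
    proof (cases "0 \<le> t \<and> t \<le> 1")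
      case True
      have "emeasure \<nu>' {u. r < norm u} = (\<integral>\<^sup>+u. indicator {u. r < norm u} u \<partial>\<nu>')"
        by simp
      also have "\<dots> \<le> (\<integral>\<^sup>+u. indicator {u. r / exp 1 < norm u} (exp (- t) *\<^sub>R u) \<partial>\<nu>')"
      proof (rule nn_integral_mono)
        fix u :: 'a
        have "r / exp 1 < exp (- t) * norm u" if "r < norm u"
        proof -
          have "r / exp 1 < norm u / exp 1" using that by (simp add: divide_strict_right_mono)
          also have "\<dots> = exp (- 1) * norm u" by (simp add: exp_minus field_simps)
          also have "\<dots> \<le> exp (- t) * norm u" using True by (intro mult_right_mono) auto
          finally show ?thesis .
        qed
        then show "indicator {u. r < norm u} u \<le> (indicator {u. r / exp 1 < norm u} (exp (- t) *\<^sub>R u) :: ennreal)"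
          by (auto simp: indicator_def)
      qed
      finally show ?thesis using True by simp
    qed (auto simp: indicator_def)
  qed
  also have "\<dots> = emeasure \<nu> {u. r / exp 1 < norm u}"
    unfolding nu_def by (subst emeasure_polar_density) (auto simp: nn_integral_nonneg_time)
  also have "\<dots> < \<infinity>"
    using assms by (intro nu_tail_finite) simp
  finally show ?thesis .
qed

text \<open>Gives access to Fubini on \<open>nonneg_time \<Otimes>\<^sub>M \<nu>'\<close>. The tails
  exhaust only the complement of the origin, so \<open>{0}\<close> is added as a null set.\<close>

lemma sigma_finite_nu_tilde: "sigma_finite_measure \<nu>'"
proof
  let ?A = "insert {0} ((\<lambda>n. {u::'a. inverse (real (Suc n)) < norm u}) ` UNIV)"
  have "\<Union>?A = UNIV"
  proof (intro set_eqI iffI UNIV_I)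
    fix u :: 'a
    show "u \<in> \<Union>?A"
    proof (cases "u = 0")
      case False
      then obtain n where "inverse (real (Suc n)) < norm u"
        using reals_Archimedean[of "norm u"] by auto
      then show ?thesis by auto
    qed simp
  qed
  then show "\<exists>A. countable A \<and> A \<subseteq> sets \<nu>' \<and> \<Union>A = space \<nu>' \<and> (\<forall>a\<in>A. emeasure \<nu>' a \<noteq> \<infinity>)"
    using nu_tilde_tail_finite[of "inverse (real (Suc n))" for n] nu_tilde_zero
    by (intro exI[of _ ?A]) (auto simp: less_top sets_eq_imp_space_eq[OF sets_nu_tilde] simp del: of_nat_Suc)
qed

sublocale N: sigma_finite_measure \<nu>' by (rule sigma_finite_nu_tilde)
sublocale T: sigma_finite_measure nonneg_time by (rule sigma_finite_nonneg_time)
sublocale TN: pair_sigma_finite nonneg_time \<nu>' ..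

lemma nu_eq_distr: "\<nu> = distr (nonneg_time \<Otimes>\<^sub>M \<nu>') borel (\<lambda>p. exp (- fst p) *\<^sub>R snd p)"
proof (rule measure_eqI)
  fix A assume "A \<in> sets \<nu>"
  then have [measurable]: "A \<in> sets borel" by simp
  have "emeasure \<nu> A = (\<integral>\<^sup>+t. \<integral>\<^sup>+u. indicator A (exp (- t) *\<^sub>R u) \<partial>\<nu>' \<partial>nonneg_time)"
    unfolding nu_def by (rule emeasure_polar_density) measurable
  also have "\<dots> = (\<integral>\<^sup>+p. indicator A (exp (- fst p) *\<^sub>R snd p) \<partial>(nonneg_time \<Otimes>\<^sub>M \<nu>'))"
    by (subst N.nn_integral_fst[symmetric]) auto
  also have "\<dots> = (\<integral>\<^sup>+p. indicator A p \<partial>distr (nonneg_time \<Otimes>\<^sub>M \<nu>') borel (\<lambda>p. exp (- fst p) *\<^sub>R snd p))"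
    by (subst nn_integral_distr) auto
  also have "\<dots> = emeasure (distr (nonneg_time \<Otimes>\<^sub>M \<nu>') borel (\<lambda>p. exp (- fst p) *\<^sub>R snd p)) A"
    by simp
  finally show "emeasure \<nu> A = emeasure (distr (nonneg_time \<Otimes>\<^sub>M \<nu>') borel (\<lambda>p. exp (- fst p) *\<^sub>R snd p)) A" .
qed simp

lemma nn_integral_nu:
  assumes [measurable]: "F \<in> borel_measurable borel"
  shows "(\<integral>\<^sup>+u. F u \<partial>\<nu>) = (\<integral>\<^sup>+t. \<integral>\<^sup>+u. F (exp (- t) *\<^sub>R u) \<partial>\<nu>' \<partial>nonneg_time)"
  by (subst nu_eq_distr, subst nn_integral_distr) (auto simp: N.nn_integral_fst[symmetric])

lemma integrable_nu_iff:
  fixes F :: "'a \<Rightarrow> 'b::{banach, second_countable_topology}"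
  assumes [measurable]: "F \<in> borel_measurable borel"
  shows "integrable \<nu> F \<longleftrightarrow> integrable (nonneg_time \<Otimes>\<^sub>M \<nu>') (\<lambda>p. F (exp (- fst p) *\<^sub>R snd p))"
  by (subst nu_eq_distr, subst integrable_distr_eq) auto

lemma integral_nu:
  fixes F :: "'a \<Rightarrow> 'b::{banach, second_countable_topology}"
  assumes [measurable]: "F \<in> borel_measurable borel"
  shows "(\<integral>u. F u \<partial>\<nu>) = (\<integral>p. F (exp (- fst p) *\<^sub>R snd p) \<partial>(nonneg_time \<Otimes>\<^sub>M \<nu>'))"
  by (subst nu_eq_distr, subst integral_distr) auto

lemma integrable_nu_min: "integrable \<nu> (\<lambda>u. min 1 ((norm u)\<^sup>2))"
proof (rule integrableI_nonneg)
  show "(\<lambda>u. min 1 ((norm u)\<^sup>2)) \<in> borel_measurable \<nu>" by measurable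
qed (use levy in \<open>auto simp: levy_measure_def\<close>)

lemma integrable_flow_min:
  "integrable (nonneg_time \<Otimes>\<^sub>M \<nu>') (\<lambda>p. min 1 ((exp (- fst p) * norm (snd p))\<^sup>2))"
  using integrable_nu_min by (subst (asm) integrable_nu_iff) auto

text \<open>The same window of unit length as for the tails: on it \<open>(norm u)\<^sup>2\<close>
  shrinks by at most \<open>exp (- 2)\<close>, so the integral against \<open>\<nu>'\<close> is
  controlled by the one against \<open>\<nu>\<close>.\<close>

lemma integrable_nu_tilde_min: "integrable \<nu>' (\<lambda>u. min 1 ((norm u)\<^sup>2))"
proof (rule integrableI_nonneg)
  have "ennreal (exp (- 2)) * (\<integral>\<^sup>+u. ennreal (min 1 ((norm u)\<^sup>2)) \<partial>\<nu>') =
      (\<integral>\<^sup>+t. (\<integral>\<^sup>+u. ennreal (exp (- 2)) * ennreal (min 1 ((norm u)\<^sup>2)) \<partial>\<nu>') * indicator {0..1::real} t \<partial>lborel)"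
    by (subst nn_integral_cmult_indicator, simp, subst nn_integral_cmult) auto
  also have "\<dots> \<le> (\<integral>\<^sup>+t. (\<integral>\<^sup>+u. ennreal (min 1 ((norm (exp (- t) *\<^sub>R u))\<^sup>2)) \<partial>\<nu>') * indicator {0..} t \<partial>lborel)"
  proof (rule nn_integral_mono)
    fix t :: real
    have "ennreal (exp (- 2)) * ennreal (min 1 ((norm u)\<^sup>2)) \<le> ennreal (min 1 ((norm (exp (- t) *\<^sub>R u))\<^sup>2))"
      if "0 \<le> t" "t \<le> 1" for u :: 'a
    proof -
      have "exp (- 2) \<le> (exp (- t))\<^sup>2"
        using that by (simp flip: exp_double)
      then have "exp (- 2) * (norm u)\<^sup>2 \<le> (norm (exp (- t) *\<^sub>R u))\<^sup>2"
        by (simp add: power_mult_distrib mult_right_mono)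
      moreover have "exp (- 2) \<le> (1::real)" by simp
      ultimately have "exp (- 2) * min 1 ((norm u)\<^sup>2) \<le> min 1 ((norm (exp (- t) *\<^sub>R u))\<^sup>2)"
        by (smt (verit, best) exp_gt_zero min_def mult_left_mono mult_left_le zero_le_power2)
      then show ?thesis
        by (subst ennreal_mult[symmetric]) (auto intro: ennreal_leI)
    qed
    then show "(\<integral>\<^sup>+u. ennreal (exp (- 2)) * ennreal (min 1 ((norm u)\<^sup>2)) \<partial>\<nu>') * indicator {0..1} t
        \<le> (\<integral>\<^sup>+u. ennreal (min 1 ((norm (exp (- t) *\<^sub>R u))\<^sup>2)) \<partial>\<nu>') * indicator {0..} t"
      by (auto simp: indicator_def intro!: nn_integral_mono)
  qed
  also have "\<dots> = (\<integral>\<^sup>+u. ennreal (min 1 ((norm u)\<^sup>2)) \<partial>\<nu>)"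
    by (subst nn_integral_nu) (auto simp: nn_integral_nonneg_time)
  also have "\<dots> < \<infinity>"
    using levy by (simp add: levy_measure_def)
  finally show "(\<integral>\<^sup>+u. ennreal (min 1 ((norm u)\<^sup>2)) \<partial>\<nu>') < \<infinity>"
    by (auto simp: ennreal_mult_less_top ennreal_eq_0_iff not_le)
qed auto

text \<open>Integrating over time first, this is the logarithmic moment of \<open>\<nu>'\<close>
  outside the unit ball. For jumps larger than 1, the first power of the contracted norm at time 2t
  is at most its square at time t, so doubling the time scale reduces the claim to the Levy
  integrability of \<open>\<nu>\<close>.\<close>

lemma integrable_flow_large:
  "integrable (nonneg_time \<Otimes>\<^sub>M \<nu>') (\<lambda>p. indicator {1<..} (norm (snd p)) * min 1 (exp (- fst p) * norm (snd p)))"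
proof (rule integrableI_nonneg)
  let ?f = "\<lambda>u t. ennreal (indicator {1<..} (norm u) * min 1 (exp (- t) * norm (u::'a)))"
  let ?g = "\<lambda>u t. ennreal (min 1 ((exp (- t) * norm (u::'a))\<^sup>2))"
  have *: "(\<integral>\<^sup>+t. ?f u t \<partial>nonneg_time) \<le> 2 * (\<integral>\<^sup>+t. ?g u t \<partial>nonneg_time)" for u
  proof -
    have "(\<integral>\<^sup>+t. ?f u t \<partial>nonneg_time) = (\<integral>\<^sup>+t. ?f u t * indicator {0..} t \<partial>lborel)"
      by (rule nn_integral_nonneg_time)
    also have "\<dots> = 2 * (\<integral>\<^sup>+t. ?f u (2 * t) * indicator {0..} (2 * t) \<partial>lborel)"
      by (subst nn_integral_real_affine[where c=2 and t=0]) auto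
    also have "\<dots> \<le> 2 * (\<integral>\<^sup>+t. ?g u t * indicator {0..} t \<partial>lborel)"
    proof (intro mult_left_mono nn_integral_mono)
      fix t :: real
      have "exp (- (2 * t)) * norm u \<le> (exp (- t) * norm u)\<^sup>2" if "1 < norm u"
      proof -
        have "exp (- (2 * t)) * norm u \<le> exp (- (2 * t)) * (norm u * norm u)"
          using that mult_left_mono[of 1 "norm u" "norm u"] by (intro mult_left_mono) auto
        also have "\<dots> = (exp (- t) * norm u)\<^sup>2"
          by (simp add: power_mult_distrib power2_eq_square exp_add[symmetric])
        finally show ?thesis .
      qed
      then show "?f u (2 * t) * indicator {0..} (2 * t) \<le> ?g u t * indicator {0..} t"
        by (auto simp: indicator_def intro!: ennreal_leI)
    qed simp
    finally show ?thesis
      by (simp add: nn_integral_nonneg_time)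
  qed
  have "(\<integral>\<^sup>+p. ?f (snd p) (fst p) \<partial>(nonneg_time \<Otimes>\<^sub>M \<nu>')) = (\<integral>\<^sup>+u. \<integral>\<^sup>+t. ?f u t \<partial>nonneg_time \<partial>\<nu>')"
    by (subst TN.nn_integral_snd[symmetric]) auto
  also have "\<dots> \<le> (\<integral>\<^sup>+u. 2 * (\<integral>\<^sup>+t. ?g u t \<partial>nonneg_time) \<partial>\<nu>')"
    by (intro nn_integral_mono *)
  also have "\<dots> = 2 * (\<integral>\<^sup>+u. \<integral>\<^sup>+t. ?g u t \<partial>nonneg_time \<partial>\<nu>')"
    by (subst nn_integral_cmult) auto
  also have "(\<integral>\<^sup>+u. \<integral>\<^sup>+t. ?g u t \<partial>nonneg_time \<partial>\<nu>') = (\<integral>\<^sup>+p. ?g (snd p) (fst p) \<partial>(nonneg_time \<Otimes>\<^sub>M \<nu>'))"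
    by (subst TN.nn_integral_snd[symmetric]) auto
  also have "2 * \<dots> < \<infinity>"
    using integrable_flow_min unfolding integrable_iff_bounded
    by (simp add: ennreal_mult_less_top)
  finally show "(\<integral>\<^sup>+p. ?f (snd p) (fst p) \<partial>(nonneg_time \<Otimes>\<^sub>M \<nu>')) < \<infinity>" .
qed auto

text \<open>In the direction \<open>x\<close> the measure \<open>-dk_x\<close> has mass
  \<open>k x 1\<close> beyond radius 1, because \<open>k x\<close> tends to 0. This identifies the
  drift correction in \<open>b_tilde\<close> with an integral against \<open>\<nu>'\<close>.\<close>

lemma
  defines "G \<equiv> \<lambda>u::'a. indicator {1<..} (norm u) *\<^sub>R (u /\<^sub>R norm u)"
  shows integrable_direction: "integrable \<nu>' G"
    and integral_direction: "(\<integral>u. G u \<partial>\<nu>') = (\<integral>x. k x 1 *\<^sub>R x \<partial>\<sigma>)"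
proof -
  have [measurable]: "G \<in> borel_measurable borel"
    unfolding G_def by measurable
  show int: "integrable \<nu>' G"
  proof (rule Bochner_Integration.integrable_bound)
    show "integrable \<nu>' (indicator {u::'a. 1 < norm u} :: 'a \<Rightarrow> real)"
      using nu_tilde_tail_finite[of 1] by (subst integrable_indicator_iff) auto
    show "G \<in> borel_measurable \<nu>'" by measurable
    show "AE u in \<nu>'. norm (G u) \<le> norm (indicator {u. 1 < norm u} u :: real)"
      by (intro always_eventually allI) (auto simp: G_def indicator_def field_simps)
  qed
  let ?H = "\<lambda>p. indicator {1<..} (q p) *\<^sub>R fst p"
  have GH: "indicator {0<..} (q p) *\<^sub>R G (polar_map p) = ?H p" if "p \<in> space (\<sigma> \<Otimes>\<^sub>M lborel)" for p
  proof -
    have "norm (fst p) = 1" using that by (auto simp: space_pair_measure space_\<sigma>)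
    then show ?thesis by (auto simp: G_def indicator_def)
  qed
  have W: "W = density (\<sigma> \<Otimes>\<^sub>M lborel) (\<lambda>p. ennreal (indicator {0<..} (q p)))"
    by (simp add: W_def ennreal_indicator)
  have "integrable (distr W borel polar_map) G"
    using int by (simp add: nu_tilde_eq)
  then have "integrable W (\<lambda>p. G (polar_map p))"
    by (subst (asm) integrable_distr_eq) auto
  then have "integrable (\<sigma> \<Otimes>\<^sub>M lborel) (\<lambda>p. indicator {0<..} (q p) *\<^sub>R G (polar_map p))"
    unfolding W by (subst (asm) integrable_density) auto
  then have iH: "integrable (\<sigma> \<Otimes>\<^sub>M lborel) ?H"
    by (subst (asm) Bochner_Integration.integrable_cong[OF refl GH])
  have "(\<integral>u. G u \<partial>\<nu>') = (\<integral>p. G (polar_map p) \<partial>W)"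
    unfolding nu_tilde_eq by (subst integral_distr) auto
  also have "\<dots> = (\<integral>p. indicator {0<..} (q p) *\<^sub>R G (polar_map p) \<partial>(\<sigma> \<Otimes>\<^sub>M lborel))"
    unfolding W by (subst integral_density) auto
  also have "\<dots> = (\<integral>p. ?H p \<partial>(\<sigma> \<Otimes>\<^sub>M lborel))"
    by (rule Bochner_Integration.integral_cong[OF refl GH])
  also have "\<dots> = (\<integral>x. \<integral>y. indicator {1<..} (q (x, y)) *\<^sub>R x \<partial>lborel \<partial>\<sigma>)"
    using P.integral_fst'[OF iH] by simp
  also have "\<dots> = (\<integral>x. k x 1 *\<^sub>R x \<partial>\<sigma>)"
  proof (rule Bochner_Integration.integral_cong[OF refl])
    fix x assume "x \<in> space \<sigma>"
    then have x: "x \<in> sphere 0 1" by (simp add: space_\<sigma>)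
    have "(\<integral>y. indicator {1<..} (q (x, y)) *\<^sub>R x \<partial>lborel) = (\<integral>y. indicator {0<..<k x 1} y *\<^sub>R x \<partial>lborel)"
      using less_q_iff[OF x, of 1] by (intro Bochner_Integration.integral_cong) (auto simp: indicator_def)
    also have "\<dots> = k x 1 *\<^sub>R x"
      using k_nonneg[OF x, of 1] by simp
    finally show "(\<integral>y. indicator {1<..} (q (x, y)) *\<^sub>R x \<partial>lborel) = k x 1 *\<^sub>R x" .
  qed
  finally show "(\<integral>u. G u \<partial>\<nu>') = (\<integral>x. k x 1 *\<^sub>R x \<partial>\<sigma>)" .
qed

end

subsection \<open>The characteristic exponent along the flow\<close>

lemma integrable_nonneg_time_iff:
  fixes f :: "real \<Rightarrow> 'b::{banach, second_countable_topology}"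
  shows "integrable nonneg_time f \<longleftrightarrow> set_integrable lborel {0..} f"
  unfolding nonneg_time_def set_integrable_def by (subst integrable_restrict_space) auto

lemma integral_nonneg_time:
  fixes f :: "real \<Rightarrow> 'b::{banach, second_countable_topology}"
  shows "(\<integral>t. f t \<partial>nonneg_time) = (LINT t:{0..}|lborel. f t)"
  unfolding nonneg_time_def set_lebesgue_integral_def by (subst integral_restrict_space) auto

lemma has_bochner_integral_exp:
  fixes c :: real assumes "0 < c"
  shows "has_bochner_integral nonneg_time (\<lambda>t. exp (- (c * t))) (1 / c)"
proof (rule has_bochner_integral_nn_integral)
  have "(\<integral>\<^sup>+t. ennreal (exp (- (c * t))) \<partial>nonneg_time) =
      (\<integral>\<^sup>+t. ennreal (exp (- (c * t))) * indicator {0..} t \<partial>lborel)"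
    by (rule nn_integral_nonneg_time)
  also have "\<dots> = ennreal (0 - (- exp (- (c * 0)) / c))"
  proof (rule nn_integral_FTC_atLeast)
    show "DERIV (\<lambda>t. - exp (- (c * t)) / c) t :> exp (- (c * t))" for t
      using assms by (auto intro!: derivative_eq_intros)
    have "filterlim (\<lambda>t. - (c * t)) at_bot at_top"
      using assms by (simp add: filterlim_uminus_at_bot filterlim_tendsto_pos_mult_at_top[OF tendsto_const] filterlim_ident)
    then have "((\<lambda>t. - exp (- (c * t)) / c) \<longlongrightarrow> - 0 / c) at_top"
      by (intro tendsto_intros filterlim_compose[OF exp_at_bot]) (use assms in auto)
    then show "((\<lambda>t. - exp (- (c * t)) / c) \<longlongrightarrow> 0) at_top" by simp
  qed auto
  finally show "(\<integral>\<^sup>+t. ennreal (exp (- (c * t))) \<partial>nonneg_time) = ennreal (1 / c)" by simp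
qed (use assms in auto)

lemma integrable_exp_nonneg_time: "0 < c \<Longrightarrow> integrable nonneg_time (\<lambda>t. exp (- (c * t)) :: real)"
  using has_bochner_integral_exp by (rule integrable.intros)

lemma AE_nonneg_time_neq: "AE t in nonneg_time. t \<noteq> l"
  unfolding nonneg_time_def
  by (subst AE_restrict_space_iff) (auto intro: AE_mp[OF AE_lborel_singleton])

lemma has_bochner_integral_exp_atMost:
  assumes "0 \<le> l"
  shows "has_bochner_integral nonneg_time (\<lambda>t. indicator {..l} t * exp (- t)) (1 - exp (- l))"
proof (rule has_bochner_integral_nn_integral)
  have "(\<integral>\<^sup>+t. ennreal (indicator {..l} t * exp (- t)) \<partial>nonneg_time) =
      (\<integral>\<^sup>+t. ennreal (exp (- t)) * indicator {0..l} t \<partial>lborel)"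
    by (subst nn_integral_nonneg_time) (auto intro!: nn_integral_cong simp: indicator_def)
  also have "\<dots> = ennreal (- exp (- l) - - exp (- 0))"
    using assms by (intro nn_integral_FTC_Icc) (auto intro!: derivative_eq_intros simp: has_real_derivative_iff_has_vector_derivative[symmetric])
  finally show "(\<integral>\<^sup>+t. ennreal (indicator {..l} t * exp (- t)) \<partial>nonneg_time) = ennreal (1 - exp (- l))"
    by (simp add: algebra_simps)
qed (use assms in auto)

lemma has_bochner_integral_exp_lessThan:
  assumes "0 \<le> l"
  shows "has_bochner_integral nonneg_time (\<lambda>t. indicator {..<l} t * exp (- t)) (1 - exp (- l))"
proof -
  have "AE t in nonneg_time. indicator {..l} t * exp (- t) = indicator {..<l} t * exp (- t)"
    using AE_nonneg_time_neq[of l] by eventually_elim (auto simp: indicator_def)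
  with has_bochner_integral_exp_atMost[OF assms] show ?thesis
    by (subst (asm) has_bochner_integral_cong_AE) auto
qed

text \<open>A shift by \<open>t\<close> loses exactly the initial segment of length
  \<open>t\<close>; its right endpoint is a null set.\<close>

lemma has_bochner_integral_shift_difference:
  fixes f :: "real \<Rightarrow> 'b::{banach, second_countable_topology}"
  assumes f: "integrable nonneg_time f" and "0 \<le> t"
    and [measurable]: "f \<in> borel_measurable borel"
  shows "has_bochner_integral nonneg_time (\<lambda>s. f s - f (s + t)) (\<integral>s. indicator {..t} s *\<^sub>R f s \<partial>nonneg_time)"
proof -
  let ?i = "\<lambda>s. indicator {0..} s *\<^sub>R f s" and ?j = "\<lambda>s. indicator {t..} s *\<^sub>R f s"
  have int: "integrable lborel ?i"
    using f by (simp add: integrable_nonneg_time_iff set_integrable_def)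
  then have intj: "integrable lborel ?j"
    by (rule Bochner_Integration.integrable_bound) (use \<open>0 \<le> t\<close> in \<open>auto simp: indicator_def\<close>)
  have shift: "(\<lambda>s. indicator {0..} s *\<^sub>R f (s + t)) = (\<lambda>s. ?j (t + 1 * s))"
    by (auto simp: indicator_def ac_simps)
  have ints: "integrable lborel (\<lambda>s. indicator {0..} s *\<^sub>R f (s + t))"
    unfolding shift using lborel_integrable_real_affine[OF intj, of 1 t] by simp
  have "(\<integral>s. indicator {0..} s *\<^sub>R f (s + t) \<partial>lborel) = (\<integral>s. ?j s \<partial>lborel)"
    unfolding shift using lborel_integral_real_affine[of 1 ?j t] by simp
  moreover have "(\<integral>s. ?i s \<partial>lborel) - (\<integral>s. ?j s \<partial>lborel) = (\<integral>s. indicator {0..} s *\<^sub>R indicator {..t} s *\<^sub>R f s \<partial>lborel)"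
  proof -
    have "AE s in lborel. ?i s - ?j s = indicator {0..} s *\<^sub>R indicator {..t} s *\<^sub>R f s"
      using AE_lborel_singleton[of t] by eventually_elim (use \<open>0 \<le> t\<close> in \<open>auto simp: indicator_def\<close>)
    then show ?thesis
      unfolding Bochner_Integration.integral_diff[OF int intj, symmetric] by (intro integral_cong_AE) auto
  qed
  ultimately show ?thesis
    using int ints
    by (auto simp: has_bochner_integral_iff integrable_nonneg_time_iff set_integrable_def
        integral_nonneg_time set_lebesgue_integral_def scaleR_diff_right)
qed

section \<open>The Levy-Khintchine integrand\<close>

definition levy_integrand :: "'a::euclidean_space \<Rightarrow> 'a \<Rightarrow> complex" where
  "levy_integrand \<xi> u = iexp (\<xi> \<bullet> u) - 1 - \<i> * complex_of_real (\<xi> \<bullet> u) * indicator (cball 0 1) u"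

lemma levy_integrand_measurable [measurable]:
  "(\<lambda>p. levy_integrand (fst p) (snd p)) \<in> borel_measurable (borel \<Otimes>\<^sub>M borel)"
proof -
  have [measurable]: "cball 0 1 \<in> sets (borel :: 'a measure)" by simp
  show ?thesis
    unfolding levy_integrand_def by measurable
qed

lemma levy_integrand_measurable' [measurable (raw)]:
  assumes "f \<in> borel_measurable M" "g \<in> borel_measurable M"
  shows "(\<lambda>x. levy_integrand (f x) (g x)) \<in> borel_measurable M"
  using measurable_compose[OF measurable_Pair[OF assms] levy_integrand_measurable] by simp

definition iexp_remainder :: "real \<Rightarrow> complex" where
  "iexp_remainder y = iexp y - 1 - \<i> * complex_of_real y"

lemma norm_iexp_remainder: "norm (iexp_remainder y) \<le> y\<^sup>2"
proof -
  have "norm (iexp_remainder y) \<le> \<bar>y\<bar>\<^sup>2 / 2"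
    using iexp_approx1[of y 1] by (simp add: iexp_remainder_def diff_diff_eq numeral_2_eq_2)
  then show ?thesis using zero_le_power2[of y] norm_ge_zero[of "iexp_remainder y"] unfolding power2_abs by linarith
qed

text \<open>The summand 2 bounds the integrand outside the unit ball, where no linear term is
  subtracted; \<open>(norm \<xi>)\<^sup>2\<close> bounds the second-order remainder inside.\<close>

lemma norm_levy_integrand: "norm (levy_integrand \<xi> u) \<le> (2 + (norm \<xi>)\<^sup>2) * min 1 ((norm u)\<^sup>2)"
proof (cases "norm u \<le> 1")
  case True
  then have "norm (levy_integrand \<xi> u) \<le> (\<xi> \<bullet> u)\<^sup>2"
    using norm_iexp_remainder[of "\<xi> \<bullet> u"] by (simp add: levy_integrand_def iexp_remainder_def)
  also have "\<dots> \<le> (norm \<xi>)\<^sup>2 * (norm u)\<^sup>2"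
    using Cauchy_Schwarz_ineq2[of \<xi> u] by (simp add: power_mult_distrib[symmetric] abs_le_square_iff[symmetric] abs_mult)
  also have "\<dots> \<le> (2 + (norm \<xi>)\<^sup>2) * (norm u)\<^sup>2"
    by (intro mult_right_mono) auto
  also have "(norm u)\<^sup>2 = min 1 ((norm u)\<^sup>2)"
    using True power_mono[of "norm u" 1 2] by simp
  finally show ?thesis .
next
  case False
  then have "norm (levy_integrand \<xi> u) \<le> norm (iexp (\<xi> \<bullet> u)) + norm (1::complex)"
    using norm_triangle_ineq4[of "iexp (\<xi> \<bullet> u)" 1] by (simp add: levy_integrand_def)
  then have "norm (levy_integrand \<xi> u) \<le> 2" by simp
  moreover have "min 1 ((norm u)\<^sup>2) = 1"
    using False power_mono[of 1 "norm u" 2] by simp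
  ultimately show ?thesis
    by (auto intro: order_trans[of _ 2])
qed

section \<open>Exponents of the law and of the jump operator\<close>

context polar_levy
begin

lemma integrable_levy_integrand:
  "integrable \<nu> (levy_integrand \<xi>)" "integrable \<nu>' (levy_integrand \<xi>)"
proof -
  have [measurable]: "levy_integrand \<xi> \<in> borel_measurable borel" by measurable
  show "integrable \<nu> (levy_integrand \<xi>)"
    by (rule Bochner_Integration.integrable_bound[OF integrable_mult_right[OF integrable_nu_min, of "2 + (norm \<xi>)\<^sup>2"]])
      (auto intro!: always_eventually order_trans[OF norm_levy_integrand])
  show "integrable \<nu>' (levy_integrand \<xi>)"
    by (rule Bochner_Integration.integrable_bound[OF integrable_mult_right[OF integrable_nu_tilde_min, of "2 + (norm \<xi>)\<^sup>2"]])
      (auto intro!: always_eventually order_trans[OF norm_levy_integrand])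
qed

definition levy_exponent :: "'a \<Rightarrow> 'a \<Rightarrow> complex" where
  "levy_exponent b \<xi> = \<i> * complex_of_real (b \<bullet> \<xi>) + (\<integral>u. levy_integrand \<xi> u \<partial>\<nu>)"

text \<open>With drift \<open>b_tilde b \<sigma> k\<close> this is the exponent of the background
  driving Levy process of the self-decomposable law, that is, the symbol of the jump
  operator.\<close>

definition generator_exponent :: "'a \<Rightarrow> 'a \<Rightarrow> complex" where
  "generator_exponent b \<xi> = \<i> * complex_of_real (b \<bullet> \<xi>) + (\<integral>u. levy_integrand \<xi> u \<partial>\<nu>')"

abbreviation (input) "far_direction u \<equiv> indicator {1<..} (norm u) *\<^sub>R (u /\<^sub>R norm (u::'a))"

text \<open>Without truncation the integrand along the flow would be a single function
  \<open>\<Phi>\<close> of time, and replacing \<open>\<xi>\<close> by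
  \<open>exp (- t) *\<^sub>R \<xi>\<close> would shift it by \<open>t\<close>, leaving only the
  initial segment. The truncation spoils this for \<open>norm u > 1\<close>: the linear term is
  absent until the trajectory enters the unit ball, and this defect is the term with the direction
  of \<open>u\<close>.\<close>

lemma integral_levy_integrand_flow:
  assumes "0 \<le> t"
  shows "(\<integral>s. levy_integrand \<xi> (exp (- s) *\<^sub>R u) - levy_integrand (exp (- t) *\<^sub>R \<xi>) (exp (- s) *\<^sub>R u) \<partial>nonneg_time) =
    (\<integral>s. indicator {..t} s *\<^sub>R levy_integrand (exp (- s) *\<^sub>R \<xi>) u \<partial>nonneg_time) -
      \<i> * complex_of_real ((1 - exp (- t)) * (\<xi> \<bullet> far_direction u))"
proof -
  define a where "a = \<xi> \<bullet> u"
  define \<Phi> where "\<Phi> s = iexp_remainder (a * exp (- s))" for s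
  \<comment> \<open>The time at which the trajectory of \<open>u\<close> enters the unit ball, 0 if
    it starts there.\<close>
  define l where "l = (if 1 < norm u then ln (norm u) else 0)"
  have l: "0 \<le> l" by (simp add: l_def)
  have [measurable]: "\<Phi> \<in> borel_measurable borel"
    unfolding \<Phi>_def iexp_remainder_def by measurable
  have \<Phi>_int: "integrable nonneg_time \<Phi>"
  proof (rule Bochner_Integration.integrable_bound[OF integrable_mult_right[OF integrable_exp_nonneg_time[of 2], of "a\<^sup>2"]])
    show "AE s in nonneg_time. norm (\<Phi> s) \<le> norm (a\<^sup>2 * exp (- (2 * s)))"
      using norm_iexp_remainder[of "a * exp (- s)" for s]
      by (auto simp: \<Phi>_def power_mult_distrib exp_double[symmetric])
  qed (auto intro: measurable_compose[OF id_nonneg_time_borel])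
  have far: "indicator {1<..} (exp (- s) * norm u) = (indicator {..<l} s :: real)" if "0 \<le> s" for s
  proof -
    have "1 < exp (- s) * norm u \<longleftrightarrow> s < l"
    proof (cases "1 < norm u")
      case True
      then have "1 < exp (- s) * norm u \<longleftrightarrow> exp s < norm u"
        by (simp add: exp_minus field_simps)
      also have "\<dots> \<longleftrightarrow> s < l"
        using True by (metis exp_less_cancel_iff exp_ln l_def less_trans zero_less_one)
      finally show ?thesis .
    next
      case False
      have "exp (- s) * norm u \<le> 1 * 1"
        using False that by (intro mult_mono) auto
      then show ?thesis using False that by (simp add: l_def)
    qed
    then show ?thesis by (simp add: indicator_def)
  qed
  have 1: "levy_integrand \<xi> (exp (- s) *\<^sub>R u) - levy_integrand (exp (- t) *\<^sub>R \<xi>) (exp (- s) *\<^sub>R u) =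
      (\<Phi> s - \<Phi> (s + t)) + \<i> * complex_of_real (a * (1 - exp (- t))) * complex_of_real (indicator {..<l} s * exp (- s))"
    if "s \<in> space nonneg_time" for s
  proof -
    have s: "0 \<le> s" using that by simp
    have ind: "indicator (cball 0 1) (exp (- s) *\<^sub>R u) = 1 - complex_of_real (indicator {..<l} s)"
      unfolding far[OF s, symmetric] by (auto simp: indicator_def)
    show ?thesis
      unfolding levy_integrand_def ind
      by (simp add: \<Phi>_def iexp_remainder_def a_def[symmetric] exp_add exp_minus_inverse algebra_simps flip: exp_of_real)
        (simp add: exp_diff exp_minus field_simps)
  qed
  have 2: "indicator {..t} s *\<^sub>R levy_integrand (exp (- s) *\<^sub>R \<xi>) u = indicator {..t} s *\<^sub>R \<Phi> s +
      \<i> * complex_of_real (a * indicator {1<..} (norm u)) * complex_of_real (indicator {..t} s * exp (- s))" for s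
    by (auto simp: levy_integrand_def \<Phi>_def iexp_remainder_def a_def[symmetric] indicator_def algebra_simps)
  have e1: "has_bochner_integral nonneg_time (\<lambda>s. complex_of_real (indicator {..<l} s * exp (- s))) (complex_of_real (1 - exp (- l)))"
    by (rule has_bochner_integral_of_real, rule has_bochner_integral_exp_lessThan[OF l])
  have e2: "has_bochner_integral nonneg_time (\<lambda>s. complex_of_real (indicator {..t} s * exp (- s))) (complex_of_real (1 - exp (- t)))"
    by (rule has_bochner_integral_of_real, rule has_bochner_integral_exp_atMost[OF assms])
  have \<Phi>_ind: "integrable nonneg_time (\<lambda>s. indicator {..t} s *\<^sub>R \<Phi> s)"
    by (rule Bochner_Integration.integrable_bound[OF \<Phi>_int])
      (auto simp: indicator_def intro: measurable_compose[OF id_nonneg_time_borel])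
  \<comment> \<open>For \<open>norm u > 1\<close> one has exp(-l) = 1 / norm u, and multiplying the
    inner product with \<open>u\<close> by it leaves the unit vector along \<open>u\<close>.\<close>
  have el: "a * (1 - exp (- l)) = a * indicator {1<..} (norm u) - \<xi> \<bullet> far_direction u"
  proof (cases "1 < norm u")
    case True
    then have "exp (ln (norm u)) = norm u" by (intro exp_ln) linarith
    with True show ?thesis by (simp add: l_def a_def exp_minus algebra_simps)
  qed (simp add: l_def)
  have "(\<integral>s. levy_integrand \<xi> (exp (- s) *\<^sub>R u) - levy_integrand (exp (- t) *\<^sub>R \<xi>) (exp (- s) *\<^sub>R u) \<partial>nonneg_time) =
      (\<integral>s. indicator {..t} s *\<^sub>R \<Phi> s \<partial>nonneg_time) + \<i> * complex_of_real (a * (1 - exp (- t))) * complex_of_real (1 - exp (- l))"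
    by (subst Bochner_Integration.integral_cong[OF refl 1], assumption, rule has_bochner_integral_integral_eq, intro has_bochner_integral_add has_bochner_integral_mult_right
        has_bochner_integral_shift_difference \<Phi>_int assms e1) auto
  also have "\<dots> = (\<integral>s. indicator {..t} s *\<^sub>R levy_integrand (exp (- s) *\<^sub>R \<xi>) u \<partial>nonneg_time) -
      \<i> * complex_of_real ((1 - exp (- t)) * (\<xi> \<bullet> far_direction u))"
  proof -
    have "(\<integral>s. indicator {..t} s *\<^sub>R levy_integrand (exp (- s) *\<^sub>R \<xi>) u \<partial>nonneg_time) =
        (\<integral>s. indicator {..t} s *\<^sub>R \<Phi> s \<partial>nonneg_time) +
          \<i> * complex_of_real (a * indicator {1<..} (norm u)) * complex_of_real (1 - exp (- t))"
      unfolding 2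
      by (rule has_bochner_integral_integral_eq, intro has_bochner_integral_add has_bochner_integral_mult_right
          has_bochner_integral_integrable \<Phi>_ind e2)
    moreover have "a * (1 - exp (- t)) * (1 - exp (- l)) =
        a * indicator {1<..} (norm u) * (1 - exp (- t)) - (1 - exp (- t)) * (\<xi> \<bullet> far_direction u)"
      using arg_cong[OF el, of "\<lambda>x. x * (1 - exp (- t))"] by (simp add: algebra_simps)
    from arg_cong[OF this, of complex_of_real] have "\<i> * complex_of_real (a * (1 - exp (- t))) * complex_of_real (1 - exp (- l)) =
        \<i> * complex_of_real (a * indicator {1<..} (norm u)) * complex_of_real (1 - exp (- t)) -
        \<i> * complex_of_real ((1 - exp (- t)) * (\<xi> \<bullet> far_direction u))"
      unfolding of_real_mult of_real_diff mult.assoc right_diff_distrib[of \<i>, symmetric] by simp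
    ultimately show ?thesis by simp
  qed
  finally show ?thesis .
qed


lemma integrable_levy_integrand_flow:
  "integrable (nonneg_time \<Otimes>\<^sub>M \<nu>') (\<lambda>p. levy_integrand \<xi> (exp (- fst p) *\<^sub>R snd p))"
  using integrable_levy_integrand(1)[of \<xi>] by (subst (asm) integrable_nu_iff) auto

text \<open>Up to time \<open>t\<close> the flow has not contracted by more than
  \<open>exp (- t)\<close>, so the bound on the unmoved jump is at most
  \<open>exp (2 * \<bar>t\<bar>)\<close> times the bound along the flow, which is integrable. This
  permits the exchange of time and jumps below.\<close>

lemma integrable_levy_integrand_initial:
  "integrable (nonneg_time \<Otimes>\<^sub>M \<nu>') (\<lambda>(s, u). indicator {..t} s *\<^sub>R levy_integrand (exp (- s) *\<^sub>R \<xi>) u)"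
proof (rule Bochner_Integration.integrable_bound)
  let ?c = "(2 + (norm \<xi>)\<^sup>2) * exp (2 * \<bar>t\<bar>)"
  show "integrable (nonneg_time \<Otimes>\<^sub>M \<nu>') (\<lambda>p. ?c * min 1 ((exp (- fst p) * norm (snd p))\<^sup>2))"
    by (rule integrable_mult_right[OF integrable_flow_min])
  show "AE p in nonneg_time \<Otimes>\<^sub>M \<nu>'. norm (case p of (s, u) \<Rightarrow> indicator {..t} s *\<^sub>R levy_integrand (exp (- s) *\<^sub>R \<xi>) u)
      \<le> norm (?c * min 1 ((exp (- fst p) * norm (snd p))\<^sup>2))"
  proof (rule AE_I2)
    fix p :: "real \<times> 'a" assume "p \<in> space (nonneg_time \<Otimes>\<^sub>M \<nu>')"
    then obtain s u where p: "p = (s, u)" and s: "0 \<le> s"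
      by (cases p) (auto simp: space_pair_measure)
    have "norm (levy_integrand (exp (- s) *\<^sub>R \<xi>) u) \<le> ?c * min 1 ((exp (- s) * norm u)\<^sup>2)" if "s \<le> t"
    proof -
      have "(norm (exp (- s) *\<^sub>R \<xi>))\<^sup>2 \<le> (norm \<xi>)\<^sup>2"
        using s by (intro power_mono) (auto intro: mult_left_le_one_le)
      moreover have "min 1 ((norm u)\<^sup>2) \<le> exp (2 * \<bar>t\<bar>) * min 1 ((exp (- s) * norm u)\<^sup>2)"
      proof -
        have "1 \<le> exp (2 * \<bar>t\<bar>)" by simp
        moreover have "(norm u)\<^sup>2 \<le> exp (2 * \<bar>t\<bar>) * (exp (- s) * norm u)\<^sup>2"
        proof -
          have "1 \<le> exp (2 * \<bar>t\<bar>) * (exp (- s))\<^sup>2"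
            using that s by (simp add: exp_double[symmetric] exp_add[symmetric])
          from mult_right_mono[OF this, of "(norm u)\<^sup>2"] show ?thesis
            by (simp add: power_mult_distrib mult_ac)
        qed
        ultimately show ?thesis
          by (auto simp: min_def intro: order_trans[of _ 1])
      qed
      ultimately have "(2 + (norm (exp (- s) *\<^sub>R \<xi>))\<^sup>2) * min 1 ((norm u)\<^sup>2) \<le>
          (2 + (norm \<xi>)\<^sup>2) * (exp (2 * \<bar>t\<bar>) * min 1 ((exp (- s) * norm u)\<^sup>2))"
        by (intro mult_mono) auto
      then show ?thesis
        using norm_levy_integrand[of "exp (- s) *\<^sub>R \<xi>" u] by (simp add: mult.assoc)
    qed
    then show "norm (case p of (s, u) \<Rightarrow> indicator {..t} s *\<^sub>R levy_integrand (exp (- s) *\<^sub>R \<xi>) u)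
        \<le> norm (?c * min 1 ((exp (- fst p) * norm (snd p))\<^sup>2))"
      by (auto simp: p indicator_def)
  qed
qed measurable

text \<open>
  Integrating the pointwise flow identity turns the truncation at radius one, which does not
  commute with the contraction, into the drift correction \<open>b - \<integral> k\<^sub>x(1) x \<sigma>(dx)\<close>.
\<close>

lemma levy_exponent_difference:
  assumes t: "0 \<le> t"
  shows "levy_exponent b \<xi> - levy_exponent b (exp (- t) *\<^sub>R \<xi>) =
    (\<integral>s. indicator {..t} s *\<^sub>R generator_exponent (b_tilde b \<sigma> k) (exp (- s) *\<^sub>R \<xi>) \<partial>nonneg_time)"
proof -
  let ?d = "1 - exp (- t)"
  let ?L = "\<lambda>s u. indicator {..t} s *\<^sub>R levy_integrand (exp (- s) *\<^sub>R \<xi>) u"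
  have intG: "integrable \<nu>' (\<lambda>u. far_direction u)"
    using integrable_direction .
  have snd: "(\<integral>u. \<integral>s. f s u \<partial>nonneg_time \<partial>\<nu>') = (\<integral>p. f (fst p) (snd p) \<partial>(nonneg_time \<Otimes>\<^sub>M \<nu>'))"
    if "integrable (nonneg_time \<Otimes>\<^sub>M \<nu>') (\<lambda>p. f (fst p) (snd p))" for f :: "real \<Rightarrow> 'a \<Rightarrow> complex"
    using TN.integral_snd[of f] that by (simp add: split_beta')
  have iJ: "integrable \<nu>' (\<lambda>u. \<integral>s. ?L s u \<partial>nonneg_time)"
    by (rule TN.integrable_snd[OF integrable_levy_integrand_initial])
  have "(\<integral>u. levy_integrand \<xi> u \<partial>\<nu>) - (\<integral>u. levy_integrand (exp (- t) *\<^sub>R \<xi>) u \<partial>\<nu>) =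
      (\<integral>p. levy_integrand \<xi> (exp (- fst p) *\<^sub>R snd p) - levy_integrand (exp (- t) *\<^sub>R \<xi>) (exp (- fst p) *\<^sub>R snd p) \<partial>(nonneg_time \<Otimes>\<^sub>M \<nu>'))"
    by (subst (1 2) integral_nu) (auto intro!: Bochner_Integration.integral_diff[symmetric] integrable_levy_integrand_flow)
  also have "\<dots> = (\<integral>u. \<integral>s. levy_integrand \<xi> (exp (- s) *\<^sub>R u) - levy_integrand (exp (- t) *\<^sub>R \<xi>) (exp (- s) *\<^sub>R u) \<partial>nonneg_time \<partial>\<nu>')"
    by (rule snd[symmetric]) (intro Bochner_Integration.integrable_diff integrable_levy_integrand_flow)
  also have "\<dots> = (\<integral>u. (\<integral>s. ?L s u \<partial>nonneg_time) - \<i> * complex_of_real (?d * (\<xi> \<bullet> far_direction u)) \<partial>\<nu>')"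
    by (rule Bochner_Integration.integral_cong[OF refl integral_levy_integrand_flow[OF t]])
  also have "\<dots> = (\<integral>u. \<integral>s. ?L s u \<partial>nonneg_time \<partial>\<nu>') - (\<integral>u. \<i> * complex_of_real (?d * (\<xi> \<bullet> far_direction u)) \<partial>\<nu>')"
    by (intro Bochner_Integration.integral_diff iJ integrable_mult_right integrable_of_real integrable_inner_right intG)
  also have "(\<integral>u. \<i> * complex_of_real (?d * (\<xi> \<bullet> far_direction u)) \<partial>\<nu>') = \<i> * complex_of_real (?d * (\<xi> \<bullet> (\<integral>u. far_direction u \<partial>\<nu>')))"
    using intG by (subst integral_mult_right_zero, subst integral_complex_of_real, subst integral_mult_right_zero, subst integral_inner_right) auto
  also have "(\<integral>u. far_direction u \<partial>\<nu>') = (\<integral>x. k x 1 *\<^sub>R x \<partial>\<sigma>)"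
    by (rule integral_direction)
  also have "(\<integral>u. \<integral>s. ?L s u \<partial>nonneg_time \<partial>\<nu>') = (\<integral>s. \<integral>u. ?L s u \<partial>\<nu>' \<partial>nonneg_time)"
    by (rule TN.Fubini_integral[OF integrable_levy_integrand_initial])
  finally have 1: "(\<integral>u. levy_integrand \<xi> u \<partial>\<nu>) - (\<integral>u. levy_integrand (exp (- t) *\<^sub>R \<xi>) u \<partial>\<nu>) =
      (\<integral>s. \<integral>u. ?L s u \<partial>\<nu>' \<partial>nonneg_time) - \<i> * complex_of_real (?d * (\<xi> \<bullet> (\<integral>x. k x 1 *\<^sub>R x \<partial>\<sigma>)))" .
  have "has_bochner_integral nonneg_time (\<lambda>s. \<i> * complex_of_real (b_tilde b \<sigma> k \<bullet> \<xi>) * complex_of_real (indicator {..t} s * exp (- s)))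
      (\<i> * complex_of_real (b_tilde b \<sigma> k \<bullet> \<xi>) * complex_of_real ?d)"
    by (intro has_bochner_integral_mult_right has_bochner_integral_of_real has_bochner_integral_exp_atMost t)
  moreover have "has_bochner_integral nonneg_time (\<lambda>s. \<integral>u. ?L s u \<partial>\<nu>') (\<integral>s. \<integral>u. ?L s u \<partial>\<nu>' \<partial>nonneg_time)"
    by (rule has_bochner_integral_integrable[OF TN.integrable_fst[OF integrable_levy_integrand_initial]])
  ultimately have "has_bochner_integral nonneg_time
      (\<lambda>s. \<i> * complex_of_real (b_tilde b \<sigma> k \<bullet> \<xi>) * complex_of_real (indicator {..t} s * exp (- s)) + (\<integral>u. ?L s u \<partial>\<nu>'))
      (\<i> * complex_of_real (b_tilde b \<sigma> k \<bullet> \<xi>) * complex_of_real ?d + (\<integral>s. \<integral>u. ?L s u \<partial>\<nu>' \<partial>nonneg_time))"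
    by (rule has_bochner_integral_add)
  moreover have "\<i> * complex_of_real (b_tilde b \<sigma> k \<bullet> \<xi>) * complex_of_real (indicator {..t} s * exp (- s)) + (\<integral>u. ?L s u \<partial>\<nu>') =
      indicator {..t} s *\<^sub>R generator_exponent (b_tilde b \<sigma> k) (exp (- s) *\<^sub>R \<xi>)" for s
    by (simp add: generator_exponent_def indicator_def)
  ultimately have "(\<integral>s. indicator {..t} s *\<^sub>R generator_exponent (b_tilde b \<sigma> k) (exp (- s) *\<^sub>R \<xi>) \<partial>nonneg_time) =
      \<i> * complex_of_real (b_tilde b \<sigma> k \<bullet> \<xi>) * complex_of_real ?d + (\<integral>s. \<integral>u. ?L s u \<partial>\<nu>' \<partial>nonneg_time)"
    by (simp add: has_bochner_integral_integral_eq)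
  then have I: "(\<integral>s. indicator {..t} s *\<^sub>R generator_exponent (b_tilde b \<sigma> k) (exp (- s) *\<^sub>R \<xi>) \<partial>nonneg_time) =
      \<i> * complex_of_real (b \<bullet> \<xi>) * complex_of_real ?d + ((\<integral>s. \<integral>u. ?L s u \<partial>\<nu>' \<partial>nonneg_time) -
        \<i> * complex_of_real (?d * (\<xi> \<bullet> (\<integral>x. k x 1 *\<^sub>R x \<partial>\<sigma>))))"
    by (simp add: b_tilde_def inner_diff_left inner_commute[of \<xi>] algebra_simps)
  have "levy_exponent b \<xi> - levy_exponent b (exp (- t) *\<^sub>R \<xi>) =
      \<i> * complex_of_real (b \<bullet> \<xi>) * complex_of_real ?d +
        ((\<integral>u. levy_integrand \<xi> u \<partial>\<nu>) - (\<integral>u. levy_integrand (exp (- t) *\<^sub>R \<xi>) u \<partial>\<nu>))"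
    by (simp add: levy_exponent_def algebra_simps)
  then show ?thesis
    unfolding 1 I .
qed

lemma continuous_generator_exponent: "continuous_on UNIV (generator_exponent b)"
proof -
  have "(\<lambda>n. \<integral>u. levy_integrand (X n) u \<partial>\<nu>') \<longlonglongrightarrow> (\<integral>u. levy_integrand x u \<partial>\<nu>')"
    if X: "X \<longlonglongrightarrow> x" for X :: "nat \<Rightarrow> 'a" and x
  proof -
    obtain B where B: "\<And>n. norm (X n) \<le> B"
      using convergent_imp_Bseq[of X] X by (auto simp: convergent_def Bseq_def)
    show ?thesis
    proof (rule integral_dominated_convergence)
      show "integrable \<nu>' (\<lambda>u. (2 + B\<^sup>2) * min 1 ((norm u)\<^sup>2))"
        by (rule integrable_mult_right[OF integrable_nu_tilde_min])
      show "AE u in \<nu>'. norm (levy_integrand (X n) u) \<le> (2 + B\<^sup>2) * min 1 ((norm u)\<^sup>2)" for n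
        by (intro always_eventually allI order_trans[OF norm_levy_integrand] mult_right_mono add_left_mono power_mono B) auto
      show "AE u in \<nu>'. (\<lambda>n. levy_integrand (X n) u) \<longlonglongrightarrow> levy_integrand x u"
        unfolding levy_integrand_def by (intro always_eventually allI tendsto_intros X)
    qed measurable
  qed
  then have "continuous_on UNIV (\<lambda>\<xi>. \<integral>u. levy_integrand \<xi> u \<partial>\<nu>')"
    by (auto simp: continuous_on_sequentially comp_def)
  then show ?thesis
    unfolding generator_exponent_def[abs_def] by (intro continuous_intros)
qed

text \<open>The integrated form has a continuous integrand, so it can be differentiated by the
  fundamental theorem of calculus. It holds for nonnegative times, hence the two-sided derivative is
  taken at positive ones.\<close>

lemma levy_exponent_has_vector_derivative:
  assumes t: "0 < t"
  shows "((\<lambda>t. levy_exponent b (exp (- t) *\<^sub>R \<xi>)) has_vector_derivative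
    - generator_exponent (b_tilde b \<sigma> k) (exp (- t) *\<^sub>R \<xi>)) (at t)"
proof -
  let ?g = "\<lambda>s. generator_exponent (b_tilde b \<sigma> k) (exp (- s) *\<^sub>R \<xi>)"
  have cont: "continuous_on S ?g" for S
    by (rule continuous_on_compose2[OF continuous_generator_exponent]) (auto intro!: continuous_intros)
  have eq: "levy_exponent b (exp (- s) *\<^sub>R \<xi>) = levy_exponent b \<xi> - integral {0..s} ?g" if "0 \<le> s" for s
  proof -
    have si: "set_integrable lborel {0..s} ?g"
      using borel_integrable_compact[of "{0..s}" ?g, OF _ cont] by (simp add: set_integrable_def)
    have "(\<integral>r. indicator {..s} r *\<^sub>R ?g r \<partial>nonneg_time) = (LINT r:{0..s}|lborel. ?g r)"
      unfolding integral_nonneg_time set_lebesgue_integral_def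
      by (rule Bochner_Integration.integral_cong) (auto simp: indicator_def)
    also have "\<dots> = integral {0..s} ?g"
      by (rule set_borel_integral_eq_integral(2)[OF si])
    finally show ?thesis
      using levy_exponent_difference[OF that, of b \<xi>] by (simp add: algebra_simps)
  qed
  have "((\<lambda>s. integral {0..s} ?g) has_vector_derivative ?g t) (at t within {0..t + 1})"
    by (rule integral_has_vector_derivative[OF cont]) (use t in auto)
  then have "((\<lambda>s. integral {0..s} ?g) has_vector_derivative ?g t) (at t)"
    using t by (simp add: at_within_Icc_at)
  then have "((\<lambda>s. levy_exponent b \<xi> - integral {0..s} ?g) has_vector_derivative - ?g t) (at t)"
    by (auto intro!: derivative_eq_intros)
  then show ?thesis
    by (rule has_vector_derivative_transform_within_open[of _ _ _ "{0<..}"]) (use t in \<open>auto simp: eq\<close>)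
qed

end

declare id_nonneg_time_borel [measurable del]

subsection \<open>Trigonometric approximation of the identity\<close>

text \<open>Differentiation under the integral sign. The mean value inequality on the convex set
  \<open>S\<close> bounds the increments of \<open>F\<close> by \<open>g\<close> times the
  displacement, and the linear term obeys the same bound, so \<open>2 * g\<close> dominates the
  difference quotients.\<close>

lemma integral_has_gradient:
  fixes F :: "'a::euclidean_space \<Rightarrow> 'w \<Rightarrow> real" and D :: "'a \<Rightarrow> 'w \<Rightarrow> 'a"
  assumes S: "open S" "convex S" "x \<in> S"
    and der: "\<And>y w. y \<in> S \<Longrightarrow> w \<in> space M \<Longrightarrow> ((\<lambda>y. F y w) has_derivative (\<lambda>v. D y w \<bullet> v)) (at y)"
    and int: "\<And>y. y \<in> S \<Longrightarrow> integrable M (F y)"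
    and meas [measurable]: "D x \<in> borel_measurable M"
    and bnd: "\<And>y w. y \<in> S \<Longrightarrow> w \<in> space M \<Longrightarrow> norm (D y w) \<le> g w"
    and g: "integrable M g"
  shows "((\<lambda>y. \<integral>w. F y w \<partial>M) has_derivative (\<lambda>v. (\<integral>w. D x w \<partial>M) \<bullet> v)) (at x)"
proof -
  have intD: "integrable M (D x)"
    by (rule Bochner_Integration.integrable_bound[OF g]) (use bnd[OF S(3)] in \<open>auto intro!: AE_I2 intro: order_trans[OF _ abs_ge_self]\<close>)
  have lip: "\<bar>F y w - F x w\<bar> \<le> g w * norm (y - x)" if "y \<in> S" "w \<in> space M" for y w
  proof -
    have "norm (F y w - F x w) \<le> g w * norm (y - x)"
    proof (rule differentiable_bound[OF S(2)])
      fix z assume z: "z \<in> S"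
      show "((\<lambda>y. F y w) has_derivative (\<lambda>v. D z w \<bullet> v)) (at z within S)"
        using der[OF z that(2)] by (rule has_derivative_at_withinI)
      have "norm (D z w \<bullet> v) \<le> g w * norm v" for v
        using Cauchy_Schwarz_ineq2[of "D z w" v] mult_right_mono[OF bnd[OF z that(2)] norm_ge_zero[of v]] by simp
      then show "onorm (\<lambda>v. D z w \<bullet> v) \<le> g w"
        by (rule onorm_le)
    qed (use that S in auto)
    then show ?thesis by simp
  qed
  show ?thesis
    unfolding has_derivative_at
  proof (intro conjI bounded_linear_inner_right)
    let ?q = "\<lambda>h w. (F (x + h) w - F x w - D x w \<bullet> h) / norm h"
    show "(\<lambda>h. norm ((\<integral>w. F (x + h) w \<partial>M) - (\<integral>w. F x w \<partial>M) - (\<integral>w. D x w \<partial>M) \<bullet> h) / norm h) \<midarrow>0\<rightarrow> 0"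
    proof (subst tendsto_at_iff_sequentially, intro allI impI)
      fix h assume h: "\<forall>i. h i \<in> UNIV - {0::'a}" and h0: "h \<longlonglongrightarrow> 0"
      have "(\<lambda>i. x + h i) \<longlonglongrightarrow> x + 0"
        by (intro tendsto_intros h0)
      then have "\<forall>\<^sub>F i in sequentially. x + h i \<in> S"
        using S by (auto dest: topological_tendstoD)
      \<comment> \<open>The displaced point may lie outside \<open>S\<close> for the first indices,
        where nothing is known; the sequence is started at \<open>N\<close>.\<close>
      then obtain N where N: "\<And>i. N \<le> i \<Longrightarrow> x + h i \<in> S"
        unfolding eventually_sequentially by auto
      have shift: "(\<lambda>i. h (i + N)) \<longlonglongrightarrow> 0"
        using h0 by (rule LIMSEQ_ignore_initial_segment)
      have "(\<lambda>i. \<integral>w. ?q (h (i + N)) w \<partial>M) \<longlonglongrightarrow> (\<integral>w. 0 \<partial>M)"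
      proof (rule integral_dominated_convergence)
        show "integrable M (\<lambda>w. 2 * g w)" using g by simp
        show "(\<lambda>w. ?q (h (i + N)) w) \<in> borel_measurable M" for i
          using borel_measurable_integrable[OF int[OF N[of "i + N"]]] borel_measurable_integrable[OF int[OF S(3)]] by simp
        show "AE w in M. norm (?q (h (i + N)) w) \<le> 2 * g w" for i
        proof (rule AE_I2)
          fix w assume w: "w \<in> space M"
          have "\<bar>F (x + h (i + N)) w - F x w\<bar> \<le> g w * norm (h (i + N))"
            using lip[OF N[of "i + N"] w] by simp
          moreover have "\<bar>D x w \<bullet> h (i + N)\<bar> \<le> g w * norm (h (i + N))"
            using Cauchy_Schwarz_ineq2[of "D x w" "h (i + N)"] mult_right_mono[OF bnd[OF S(3) w] norm_ge_zero[of "h (i + N)"]] by simp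
          ultimately show "norm (?q (h (i + N)) w) \<le> 2 * g w"
            using h by (simp add: divide_le_eq)
        qed
        show "AE w in M. (\<lambda>i. ?q (h (i + N)) w) \<longlonglongrightarrow> 0"
        proof (rule AE_I2)
          fix w assume w: "w \<in> space M"
          have "(\<lambda>h. norm (F (x + h) w - F x w - D x w \<bullet> h) / norm h) \<midarrow>0\<rightarrow> 0"
            using der[OF S(3) w] by (simp add: has_derivative_at)
          then have "(\<lambda>i. norm (F (x + h (i + N)) w - F x w - D x w \<bullet> h (i + N)) / norm (h (i + N))) \<longlonglongrightarrow> 0"
            using h shift by (auto simp: tendsto_at_iff_sequentially comp_def)
          then show "(\<lambda>i. ?q (h (i + N)) w) \<longlonglongrightarrow> 0"
            by (subst tendsto_norm_zero_iff[symmetric]) simp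
        qed
      qed auto
      moreover have "(\<integral>w. ?q (h (i + N)) w \<partial>M) =
          ((\<integral>w. F (x + h (i + N)) w \<partial>M) - (\<integral>w. F x w \<partial>M) - (\<integral>w. D x w \<partial>M) \<bullet> h (i + N)) / norm (h (i + N))" for i
        using int[OF N[of "i + N"]] int[OF S(3)] intD by simp
      ultimately have "(\<lambda>i. norm (((\<integral>w. F (x + h (i + N)) w \<partial>M) - (\<integral>w. F x w \<partial>M) - (\<integral>w. D x w \<partial>M) \<bullet> h (i + N)) / norm (h (i + N)))) \<longlonglongrightarrow> 0"
        by (intro tendsto_norm_zero) (simp only: Bochner_Integration.integral_zero)
      then have "(\<lambda>i. norm ((\<integral>w. F (x + h (i + N)) w \<partial>M) - (\<integral>w. F x w \<partial>M) - (\<integral>w. D x w \<partial>M) \<bullet> h (i + N)) / norm (h (i + N))) \<longlonglongrightarrow> 0"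
        by simp
      then show "((\<lambda>h. norm ((\<integral>w. F (x + h) w \<partial>M) - (\<integral>w. F x w \<partial>M) - (\<integral>w. D x w \<partial>M) \<bullet> h) / norm h) \<circ> h) \<longlonglongrightarrow> 0"
        unfolding comp_def by (rule LIMSEQ_offset)
    qed
  qed
qed

text \<open>The phase supplies sines, the frequency 0 supplies constants, and frequencies range over
  all vectors, so that the set is closed under products without a common period.\<close>

inductive_set trig_poly :: "('a::euclidean_space \<Rightarrow> real) set" where
  cos: "(\<lambda>x. cos (\<xi> \<bullet> x + \<theta>)) \<in> trig_poly"
| lin: "f \<in> trig_poly \<Longrightarrow> g \<in> trig_poly \<Longrightarrow> (\<lambda>x. a * f x + b * g x) \<in> trig_poly"

lemma trig_poly_const: "(\<lambda>x. c) \<in> trig_poly"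
  using trig_poly.lin[OF trig_poly.cos[of 0 0] trig_poly.cos[of 0 0], of c 0] by simp

lemma trig_poly_mult: "f \<in> trig_poly \<Longrightarrow> g \<in> trig_poly \<Longrightarrow> (\<lambda>x. f x * g x) \<in> trig_poly"
proof (induction rule: trig_poly.induct)
  case (cos \<xi> \<theta>)
  from cos.prems show ?case
  proof (induction rule: trig_poly.induct)
    case (cos \<xi>' \<theta>')
    have "cos (\<xi> \<bullet> x + \<theta>) * cos (\<xi>' \<bullet> x + \<theta>') =
        1/2 * cos ((\<xi> - \<xi>') \<bullet> x + (\<theta> - \<theta>')) + 1/2 * cos ((\<xi> + \<xi>') \<bullet> x + (\<theta> + \<theta>'))" for x
    proof -
      have "(\<xi> - \<xi>') \<bullet> x + (\<theta> - \<theta>') = (\<xi> \<bullet> x + \<theta>) - (\<xi>' \<bullet> x + \<theta>')"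
        "(\<xi> + \<xi>') \<bullet> x + (\<theta> + \<theta>') = (\<xi> \<bullet> x + \<theta>) + (\<xi>' \<bullet> x + \<theta>')"
        by (simp_all add: inner_simps)
      then show ?thesis by (simp only: cos_diff cos_add[of "_ + _" "_ + _"]) (simp add: add_divide_distrib diff_divide_distrib)
    qed
    then show ?case
      by (simp only:) (intro trig_poly.intros)
  next
    case (lin f g a b)
    then show ?case
      using trig_poly.lin[OF lin.IH, of a b] by (simp add: algebra_simps)
  qed
next
  case (lin f g' a b)
  then show ?case
    using trig_poly.lin[OF lin.IH, of a b] by (simp add: algebra_simps)
qed

lemma trig_poly_power: "f \<in> trig_poly \<Longrightarrow> (\<lambda>x. f x ^ n) \<in> trig_poly"
  by (induction n) (auto intro: trig_poly_const trig_poly_mult)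

lemma trig_poly_prod: "(\<And>i. i \<in> I \<Longrightarrow> f i \<in> trig_poly) \<Longrightarrow> (\<lambda>x. \<Prod>i\<in>I. f i x) \<in> trig_poly"
  by (induction I rule: infinite_finite_induct) (auto intro: trig_poly_const trig_poly_mult)

lemma continuous_on_trig_poly: "f \<in> trig_poly \<Longrightarrow> continuous_on S f"
  by (induction rule: trig_poly.induct) (auto intro!: continuous_intros)

lemma trig_poly_measurable: "f \<in> trig_poly \<Longrightarrow> f \<in> borel_measurable borel"
  by (rule borel_measurable_continuous_onI) (rule continuous_on_trig_poly)

text \<open>Each factor is the square of cos(z_b / (2p)). The product has period
  \<open>2 * pi * p\<close> in every coordinate, \<open>cell p\<close> is one period, and within it
  the maximum 1 is attained only at the origin.\<close>

definition cos_bump :: "real \<Rightarrow> 'a::euclidean_space \<Rightarrow> real" where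
  "cos_bump p z = (\<Prod>b\<in>Basis. (1 + cos (z \<bullet> b / p)) / 2)"

definition cell :: "real \<Rightarrow> 'a::euclidean_space set" where
  "cell p = {z. \<forall>b\<in>Basis. \<bar>z \<bullet> b\<bar> \<le> pi * p}"

lemma cell_eq_cbox: "cell p = cbox (\<Sum>b\<in>Basis. - (pi * p) *\<^sub>R b) (\<Sum>b\<in>Basis. (pi * p) *\<^sub>R b)"
proof -
  have "(\<Sum>b\<in>Basis. c *\<^sub>R b) \<bullet> i = c" if "i \<in> Basis" for c and i :: 'a
    using inner_sum_left_Basis[OF that, of "\<lambda>_. c"] .
  then show ?thesis
    by (auto simp: cell_def mem_box abs_le_iff minus_le_iff simp del: scaleR_minus_left)
qed

lemma compact_cell: "compact (cell p)"
  by (simp add: cell_eq_cbox)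

lemma sets_cell [measurable]: "cell p \<in> sets borel"
  by (simp add: cell_eq_cbox)

lemma ball_subset_cell:
  assumes "0 < p" shows "cball 0 p \<subseteq> cell p"
proof
  fix z :: 'a assume z: "z \<in> cball 0 p"
  have "p \<le> pi * p"
    using mult_right_mono[of 1 pi p] pi_ge_two assms by linarith
  moreover have "\<bar>z \<bullet> b\<bar> \<le> p" if "b \<in> Basis" for b
    using Basis_le_norm[OF that, of z] z by simp
  ultimately show "z \<in> cell p"
    by (force simp: cell_def)
qed

lemma cos_bump_trig_poly: "cos_bump p \<in> trig_poly"
proof -
  have "(\<lambda>z::'a. (1 + cos (z \<bullet> b / p)) / 2) \<in> trig_poly" for b
  proof -
    have "(\<lambda>z::'a. (1 + cos (z \<bullet> b / p)) / 2) = (\<lambda>z. 1 / 2 * cos (0 \<bullet> z + 0) + 1 / 2 * cos ((b /\<^sub>R p) \<bullet> z + 0))"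
      by (auto simp: field_simps inner_commute)
    also have "\<dots> \<in> trig_poly" by (intro trig_poly.intros)
    finally show ?thesis .
  qed
  then show ?thesis
    unfolding cos_bump_def[abs_def] by (rule trig_poly_prod)
qed

lemma half_cos_bounds: "0 \<le> (1 + cos x) / (2::real)" "(1 + cos x) / 2 \<le> (1::real)"
  using cos_ge_minus_one[of x] cos_le_one[of x] by (simp_all, linarith)

lemma cos_bump_bounds: "0 \<le> cos_bump p z" "cos_bump p z \<le> 1"
  unfolding cos_bump_def by (auto intro!: prod_nonneg prod_le_1 half_cos_bounds)

lemma cos_bump_minus: "cos_bump p (- z) = cos_bump p z"
  by (simp add: cos_bump_def)

lemma cos_bump_less_1:
  assumes "0 < p" "z \<in> cell p" "z \<noteq> 0"
  shows "cos_bump p z < 1"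
proof -
  obtain b where b: "b \<in> Basis" "z \<bullet> b \<noteq> 0"
    using assms(3) by (metis euclidean_all_zero_iff)
  have "\<bar>z \<bullet> b\<bar> / p \<le> pi"
    using assms b by (simp add: cell_def divide_le_eq)
  then have "cos (\<bar>z \<bullet> b\<bar> / p) < cos 0"
    using assms b by (subst cos_mono_less_eq) auto
  moreover have "cos (z \<bullet> b / p) = cos (\<bar>z \<bullet> b\<bar> / p)"
    by (simp add: abs_if)
  ultimately have lt: "(1 + cos (z \<bullet> b / p)) / 2 < 1" by simp
  have "cos_bump p z = (1 + cos (z \<bullet> b / p)) / 2 * (\<Prod>b\<in>Basis - {b}. (1 + cos (z \<bullet> b / p)) / 2)"
    unfolding cos_bump_def using b by (subst prod.remove) auto
  also have "\<dots> \<le> (1 + cos (z \<bullet> b / p)) / 2 * 1"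
    by (intro mult_left_mono prod_le_1 conjI half_cos_bounds)
  finally show ?thesis using lt by simp
qed

text \<open>The integral over the window from a - p to a + p has derivative h(a + p) - h(a - p) in
  a, which vanishes; the window may thus be moved to the origin.\<close>

lemma nn_integral_periodic:
  fixes h :: "real \<Rightarrow> real"
  assumes cont: "continuous_on UNIV h" and nonneg: "\<And>x. 0 \<le> h x" and per: "\<And>x. h (x + p) = h (x - p)"
    and p: "0 \<le> p"
  shows "(\<integral>\<^sup>+s. ennreal (h (a - s)) * indicator {-p..p} s \<partial>lborel) = (\<integral>\<^sup>+s. ennreal (h s) * indicator {-p..p} s \<partial>lborel)"
proof -
  obtain F where F: "\<And>x. DERIV F x :> h x"
    using einterval_antiderivative[of "-\<infinity>" "\<infinity>" h] cont
    by (auto simp: continuous_on_eq_continuous_at has_real_derivative_iff_has_vector_derivative)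
  define G where "G a = F (a + p) - F (a - p)" for a
  have "DERIV G x :> 0" for x
  proof -
    have "DERIV G x :> h (x + p) - h (x - p)"
      unfolding G_def[abs_def] by (auto intro!: derivative_eq_intros DERIV_chain'[OF _ F])
    then show ?thesis by (simp add: per)
  qed
  then have G: "G a = G 0"
    using DERIV_isconst_all by blast
  have [measurable]: "h \<in> borel_measurable borel"
    by (rule borel_measurable_continuous_onI[OF cont])
  have "(\<integral>\<^sup>+s. ennreal (h (a - s)) * indicator {-p..p} s \<partial>lborel) = ennreal (- F (a - p) - - F (a - - p))"
  proof (rule nn_integral_FTC_Icc)
    fix s
    have "((\<lambda>s. - F (a - s)) has_real_derivative h (a - s)) (at s)"
      by (auto intro!: derivative_eq_intros DERIV_chain'[OF _ F])
    then show "((\<lambda>s. - F (a - s)) has_real_derivative h (a - s)) (at s)" .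
  qed (use nonneg p in auto)
  also have "- F (a - p) - - F (a - - p) = F p - F (- p)"
    using G by (simp add: G_def)
  also have "\<dots> = (\<integral>\<^sup>+s. ennreal (h s) * indicator {-p..p} s \<partial>lborel)"
    using F nonneg p by (intro nn_integral_FTC_Icc[symmetric]) auto
  finally show ?thesis .
qed

text \<open>Needed because convolutions integrate over a fixed cell while the kernel is centred at
  \<open>x\<close>. The integrand factorises over coordinates, and each factor is a periodic
  function over a full period.\<close>

lemma nn_integral_cos_bump_translate:
  fixes x :: "'a::euclidean_space"
  assumes p: "0 < p"
  shows "(\<integral>\<^sup>+y. ennreal (cos_bump p (x - y) ^ m) * indicator (cell p) y \<partial>lborel) =
    (\<integral>\<^sup>+y. ennreal (cos_bump p y ^ m) * indicator (cell p) (y::'a) \<partial>lborel)"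
proof -
  define h where "h s = ((1 + cos (s / p)) / 2) ^ m" for s :: real
  have h: "continuous_on UNIV h" "\<And>x. 0 \<le> h x"
    unfolding h_def by (auto intro!: continuous_intros zero_le_power half_cos_bounds) (use p in simp)
  have [measurable]: "h \<in> borel_measurable borel"
    by (rule borel_measurable_continuous_onI[OF h(1)])
  have per: "h (x + pi * p) = h (x - pi * p)" for x
    using cos_periodic[of "x / p - pi"] p by (simp add: h_def add_divide_distrib diff_divide_distrib)
  have eq: "ennreal (cos_bump p (x - y) ^ m) * indicator (cell p) y =
      (\<Prod>b\<in>Basis. ennreal (h (x \<bullet> b - y \<bullet> b)) * indicator {- (pi * p)..pi * p} (y \<bullet> b))" for x y :: 'a
  proof -
    have "indicator (cell p) y = (\<Prod>b\<in>Basis. indicator {- (pi * p)..pi * p} (y \<bullet> b) :: ennreal)"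
    proof (cases "y \<in> cell p")
      case True
      then have "indicator {- (pi * p)..pi * p} (y \<bullet> b) = (1::ennreal)" if "b \<in> Basis" for b
        using that by (auto simp: cell_def indicator_def abs_le_iff)
      then show ?thesis using True by simp
    next
      case False
      then obtain b where b: "b \<in> Basis" "pi * p < \<bar>y \<bullet> b\<bar>"
        by (auto simp: cell_def not_le)
      then have "indicator {- (pi * p)..pi * p} (y \<bullet> b) = (0::ennreal)"
        by (auto simp: indicator_def)
      then have "(\<Prod>b\<in>Basis. indicator {- (pi * p)..pi * p} (y \<bullet> b) :: ennreal) = 0"
        using b by (auto intro!: prod_zero)
      then show ?thesis using False by simp
    qed
    moreover have "ennreal (cos_bump p (x - y) ^ m) = (\<Prod>b\<in>Basis. ennreal (h (x \<bullet> b - y \<bullet> b)))"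
      using h(2) by (subst prod_ennreal) (auto simp: cos_bump_def h_def prod_power_distrib inner_diff_left)
    ultimately show ?thesis
      by (simp add: prod.distrib)
  qed
  have int: "(\<integral>\<^sup>+y. ennreal (cos_bump p (x - y) ^ m) * indicator (cell p) y \<partial>lborel) =
      (\<Prod>b\<in>(Basis::'a set). \<integral>\<^sup>+s. ennreal (h s) * indicator {- (pi * p)..pi * p} s \<partial>lborel)" for x :: 'a
  proof -
    have per': "(\<integral>\<^sup>+s. ennreal (h (a - s)) * indicator {- (pi * p)..pi * p} s \<partial>lborel) =
        (\<integral>\<^sup>+s. ennreal (h s) * indicator {- (pi * p)..pi * p} s \<partial>lborel)" for a
      by (rule nn_integral_periodic[OF h per]) (use p in simp)
    show ?thesis
      unfolding eq
      by (subst nn_integral_lborel_prod[where f="\<lambda>b s. ennreal (h (x \<bullet> b - s)) * indicator {- (pi * p)..pi * p} s"])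
        (simp_all add: per')
  qed
  have "(\<integral>\<^sup>+y. ennreal (cos_bump p y ^ m) * indicator (cell p) (y::'a) \<partial>lborel) =
      (\<integral>\<^sup>+y. ennreal (cos_bump p (0 - y) ^ m) * indicator (cell p) (y::'a) \<partial>lborel)"
    by (simp add: cos_bump_minus)
  then show ?thesis by (simp only: int)
qed


text \<open>
  A high power of \<open>cos_bump n\<close>, normalised on the cell of periodicity, is an approximate identity
  among trigonometric polynomials.
\<close>

lemma trig_kernel_exists:
  assumes n: "0 < (n::nat)"
  shows "\<exists>K::'a::euclidean_space \<Rightarrow> real. K \<in> trig_poly \<and> (\<forall>z. 0 \<le> K z) \<and>
    (\<forall>x. (\<integral>\<^sup>+y. ennreal (K (x - y)) * indicator (cell n) y \<partial>lborel) = 1) \<and>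
    (\<integral>\<^sup>+z. ennreal (K z) * indicator (cell n) z \<partial>lborel) = 1 \<and>
    (\<integral>\<^sup>+z. ennreal (K z) * indicator (cell n - ball 0 (1 / n)) z \<partial>lborel) \<le> ennreal (1 / n)"
proof -
  let ?q = "cos_bump (real n) :: 'a \<Rightarrow> real"
  let ?C = "cell (real n) :: 'a set"
  let ?A = "?C - ball 0 (1 / n)"
  have n': "0 < real n" using n by simp
  have qc: "continuous_on S ?q" for S
    by (rule continuous_on_trig_poly[OF cos_bump_trig_poly])
  have [measurable]: "?q \<in> borel_measurable borel"
    by (rule trig_poly_measurable[OF cos_bump_trig_poly])
  have cA: "compact ?A"
    by (intro compact_diff compact_cell) auto
  \<comment> \<open>The maximum of the bump on the cell away from the origin, attained by
    compactness; any value below 1 serves if that part is empty.\<close>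
  obtain \<rho> where \<rho>: "0 \<le> \<rho>" "\<rho> < 1" "\<And>z. z \<in> ?A \<Longrightarrow> ?q z \<le> \<rho>"
  proof (cases "?A = {}")
    case False
    then obtain z where z: "z \<in> ?A" "\<And>y. y \<in> ?A \<Longrightarrow> ?q y \<le> ?q z"
      using continuous_attains_sup[OF cA False qc] by blast
    have "z \<noteq> 0" using z(1) n' by auto
    then have "?q z < 1" using z(1) cos_bump_less_1[OF n'] by auto
    then show thesis using z(2) cos_bump_bounds(1)[of n z] by (intro that[of "?q z"])
  next
    case True
    then show thesis by (intro that[of 0]) auto
  qed
  \<comment> \<open>A value strictly between \<open>\<rho>\<close> and the peak 1. The mass of the
    m-th power away from the origin is at most \<rho>^m times the volume of the cell, its total mass
    at least (\<rho>')^m times the volume of a small ball, and the quotient tends to 0 with growing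
    m.\<close>
  define \<rho>' where "\<rho>' = (1 + \<rho>) / 2"
  have \<rho>': "\<rho> < \<rho>'" "\<rho>' < 1" "0 < \<rho>'" using \<rho> by (auto simp: \<rho>'_def)
  have "isCont ?q 0"
    using qc[of UNIV] by (simp add: continuous_on_eq_continuous_at)
  moreover have "?q 0 = 1" by (simp add: cos_bump_def)
  ultimately have "\<forall>\<^sub>F z in at 0. \<rho>' < ?q z"
    using \<rho>' by (auto simp: isCont_def dest: order_tendstoD(1))
  then obtain d0 where d0: "d0 > 0" "\<And>z. z \<noteq> 0 \<Longrightarrow> dist z 0 < d0 \<Longrightarrow> \<rho>' < ?q z"
    unfolding eventually_at by auto
  \<comment> \<open>The cap \<open>real n\<close> keeps the small ball inside the cell over which
    the mass is measured.\<close>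
  define d where "d = min d0 (real n)"
  have d: "0 < d" and dC: "ball 0 d \<subseteq> ?C" and dq: "\<And>z. z \<in> ball 0 d \<Longrightarrow> \<rho>' \<le> ?q z"
  proof -
    show "0 < d" using d0 n' by (simp add: d_def)
    show "ball 0 d \<subseteq> ?C"
      by (rule order_trans[OF _ ball_subset_cell[OF n']]) (auto simp: d_def)
    show "\<rho>' \<le> ?q z" if "z \<in> ball 0 d" for z
      using d0(2)[of z] that \<open>?q 0 = 1\<close> \<rho>' by (cases "z = 0") (auto simp: d_def)
  qed
  define vC where "vC = measure lborel ?C"
  define vB where "vB = measure lborel (ball (0::'a) d)"
  have vC: "emeasure lborel ?C = ennreal vC"
    unfolding vC_def cell_eq_cbox by (intro emeasure_eq_ennreal_measure less_imp_neq[OF emeasure_lborel_cbox_finite[unfolded infinity_ennreal_def]])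
  have vB: "emeasure lborel (ball (0::'a) d) = ennreal vB"
    unfolding vB_def by (intro emeasure_eq_ennreal_measure less_imp_neq[OF emeasure_lborel_ball_finite[unfolded infinity_ennreal_def]])
  have vB_pos: "0 < vB"
    unfolding vB_def by (rule content_ball_pos[OF d])
  have vC_nonneg: "0 \<le> vC" by (simp add: vC_def)
  have "(\<lambda>m. (\<rho> / \<rho>') ^ m * (vC / vB)) \<longlonglongrightarrow> 0 * (vC / vB)"
    using \<rho> \<rho>' by (intro tendsto_mult LIMSEQ_power_zero tendsto_const) auto
  then have "\<forall>\<^sub>F m in sequentially. (\<rho> / \<rho>') ^ m * (vC / vB) < 1 / n"
    by (rule order_tendstoD(2)) (use n' in simp)
  then obtain m where "(\<rho> / \<rho>') ^ m * (vC / vB) < 1 / n"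
    by (auto simp: eventually_sequentially)
  then have m: "\<rho> ^ m * vC \<le> 1 / n * (\<rho>' ^ m * vB)"
    using \<rho>' vB_pos by (simp add: field_simps)
  define I where "I = (\<integral>\<^sup>+z. ennreal (?q z ^ m) * indicator ?C z \<partial>lborel)"
  have "I \<le> (\<integral>\<^sup>+z. indicator ?C z \<partial>lborel)"
    unfolding I_def using cos_bump_bounds
    by (intro nn_integral_mono) (auto simp: indicator_def intro!: power_le_one)
  also have "\<dots> < \<infinity>" by (simp add: vC)
  finally have I_fin: "I < \<infinity>" .
  then obtain c where c: "I = ennreal c" "0 \<le> c"
    by (cases I) auto
  have "ennreal (\<rho>' ^ m * vB) = (\<integral>\<^sup>+z. ennreal (\<rho>' ^ m) * indicator (ball (0::'a) d) z \<partial>lborel)"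
    using \<rho>' vB_pos by (simp add: nn_integral_cmult_indicator vB ennreal_mult)
  also have "\<dots> \<le> I"
    unfolding I_def using dC dq \<rho>'
    by (intro nn_integral_mono) (auto simp: indicator_def intro!: ennreal_leI power_mono)
  finally have I_ge: "\<rho>' ^ m * vB \<le> c"
    using c by simp
  then have c_pos: "0 < c"
    using mult_pos_pos[OF zero_less_power[OF \<rho>'(3), of m] vB_pos] by linarith
  define K where "K z = ?q z ^ m / c" for z
  have norm: "(\<integral>\<^sup>+z. ennreal (?q (f z) ^ m / c) * indicator S z \<partial>lborel) =
      ennreal (1 / c) * (\<integral>\<^sup>+z. ennreal (?q (f z) ^ m) * indicator S z \<partial>lborel)"
    if [measurable]: "f \<in> borel_measurable borel" "S \<in> sets borel" for f :: "'a \<Rightarrow> 'a" and S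
  proof -
    have "ennreal (?q (f z) ^ m / c) * indicator S z = ennreal (1 / c) * (ennreal (?q (f z) ^ m) * indicator S z)" for z
      using c_pos cos_bump_bounds(1)[of n "f z"]
      by (simp add: mult.assoc[symmetric] ennreal_mult[symmetric])
    then show ?thesis by (simp add: nn_integral_cmult)
  qed
  have 1: "ennreal (1 / c) * I = 1"
    using c_pos by (simp add: c ennreal_mult[symmetric])
  show ?thesis
  proof (intro exI[of _ K] conjI allI)
    have "(\<lambda>z. 1 / c * ?q z ^ m + 0 * ?q z ^ m) \<in> trig_poly"
      by (intro trig_poly.lin trig_poly_power cos_bump_trig_poly)
    then show "K \<in> trig_poly" by (simp add: K_def[abs_def])
    show "0 \<le> K z" for z
      using c_pos by (simp add: K_def cos_bump_bounds)
    show "(\<integral>\<^sup>+y. ennreal (K (x - y)) * indicator ?C y \<partial>lborel) = 1" for x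
      unfolding K_def using 1 by (subst norm) (auto simp: nn_integral_cos_bump_translate[OF n'] I_def)
    show "(\<integral>\<^sup>+z. ennreal (K z) * indicator ?C z \<partial>lborel) = 1"
      unfolding K_def using 1 by (subst norm) (auto simp: I_def)
    have "(\<integral>\<^sup>+z. ennreal (?q z ^ m) * indicator ?A z \<partial>lborel) \<le> (\<integral>\<^sup>+z. ennreal (\<rho> ^ m) * indicator ?C z \<partial>lborel)"
      using \<rho> cos_bump_bounds(1)
      by (intro nn_integral_mono) (auto simp: indicator_def intro!: ennreal_leI power_mono)
    also have "\<dots> = ennreal (\<rho> ^ m * vC)"
      using \<rho> vC_nonneg by (simp add: nn_integral_cmult_indicator vC ennreal_mult)
    also have "\<dots> \<le> ennreal (1 / n * c)"
      using order_trans[OF m mult_left_mono[OF I_ge, of "1 / real n"]] n' by (intro ennreal_leI) simp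
    finally have "ennreal (1 / c) * (\<integral>\<^sup>+z. ennreal (?q z ^ m) * indicator ?A z \<partial>lborel) \<le> ennreal (1 / c) * ennreal (1 / n * c)"
      by (rule mult_left_mono) simp
    also have "\<dots> = ennreal (1 / n)"
      using c_pos by (subst ennreal_mult[symmetric]) auto
    finally show "(\<integral>\<^sup>+z. ennreal (K z) * indicator ?A z \<partial>lborel) \<le> ennreal (1 / n)"
      unfolding K_def by (subst norm) auto
  qed
qed

section \<open>The normalised kernel\<close>

definition trig_kernel :: "nat \<Rightarrow> 'a::euclidean_space \<Rightarrow> real" where
  "trig_kernel n = (SOME K. K \<in> trig_poly \<and> (\<forall>z. 0 \<le> K z) \<and>
    (\<forall>x. (\<integral>\<^sup>+y. ennreal (K (x - y)) * indicator (cell n) y \<partial>lborel) = 1) \<and>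
    (\<integral>\<^sup>+z. ennreal (K z) * indicator (cell n) z \<partial>lborel) = 1 \<and>
    (\<integral>\<^sup>+z. ennreal (K z) * indicator (cell n - ball 0 (1 / n)) z \<partial>lborel) \<le> ennreal (1 / n))"

context
  fixes n :: nat assumes n: "0 < n"
begin

lemma trig_kernel:
  "trig_kernel n \<in> trig_poly" "0 \<le> trig_kernel n z"
  "(\<integral>\<^sup>+y. ennreal (trig_kernel n (x - y)) * indicator (cell n) y \<partial>lborel) = 1"
  "(\<integral>\<^sup>+z. ennreal (trig_kernel n z) * indicator (cell n) z \<partial>lborel) = 1"
  "(\<integral>\<^sup>+z. ennreal (trig_kernel n z) * indicator (cell n - ball 0 (1 / n)) z \<partial>lborel) \<le> ennreal (1 / n)"
  using someI_ex[OF trig_kernel_exists[OF n], folded trig_kernel_def] by blast+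

lemma continuous_on_trig_kernel: "continuous_on S (trig_kernel n)"
  by (rule continuous_on_trig_poly[OF trig_kernel(1)])

lemma trig_kernel_measurable [measurable]: "trig_kernel n \<in> borel_measurable borel"
  by (rule trig_poly_measurable[OF trig_kernel(1)])

lemma has_bochner_integral_trig_kernel:
  fixes x :: "'a::euclidean_space"
  shows
  "has_bochner_integral lborel (\<lambda>y. indicator (cell n) y * trig_kernel n (x - y)) 1"
  "has_bochner_integral lborel (\<lambda>z. indicator (cell n) z * trig_kernel n (z::'a)) 1"
proof -
  have "(\<integral>\<^sup>+y. ennreal (indicator (cell n) y * trig_kernel n (x - y)) \<partial>lborel) =
      (\<integral>\<^sup>+y. ennreal (trig_kernel n (x - y)) * indicator (cell n) y \<partial>lborel)"
    by (intro nn_integral_cong) (simp add: indicator_def)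
  then show "has_bochner_integral lborel (\<lambda>y. indicator (cell n) y * trig_kernel n (x - y)) 1"
    using trig_kernel(2,3) by (intro has_bochner_integral_nn_integral) (auto intro!: AE_I2 mult_nonneg_nonneg)
  have "(\<integral>\<^sup>+z. ennreal (indicator (cell n) z * trig_kernel n (z::'a)) \<partial>lborel) =
      (\<integral>\<^sup>+z. ennreal (trig_kernel n z) * indicator (cell n) z \<partial>(lborel :: 'a measure))"
    by (intro nn_integral_cong) (simp add: indicator_def)
  then show "has_bochner_integral lborel (\<lambda>z. indicator (cell n) z * trig_kernel n (z::'a)) 1"
    using trig_kernel(2) trig_kernel(4) by (intro has_bochner_integral_nn_integral) (auto intro!: AE_I2 mult_nonneg_nonneg)
qed

end

section \<open>Convolution of compactly supported functions with the kernel\<close>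

lemma distr_lborel_reflect: "distr lborel borel (\<lambda>z. x - z) = (lborel :: 'a::euclidean_space measure)"
  by (subst (2) lborel_affine[of "-1" x]) (simp_all add: density_1)

text \<open>The integral extends over the whole space although the kernel has mass 1 on every
  translate of the cell and hence infinite total mass. It converges because \<open>h\<close> has
  compact support, and as soon as the cell contains the support only one period is seen. Vector
  values serve for gradients.\<close>

definition kernel_conv :: "nat \<Rightarrow> ('a::euclidean_space \<Rightarrow> 'b::euclidean_space) \<Rightarrow> 'a \<Rightarrow> 'b" where
  "kernel_conv n h x = (\<integral>z. trig_kernel n z *\<^sub>R h (x - z) \<partial>lborel)"

context
  fixes h :: "'a::euclidean_space \<Rightarrow> 'b::euclidean_space" and R :: real
  assumes cont: "continuous_on UNIV h" and supp: "\<And>y. R < norm y \<Longrightarrow> h y = 0"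
begin

lemma kernel_conv_arg_measurable [measurable]: "h \<in> borel_measurable borel"
  by (rule borel_measurable_continuous_onI[OF cont])

lemma kernel_conv_integrable:
  assumes "0 < n"
  shows "integrable lborel (\<lambda>z. trig_kernel n z *\<^sub>R h (x - z))"
proof -
  have "continuous_on (cball x R) (\<lambda>z. trig_kernel n z *\<^sub>R h (x - z))"
    by (intro continuous_intros continuous_on_trig_kernel assms continuous_on_compose2[OF cont]) auto
  then have "integrable lborel (\<lambda>z. indicator (cball x R) z *\<^sub>R (trig_kernel n z *\<^sub>R h (x - z)))"
    by (intro borel_integrable_compact) auto
  moreover have "indicator (cball x R) z *\<^sub>R (trig_kernel n z *\<^sub>R h (x - z)) = trig_kernel n z *\<^sub>R h (x - z)" for z
    using supp[of "x - z"] by (cases "R < norm (x - z)") (auto simp: indicator_def dist_norm not_less)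
  ultimately show ?thesis by (simp only:)
qed

lemma kernel_conv_eq:
  assumes "0 < n"
  shows "kernel_conv n h x = (\<integral>y. trig_kernel n (x - y) *\<^sub>R h y \<partial>lborel)"
proof -
  note [measurable] = trig_kernel_measurable[OF assms]
  have "kernel_conv n h x = (\<integral>z. trig_kernel n z *\<^sub>R h (x - z) \<partial>distr lborel borel (\<lambda>z. x - z))"
    by (simp add: kernel_conv_def distr_lborel_reflect)
  then show ?thesis by (subst (asm) integral_distr) auto
qed

lemma kernel_conv_integrable':
  assumes "0 < n"
  shows "integrable lborel (\<lambda>y. trig_kernel n (x - y) *\<^sub>R h y)"
proof -
  note [measurable] = trig_kernel_measurable[OF assms]
  have "integrable (distr lborel borel (\<lambda>z. x - z)) (\<lambda>z. trig_kernel n z *\<^sub>R h (x - z))"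
    using kernel_conv_integrable[OF assms] by (simp add: distr_lborel_reflect)
  then show ?thesis by (subst (asm) integrable_distr_eq) auto
qed

lemma support_subset_cell: "0 < n \<Longrightarrow> R \<le> real n \<Longrightarrow> y \<notin> cell n \<Longrightarrow> h y = 0"
  using ball_subset_cell[of n] supp[of y] by force

text \<open>Written with \<open>h\<close> at the integration variable, the integral runs over the
  fixed cell that contains the support, where the kernel centred at any \<open>x\<close> has mass
  exactly 1.\<close>

lemma norm_kernel_conv_le:
  assumes n: "0 < n" "R \<le> real n" and B: "\<And>y. norm (h y) \<le> B"
  shows "norm (kernel_conv n h x) \<le> B"
proof -
  have B0: "0 \<le> B" using B[of 0] norm_ge_zero by (rule order_trans[rotated])
  have hb: "has_bochner_integral lborel (\<lambda>y. B * (indicator (cell n) y * trig_kernel n (x - y))) (B * 1)"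
    by (rule has_bochner_integral_mult_right) (rule has_bochner_integral_trig_kernel[OF n(1)])
  have "norm (kernel_conv n h x) \<le> (\<integral>y. norm (trig_kernel n (x - y) *\<^sub>R h y) \<partial>lborel)"
    unfolding kernel_conv_eq[OF n(1)] by (rule integral_norm_bound)
  also have "\<dots> \<le> (\<integral>y. B * (indicator (cell n) y * trig_kernel n (x - y)) \<partial>lborel)"
  proof (rule integral_mono)
    show "integrable lborel (\<lambda>y. norm (trig_kernel n (x - y) *\<^sub>R h y))"
      by (rule integrable_norm[OF kernel_conv_integrable'[OF n(1)]])
    show "integrable lborel (\<lambda>y. B * (indicator (cell n) y * trig_kernel n (x - y)))"
      using hb by (rule integrable.intros)
    show "norm (trig_kernel n (x - y) *\<^sub>R h y) \<le> B * (indicator (cell n) y * trig_kernel n (x - y))" for y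
      using support_subset_cell[OF n, of y] B[of y] trig_kernel(2)[OF n(1), of "x - y"] B0
      by (cases "y \<in> cell n") (auto simp: mult.commute[of B] intro!: mult_left_mono)
  qed
  also have "\<dots> = B"
    using has_bochner_integral_integral_eq[OF hb] by simp
  finally show ?thesis .
qed

text \<open>The constant \<open>h x\<close> is subtracted on one cell only, where the kernel has
  mass 1. Near the origin the continuity of \<open>h\<close> acts, in the rest of the cell the small
  mass 1/n, and outside the cell both terms vanish for large \<open>n\<close>.\<close>

lemma kernel_conv_tendsto:
  assumes B: "\<And>y. norm (h y) \<le> B"
  shows "(\<lambda>n. kernel_conv n h x) \<longlonglongrightarrow> h x"
proof (rule LIMSEQ_I)
  fix e :: real assume e: "0 < e"
  have B0: "0 \<le> B" using B[of 0] norm_ge_zero by (rule order_trans[rotated])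
  have "isCont h x" using cont by (simp add: continuous_on_eq_continuous_at)
  then obtain d where d: "0 < d" "\<And>y. dist y x < d \<Longrightarrow> dist (h y) (h x) < e / 3"
    using e unfolding continuous_at_eps_delta by (metis zero_less_divide_iff zero_less_numeral)
  \<comment> \<open>The first entry moves everything outside the cell out of the support of z
    \<mapsto> h(x - z), the second makes 1/n smaller than \<open>d\<close>, the third makes
    \<open>2 * B * (1 / n)\<close> at most \<open>e / 3\<close>.\<close>
  obtain N where N: "max (R + norm x + 1) (max (1 / d) (6 * B / e + 1)) < real N"
    using reals_Archimedean2 by blast
  show "\<exists>N. \<forall>n\<ge>N. norm (kernel_conv n h x - h x) < e"
  proof (intro exI allI impI)
    fix n assume "N \<le> n"
    then have nN: "real N \<le> real n" by simp
    have "0 < 1 / d" using d by simp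
    then have n0: "0 < real n" and n: "0 < n" using N nN by linarith+
    have nR: "R + norm x \<le> real n" using N nN by linarith
    have "1 / real n < d"
    proof -
      have "1 / d < real n" using N nN by linarith
      then show ?thesis using d n0 by (simp add: field_simps)
    qed
    have nB: "2 * B * (1 / n) \<le> e / 3"
    proof -
      have "6 * B / e \<le> real n" using N nN by linarith
      then show ?thesis using e n0 by (simp add: field_simps)
    qed
    note [measurable] = trig_kernel_measurable[OF n]
    let ?K = "trig_kernel n :: 'a \<Rightarrow> real" and ?C = "cell n :: 'a set"
    let ?A = "?C - ball 0 (1 / real n)"
    note K1 = has_bochner_integral_trig_kernel(2)[OF n]
    have iA: "integrable lborel (\<lambda>z. indicator ?A z * ?K z)"
      by (rule Bochner_Integration.integrable_bound[OF integrable.intros[OF K1]]) (auto simp: indicator_def)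
    have A_le: "(\<integral>z. indicator ?A z * ?K z \<partial>lborel) \<le> 1 / n"
    proof -
      have "ennreal (\<integral>z. indicator ?A z * ?K z \<partial>lborel) = (\<integral>\<^sup>+z. ennreal (indicator ?A z * ?K z) \<partial>lborel)"
        using trig_kernel(2)[OF n] by (intro nn_integral_eq_integral[symmetric] iA AE_I2 mult_nonneg_nonneg) auto
      also have "\<dots> = (\<integral>\<^sup>+z. ennreal (?K z) * indicator ?A z \<partial>lborel)"
        by (intro nn_integral_cong) (auto simp: indicator_def)
      also have "\<dots> \<le> ennreal (1 / n)" by (rule trig_kernel(5)[OF n])
      finally show ?thesis by simp
    qed
    have conv: "has_bochner_integral lborel (\<lambda>z. ?K z *\<^sub>R h (x - z) - (indicator ?C z * ?K z) *\<^sub>R h x) (kernel_conv n h x - 1 *\<^sub>R h x)"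
      unfolding kernel_conv_def
      by (intro has_bochner_integral_diff has_bochner_integral_scaleR_left K1
          has_bochner_integral_integrable kernel_conv_integrable n)
    let ?g = "\<lambda>z. e / 3 * (indicator ?C z * ?K z) + 2 * B * (indicator ?A z * ?K z)"
    have hg: "has_bochner_integral lborel ?g (e / 3 * 1 + 2 * B * (\<integral>z. indicator ?A z * ?K z \<partial>lborel))"
      by (intro has_bochner_integral_add has_bochner_integral_mult_right K1 has_bochner_integral_integrable iA)
    note ig = integrable.intros[OF hg]
    have "norm (kernel_conv n h x - h x) = norm (\<integral>z. ?K z *\<^sub>R h (x - z) - (indicator ?C z * ?K z) *\<^sub>R h x \<partial>lborel)"
      using has_bochner_integral_integral_eq[OF conv] by simp
    also have "\<dots> \<le> (\<integral>z. norm (?K z *\<^sub>R h (x - z) - (indicator ?C z * ?K z) *\<^sub>R h x) \<partial>lborel)"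
      by (rule integral_norm_bound)
    also have "\<dots> \<le> (\<integral>z. ?g z \<partial>lborel)"
    proof (rule integral_mono[OF integrable_norm[OF integrable.intros[OF conv]] ig])
      fix z
      have K: "0 \<le> ?K z" by (rule trig_kernel(2)[OF n])
      show "norm (?K z *\<^sub>R h (x - z) - (indicator ?C z * ?K z) *\<^sub>R h x) \<le> ?g z"
      proof (cases "z \<in> ?C")
        case False
        then have "real n < norm z"
          using ball_subset_cell[OF n0] by (auto simp: subset_iff not_le)
        then have "R < norm (x - z)"
          using nR norm_triangle_ineq4[of x "x - z"] by simp
        then show ?thesis using False by (simp add: supp)
      next
        case True
        have eq: "?K z *\<^sub>R h (x - z) - (indicator ?C z * ?K z) *\<^sub>R h x = ?K z *\<^sub>R (h (x - z) - h x)"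
          using True by (simp add: scaleR_diff_right)
        have nle: "norm (?K z *\<^sub>R h (x - z) - (indicator ?C z * ?K z) *\<^sub>R h x) = ?K z * norm (h (x - z) - h x)"
          unfolding eq using K by simp
        show ?thesis
        proof (cases "norm z < 1 / n")
          case near: True
          then have "norm (h (x - z) - h x) \<le> e / 3"
            using d(2)[of "x - z"] \<open>1 / real n < d\<close> by (simp add: dist_norm)
          from mult_left_mono[OF this K] show ?thesis
            unfolding nle using True near by (simp add: mult.commute)
        next
          case far: False
          have "norm (h (x - z) - h x) \<le> 2 * B"
            using norm_triangle_ineq4[of "h (x - z)" "h x"] B[of "x - z"] B[of x] by linarith
          from mult_left_mono[OF this K] have "?K z * norm (h (x - z) - h x) \<le> 2 * B * ?K z"
            by (simp add: mult.commute)
          also have "\<dots> \<le> e / 3 * ?K z + 2 * B * ?K z"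
            using K e by simp
          finally show ?thesis
            unfolding nle using True far by simp
        qed
      qed
    qed
    also have "\<dots> = e / 3 * 1 + 2 * B * (\<integral>z. indicator ?A z * ?K z \<partial>lborel)"
      by (rule has_bochner_integral_integral_eq[OF hg])
    also have "\<dots> \<le> e / 3 + 2 * B * (1 / n)"
      using A_le B0 by (intro add_mono mult_left_mono) auto
    also have "\<dots> < e" using nB e by linarith
    finally show "norm (kernel_conv n h x - h x) < e" .
  qed
qed

text \<open>The increment of \<open>h\<close> is nonzero only if one of the two shifted points lies
  in the cell. The two resulting regions of integration have kernel mass 1 each, whence the factor
  2.\<close>

lemma kernel_conv_lipschitz:
  assumes n: "0 < n" "R \<le> real n" and L: "\<And>y y'. norm (h y - h y') \<le> L * norm (y - y')"
  shows "norm (kernel_conv n h x - kernel_conv n h x') \<le> 2 * L * norm (x - x')"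
proof -
  let ?K = "trig_kernel n :: 'a \<Rightarrow> real" and ?c = "L * norm (x - x')"
  note [measurable] = trig_kernel_measurable[OF n(1)]
  have c: "0 \<le> ?c" using L[of x x'] norm_ge_zero by (rule order_trans[rotated])
  have hb: "has_bochner_integral lborel (\<lambda>z. indicator (cell n) (w - z) * ?K z) 1" for w :: 'a
  proof -
    have "has_bochner_integral (distr lborel borel (\<lambda>z. w - z)) (\<lambda>y. indicator (cell n) y * ?K (w - y)) 1"
      using has_bochner_integral_trig_kernel(1)[OF n(1), of w] by (simp only: distr_lborel_reflect)
    then show ?thesis
      by (simp add: has_bochner_integral_iff integrable_distr_eq integral_distr)
  qed
  have conv: "has_bochner_integral lborel (\<lambda>z. ?K z *\<^sub>R h (x - z) - ?K z *\<^sub>R h (x' - z)) (kernel_conv n h x - kernel_conv n h x')"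
    unfolding kernel_conv_def
    by (intro has_bochner_integral_diff has_bochner_integral_integrable kernel_conv_integrable n)
  have hg: "has_bochner_integral lborel (\<lambda>z. ?c * (indicator (cell n) (x - z) * ?K z + indicator (cell n) (x' - z) * ?K z)) (?c * (1 + 1))"
    by (intro has_bochner_integral_mult_right has_bochner_integral_add hb)
  have "norm (kernel_conv n h x - kernel_conv n h x') \<le> (\<integral>z. norm (?K z *\<^sub>R h (x - z) - ?K z *\<^sub>R h (x' - z)) \<partial>lborel)"
    unfolding has_bochner_integral_integral_eq[OF conv, symmetric] by (rule integral_norm_bound)
  also have "\<dots> \<le> (\<integral>z. ?c * (indicator (cell n) (x - z) * ?K z + indicator (cell n) (x' - z) * ?K z) \<partial>lborel)"
  proof (rule integral_mono[OF integrable_norm[OF integrable.intros[OF conv]] integrable.intros[OF hg]])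
    fix z
    have K: "0 \<le> ?K z" by (rule trig_kernel(2)[OF n(1)])
    have le: "norm (?K z *\<^sub>R h (x - z) - ?K z *\<^sub>R h (x' - z)) \<le> ?K z * ?c"
    proof -
      have "norm (h (x - z) - h (x' - z)) \<le> ?c"
        using L[of "x - z" "x' - z"] by simp
      from mult_left_mono[OF this K] show ?thesis
        unfolding scaleR_diff_right[symmetric] norm_scaleR abs_of_nonneg[OF K] .
    qed
    have Kc: "0 \<le> ?K z * ?c" using K c by simp
    show "norm (?K z *\<^sub>R h (x - z) - ?K z *\<^sub>R h (x' - z)) \<le> ?c * (indicator (cell n) (x - z) * ?K z + indicator (cell n) (x' - z) * ?K z)"
    proof (cases "x - z \<in> cell n \<or> x' - z \<in> cell n")
      case True
      then have "1 \<le> indicator (cell n) (x - z) + (indicator (cell n) (x' - z) :: real)"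
        by (auto simp: indicator_def)
      from mult_left_mono[OF this Kc]
      have "?K z * ?c \<le> ?c * (indicator (cell n) (x - z) * ?K z + indicator (cell n) (x' - z) * ?K z)"
        by (simp only: distrib_left mult_1_right mult_ac)
      with le show ?thesis by linarith
    next
      case False
      then show ?thesis using support_subset_cell[OF n] by simp
    qed
  qed
  also have "\<dots> = 2 * L * norm (x - x')"
    unfolding has_bochner_integral_integral_eq[OF hg] by (simp only: one_add_one mult_ac)
  finally show ?thesis .
qed

end

declare kernel_conv_arg_measurable [measurable del]

text \<open>The addition formula separates \<open>x\<close> from the integration variable, so the
  integrals over \<open>y\<close> become coefficients of cosines in \<open>x\<close>.\<close>

lemma kernel_conv_trig_poly:
  fixes h :: "'a::euclidean_space \<Rightarrow> real"
  assumes cont: "continuous_on UNIV h" and supp: "\<And>y. R < norm y \<Longrightarrow> h y = 0" and n: "0 < n"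
  shows "kernel_conv n h \<in> trig_poly"
proof -
  have [measurable]: "h \<in> borel_measurable borel"
    by (rule borel_measurable_continuous_onI[OF cont])
  have "integrable lborel (\<lambda>y. indicator (cball 0 R) y *\<^sub>R h y)"
    using cont by (intro borel_integrable_compact) (auto intro: continuous_on_subset)
  moreover have "indicator (cball 0 R) y *\<^sub>R h y = h y" for y
    using supp[of y] by (cases "R < norm y") (auto simp: indicator_def not_less)
  ultimately have ih: "integrable lborel h" by (simp only:)
  have bi: "integrable lborel (\<lambda>y. f y * h y)" if [measurable]: "f \<in> borel_measurable borel" and "\<And>y. \<bar>f y\<bar> \<le> 1" for f
    by (rule Bochner_Integration.integrable_bound[OF ih]) (use that in \<open>auto simp: abs_mult intro!: mult_left_le_one_le\<close>)
  \<comment> \<open>Integrability is part of the induction claim, since the linear step has to split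
    the integral.\<close>
  have main: "integrable lborel (\<lambda>y. f (x - y) * h y) \<and> (\<lambda>x. \<integral>y. f (x - y) * h y \<partial>lborel) \<in> trig_poly" if "f \<in> trig_poly" for f x
    using that
  proof (induction arbitrary: x rule: trig_poly.induct)
    case (cos \<xi> \<theta>)
    \<comment> \<open>The sine in \<open>x\<close> is written with the phase
      \<open>- pi / 2\<close>, as only cosines generate the set.\<close>
    have eq: "cos (\<xi> \<bullet> (x - y) + \<theta>) * h y = cos (\<xi> \<bullet> x + 0) * (cos (\<xi> \<bullet> y - \<theta>) * h y) + cos (\<xi> \<bullet> x + (- pi / 2)) * (sin (\<xi> \<bullet> y - \<theta>) * h y)" for x y
    proof -
      have "\<xi> \<bullet> (x - y) + \<theta> = \<xi> \<bullet> x - (\<xi> \<bullet> y - \<theta>)" by (simp add: inner_simps)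
      moreover have "cos (\<xi> \<bullet> x + (- pi / 2)) = sin (\<xi> \<bullet> x)"
        using cos_sin_eq[of "\<xi> \<bullet> x + (- pi / 2)"] by (simp add: cos_add)
      ultimately show ?thesis
        by (simp only: cos_diff[of "\<xi> \<bullet> x"]) (simp add: algebra_simps)
    qed
    have i: "integrable lborel (\<lambda>y. cos (\<xi> \<bullet> y - \<theta>) * h y)" "integrable lborel (\<lambda>y. sin (\<xi> \<bullet> y - \<theta>) * h y)"
      by (rule bi, simp_all)+
    have "(\<integral>y. cos (\<xi> \<bullet> (x - y) + \<theta>) * h y \<partial>lborel) = (\<integral>y. cos (\<xi> \<bullet> y - \<theta>) * h y \<partial>lborel) * cos (\<xi> \<bullet> x + 0) +
        (\<integral>y. sin (\<xi> \<bullet> y - \<theta>) * h y \<partial>lborel) * cos (\<xi> \<bullet> x + (- pi / 2))" for x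
      unfolding eq using i by simp
    moreover have "integrable lborel (\<lambda>y. cos (\<xi> \<bullet> (x - y) + \<theta>) * h y)"
      by (rule bi) simp_all
    ultimately show ?case
      using trig_poly.lin[OF trig_poly.cos[of \<xi> 0] trig_poly.cos[of \<xi> "- pi / 2"]] by (simp only: simp_thms)
  next
    case (lin f g a b)
    have "(\<integral>y. (a * f (x - y) + b * g (x - y)) * h y \<partial>lborel) =
        a * (\<integral>y. f (x - y) * h y \<partial>lborel) + b * (\<integral>y. g (x - y) * h y \<partial>lborel)" for x
      using lin.IH by (simp add: distrib_right mult.assoc)
    moreover have "integrable lborel (\<lambda>y. (a * f (x - y) + b * g (x - y)) * h y)"
      using lin.IH by (simp add: distrib_right mult.assoc)
    moreover have "(\<lambda>x. a * (\<integral>y. f (x - y) * h y \<partial>lborel) + b * (\<integral>y. g (x - y) * h y \<partial>lborel)) \<in> trig_poly"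
      by (rule trig_poly.lin) (use lin.IH in blast)+
    ultimately show ?case by (simp only: simp_thms)
  qed
  moreover have "kernel_conv n h = (\<lambda>x. \<integral>y. trig_kernel n (x - y) * h y \<partial>lborel)"
    using kernel_conv_eq[OF cont supp n] by (simp add: fun_eq_iff)
  moreover have "(\<lambda>x. \<integral>y. f (x - y) * h y \<partial>lborel) \<in> trig_poly" if "f \<in> trig_poly" for f
    using main[OF that] by blast
  ultimately show ?thesis
    using trig_kernel(1)[OF n] by (simp only:)
qed

text \<open>The kernel itself is not integrable, so differentiation is confined to the unit ball
  around \<open>x\<close>: for all its points the shifted supports lie in one common ball, on which
  the continuous kernel is integrable.\<close>

lemma kernel_conv_has_gradient:
  fixes h :: "'a::euclidean_space \<Rightarrow> real"
  assumes h: "\<And>y. (h has_derivative (\<lambda>v. D y \<bullet> v)) (at y)" and D: "continuous_on UNIV D"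
    and supp: "\<And>y. R < norm y \<Longrightarrow> h y = 0" "\<And>y. R < norm y \<Longrightarrow> D y = 0"
    and B: "\<And>y. norm (D y) \<le> B" and n: "0 < n"
  shows "(kernel_conv n h has_derivative (\<lambda>v. kernel_conv n D x \<bullet> v)) (at x)"
proof -
  note [measurable] = trig_kernel_measurable[OF n]
  have [measurable]: "D \<in> borel_measurable borel"
    by (rule borel_measurable_continuous_onI[OF D])
  have cont: "continuous_on UNIV h"
    by (rule has_derivative_continuous_on[of _ _ "\<lambda>y v. D y \<bullet> v"]) (use h in auto)
  let ?K = "trig_kernel n :: 'a \<Rightarrow> real" and ?S = "cball 0 (R + norm x + 1) :: 'a set"
  have B0: "0 \<le> B" using B[of 0] norm_ge_zero by (rule order_trans[rotated])
  have "((\<lambda>y. \<integral>z. ?K z *\<^sub>R h (y - z) \<partial>lborel) has_derivative (\<lambda>v. (\<integral>z. ?K z *\<^sub>R D (x - z) \<partial>lborel) \<bullet> v)) (at x)"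
  proof (rule integral_has_gradient[where S="ball x 1" and g="\<lambda>z. B * (indicator ?S z *\<^sub>R ?K z)"])
    show "integrable lborel (\<lambda>z. ?K z *\<^sub>R h (y - z))" for y
      by (rule kernel_conv_integrable[OF cont supp(1) n])
    have "((\<lambda>y. h (y - z)) has_derivative (\<lambda>v. D (y - z) \<bullet> v)) (at y)" for y z
    proof -
      have "((\<lambda>y. y - z) has_derivative (\<lambda>v. v)) (at y)"
        by (auto intro!: derivative_eq_intros)
      from has_derivative_compose[OF this h] show ?thesis .
    qed
    then show "((\<lambda>y. ?K z *\<^sub>R h (y - z)) has_derivative (\<lambda>v. (?K z *\<^sub>R D (y - z)) \<bullet> v)) (at y)" for y z
      by (auto intro!: derivative_eq_intros)
    show "integrable lborel (\<lambda>z. B * (indicator ?S z *\<^sub>R ?K z))"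
      by (intro integrable_mult_right borel_integrable_compact continuous_on_trig_kernel n) auto
    show "norm (?K z *\<^sub>R D (y - z)) \<le> B * (indicator ?S z *\<^sub>R ?K z)" if "y \<in> ball x 1" for y z
    proof (cases "R < norm (y - z)")
      case True
      then show ?thesis using supp(2) B0 trig_kernel(2)[OF n, of z] by (simp add: indicator_def)
    next
      case False
      have "norm z \<le> norm (y - z) + norm (x - y) + norm x"
        using norm_triangle_ineq4[of y "y - z"] norm_triangle_ineq4[of x "x - y"] by simp
      then have "z \<in> ?S" using False that by (simp add: dist_norm)
      then show ?thesis
        using mult_right_mono[OF B[of "y - z"] trig_kernel(2)[OF n, of z]] trig_kernel(2)[OF n, of z]
        by (simp add: mult.commute)
    qed
  qed auto
  then show ?thesis
    by (simp add: kernel_conv_def[abs_def])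
qed

subsection \<open>Bounded continuous functions and characteristic functions\<close>

definition cutoff :: "nat \<Rightarrow> 'a::euclidean_space \<Rightarrow> real" where
  "cutoff n x = max 0 (min 1 (real n + 1 - norm x))"

text \<open>Two limits are taken: kernel convolutions reach compactly supported functions, cutoffs
  then reach all bounded continuous ones, both with the bound of \<open>h\<close> kept. The
  principle serves for the uniqueness of characteristic functions and for joint measurability of the
  semigroup.\<close>

lemma bounded_continuous_induct:
  fixes h :: "'a::euclidean_space \<Rightarrow> real"
  assumes cos: "\<And>\<xi> \<theta>. P (\<lambda>x. cos (\<xi> \<bullet> x + \<theta>))"
    and lin: "\<And>f g a b. P f \<Longrightarrow> P g \<Longrightarrow> P (\<lambda>x. a * f x + b * g x)"
    and lim: "\<And>f g C. (\<And>n. P (f n)) \<Longrightarrow> (\<And>n x. \<bar>f n x\<bar> \<le> C) \<Longrightarrow> (\<And>x. (\<lambda>n. f n x) \<longlonglongrightarrow> g x) \<Longrightarrow>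
      continuous_on UNIV g \<Longrightarrow> P g"
    and h: "continuous_on UNIV h" "\<And>x. \<bar>h x\<bar> \<le> B"
  shows "P h"
proof -
  have trig: "P f" if "f \<in> trig_poly" for f
    using that by (induction rule: trig_poly.induct) (auto intro: cos lin)
  have compact: "P f" if f: "continuous_on UNIV f" "\<And>x. \<bar>f x\<bar> \<le> B" and supp: "\<And>x. R < norm x \<Longrightarrow> f x = 0" for f R
  proof -
    obtain N where N: "max 1 R \<le> real N" using real_arch_simple by blast
    then have N': "0 < n + N" "R \<le> real (n + N)" for n by auto
    show ?thesis
    proof (rule lim)
      show "P (kernel_conv (n + N) f)" for n
        by (rule trig[OF kernel_conv_trig_poly[OF f(1) supp N'(1)]])
      show "\<bar>kernel_conv (n + N) f x\<bar> \<le> B" for n x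
        using norm_kernel_conv_le[OF f(1) supp N', of B] f(2) by simp
      show "(\<lambda>n. kernel_conv (n + N) f x) \<longlonglongrightarrow> f x" for x
        by (rule LIMSEQ_ignore_initial_segment, rule kernel_conv_tendsto[OF f(1) supp]) (use f(2) in auto)
    qed fact
  qed
  show ?thesis
  proof (rule lim)
    have c01: "0 \<le> cutoff n x" "cutoff n x \<le> 1" for n and x :: 'a
      by (auto simp: cutoff_def)
    show b: "\<bar>cutoff n x * h x\<bar> \<le> B" for n x
      using h(2)[of x] c01[of n x] by (auto simp: abs_mult intro: order_trans[OF mult_left_le_one_le])
    show "P (\<lambda>x. cutoff n x * h x)" for n
    proof (rule compact[of _ "real n + 1"])
      show "continuous_on UNIV (\<lambda>x. cutoff n x * h x)"
        unfolding cutoff_def by (intro continuous_intros h)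
    qed (use b in \<open>auto simp: cutoff_def\<close>)
    show "(\<lambda>n. cutoff n x * h x) \<longlonglongrightarrow> h x" for x
    proof (rule tendsto_eventually)
      obtain N where "norm x \<le> real N" using real_arch_simple by blast
      then have "cutoff n x = 1" if "N \<le> n" for n
        using that by (auto simp: cutoff_def)
      then show "\<forall>\<^sub>F n in sequentially. cutoff n x * h x = h x"
        unfolding eventually_sequentially by (intro exI[of _ N]) auto
    qed
  qed fact
qed

context prob_space
begin

lemma integrable_bounded_continuous:
  fixes h :: "'a \<Rightarrow> 'b::{banach, second_countable_topology}"
  assumes "h \<in> borel_measurable M" "\<And>x. norm (h x) \<le> B"
  shows "integrable M h"
  by (rule integrable_const_bound[of _ B]) (use assms in auto)

end

lemma integral_cos_eq_cf:
  fixes \<mu> :: "'a::euclidean_space measure"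
  assumes "prob_space \<mu>" and [measurable_cong]: "sets \<mu> = sets borel"
  shows "(\<integral>y. cos (\<xi> \<bullet> y + \<theta>) \<partial>\<mu>) = Re (iexp \<theta> * cf \<mu> \<xi>)"
proof -
  interpret prob_space \<mu> by fact
  have int: "complex_integrable \<mu> (\<lambda>y. iexp (\<xi> \<bullet> y))"
    by (rule integrable_bounded_continuous[of _ 1]) auto
  have "Re (iexp \<theta> * cf \<mu> \<xi>) = Re (\<integral>y. iexp \<theta> * iexp (\<xi> \<bullet> y) \<partial>\<mu>)"
    unfolding cf_def by (simp add: integral_mult_right_zero)
  also have "\<dots> = (\<integral>y. Re (iexp \<theta> * iexp (\<xi> \<bullet> y)) \<partial>\<mu>)"
    using int by (intro integral_Re[symmetric] integrable_mult_right)
  also have "\<dots> = (\<integral>y. cos (\<xi> \<bullet> y + \<theta>) \<partial>\<mu>)"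
    by (rule Bochner_Integration.integral_cong) (auto simp: exp_add[symmetric] Re_exp algebra_simps)
  finally show ?thesis ..
qed

text \<open>The values of the characteristic function are the integrals of cosines, the generators
  of the induction; bounded convergence provides the limit step.\<close>

lemma cf_eq_imp_integral_eq:
  fixes h :: "'a::euclidean_space \<Rightarrow> real"
  assumes \<mu>: "prob_space \<mu>" and s\<mu> [measurable_cong]: "sets \<mu> = sets borel"
    and \<rho>: "prob_space \<rho>" and s\<rho> [measurable_cong]: "sets \<rho> = sets borel"
    and eq: "\<And>\<xi>. cf \<mu> \<xi> = cf \<rho> \<xi>"
    and h: "continuous_on UNIV h" "\<And>x. \<bar>h x\<bar> \<le> B"
  shows "(\<integral>x. h x \<partial>\<mu>) = (\<integral>x. h x \<partial>\<rho>)"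
proof -
  interpret A: prob_space \<mu> by fact
  interpret B: prob_space \<rho> by fact
  let ?P = "\<lambda>f::'a \<Rightarrow> real. continuous_on UNIV f \<and> (\<exists>B. \<forall>x. \<bar>f x\<bar> \<le> B) \<and> (\<integral>x. f x \<partial>\<mu>) = (\<integral>x. f x \<partial>\<rho>)"
  have meas: "f \<in> borel_measurable \<mu>" "f \<in> borel_measurable \<rho>" if "continuous_on UNIV f" for f :: "'a \<Rightarrow> real"
  proof -
    have [measurable]: "f \<in> borel_measurable borel" by (rule borel_measurable_continuous_onI[OF that])
    show "f \<in> borel_measurable \<mu>" "f \<in> borel_measurable \<rho>" by measurable
  qed
  have int: "integrable \<mu> f \<and> integrable \<rho> f" if "?P f" for f :: "'a \<Rightarrow> real"
    using that meas A.integrable_bounded_continuous[of f] B.integrable_bounded_continuous[of f] by auto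
  have "?P h"
  proof (rule bounded_continuous_induct[where P="?P"])
    fix \<xi> :: 'a and \<theta>
    show "?P (\<lambda>x. cos (\<xi> \<bullet> x + \<theta>))"
      using eq by (auto simp: integral_cos_eq_cf[OF \<mu> s\<mu>] integral_cos_eq_cf[OF \<rho> s\<rho>] intro!: continuous_intros exI[of _ 1])
  next
    fix f g a b assume f: "?P f" and g: "?P g"
    obtain F G where "\<And>x. \<bar>f x\<bar> \<le> F" "\<And>x. \<bar>g x\<bar> \<le> G" using f g by blast
    then have "\<bar>a * f x + b * g x\<bar> \<le> \<bar>a\<bar> * F + \<bar>b\<bar> * G" for x
      by (intro order_trans[OF abs_triangle_ineq] add_mono) (auto simp: abs_mult intro: mult_left_mono)
    then show "?P (\<lambda>x. a * f x + b * g x)"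
      using f g int[OF f] int[OF g] by (auto intro!: continuous_intros)
  next
    fix f :: "nat \<Rightarrow> 'a \<Rightarrow> real" and g C
    assume f: "\<And>n. ?P (f n)" and C: "\<And>n x. \<bar>f n x\<bar> \<le> C"
      and l: "\<And>x. (\<lambda>n. f n x) \<longlonglongrightarrow> g x" and g: "continuous_on UNIV g"
    have "(\<lambda>n. \<integral>x. f n x \<partial>\<mu>) \<longlonglongrightarrow> (\<integral>x. g x \<partial>\<mu>)" "(\<lambda>n. \<integral>x. f n x \<partial>\<rho>) \<longlonglongrightarrow> (\<integral>x. g x \<partial>\<rho>)"
      by (rule integral_dominated_convergence[where w="\<lambda>_. C"]; use f C l g meas in auto)+
    moreover have "\<bar>g x\<bar> \<le> C" for x
      by (rule LIMSEQ_le_const2[OF tendsto_rabs[OF l]]) (use C in auto)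
    ultimately show "?P g"
      using f g LIMSEQ_unique by auto
  qed (use h in auto)
  then show ?thesis by simp
qed

lemma continuous_cf:
  assumes "prob_space \<mu>" and [measurable_cong]: "sets \<mu> = sets borel"
  shows "continuous_on UNIV (cf \<mu>)"
proof -
  interpret prob_space \<mu> by fact
  have "(\<lambda>n. cf \<mu> (X n)) \<longlonglongrightarrow> cf \<mu> x" if X: "X \<longlonglongrightarrow> x" for X x
    unfolding cf_def
  proof (rule integral_dominated_convergence[where w="\<lambda>_. 1"])
    show "AE u in \<mu>. (\<lambda>n. iexp (X n \<bullet> u)) \<longlonglongrightarrow> iexp (x \<bullet> u)"
      by (intro AE_I2 tendsto_intros X)
  qed auto
  then show ?thesis
    by (auto simp: continuous_on_sequentially comp_def)
qed

subsection \<open>The semigroup\<close>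

text \<open>One constant for all three bounds, so that a sequence with common \<open>C\<close> is
  dominated uniformly. A Lipschitz gradient stands in for second derivatives: it suffices for
  Taylor's estimate and passes easily through convolution.\<close>

definition smooth_data :: "real \<Rightarrow> ('a::euclidean_space \<Rightarrow> real) \<Rightarrow> ('a \<Rightarrow> 'a) \<Rightarrow> bool" where
  "smooth_data C h D \<longleftrightarrow> (\<forall>x. (h has_derivative (\<lambda>v. D x \<bullet> v)) (at x)) \<and> (\<forall>x. \<bar>h x\<bar> \<le> C) \<and>
    (\<forall>x. norm (D x) \<le> C) \<and> (\<forall>x y. norm (D x - D y) \<le> C * norm (x - y))"

lemma smooth_dataD:
  assumes "smooth_data C h D"
  shows "(h has_derivative (\<lambda>v. D x \<bullet> v)) (at x)" "\<bar>h x\<bar> \<le> C" "norm (D x) \<le> C"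
    "norm (D x - D y) \<le> C * norm (x - y)" "0 \<le> C"
proof -
  show "(h has_derivative (\<lambda>v. D x \<bullet> v)) (at x)" "\<bar>h x\<bar> \<le> C" "norm (D x) \<le> C"
    "norm (D x - D y) \<le> C * norm (x - y)"
    using assms by (auto simp: smooth_data_def)
  then show "0 \<le> C" by linarith
qed

lemma lipschitz_of_gradient:
  fixes h :: "'a::euclidean_space \<Rightarrow> real"
  assumes h: "\<And>x. (h has_derivative (\<lambda>v. D x \<bullet> v)) (at x)" and S: "convex S" "x \<in> S" "y \<in> S"
    and D: "\<And>x. x \<in> S \<Longrightarrow> norm (D x) \<le> C"
  shows "\<bar>h x - h y\<bar> \<le> C * norm (x - y)"
proof -
  have "norm (h x - h y) \<le> C * norm (x - y)"
  proof (rule differentiable_bound[OF S(1)])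
    fix z assume z: "z \<in> S"
    show "(h has_derivative (\<lambda>v. D z \<bullet> v)) (at z within S)"
      using h by (rule has_derivative_at_withinI)
    have "norm (D z \<bullet> v) \<le> C * norm v" for v
      using Cauchy_Schwarz_ineq2[of "D z" v] mult_right_mono[OF D[OF z] norm_ge_zero[of v]] by simp
    then show "onorm (\<lambda>v. D z \<bullet> v) \<le> C" by (rule onorm_le)
  qed (use S in auto)
  then show ?thesis by simp
qed

lemma smooth_data_continuous:
  assumes "smooth_data C h D"
  shows "continuous_on UNIV h" "continuous_on UNIV D"
proof -
  show "continuous_on UNIV h"
    by (rule has_derivative_continuous_on[of _ _ "\<lambda>y v. D y \<bullet> v"]) (use smooth_dataD(1)[OF assms] in auto)
  have "C-lipschitz_on UNIV D"
    using smooth_dataD(4,5)[OF assms] by (auto intro!: lipschitz_onI simp: dist_norm)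
  then show "continuous_on UNIV D" by (rule lipschitz_on_continuous_on)
qed

text \<open>Subtracting the tangent at \<open>z\<close> leaves a function whose gradient is at most
  \<open>C * norm w\<close> on the ball of radius \<open>norm w\<close> around \<open>z\<close>; the
  mean value inequality contributes the second factor.\<close>

lemma smooth_data_taylor:
  assumes "smooth_data C h D"
  shows "\<bar>h (z + w) - h z - D z \<bullet> w\<bar> \<le> C * (norm w)\<^sup>2"
proof -
  note d = smooth_dataD[OF assms]
  have "\<bar>(h (z + w) - D z \<bullet> (z + w)) - (h z - D z \<bullet> z)\<bar> \<le> C * norm w * norm ((z + w) - z)"
  proof (rule lipschitz_of_gradient[where h="\<lambda>y. h y - D z \<bullet> y" and D="\<lambda>y. D y - D z" and S="cball z (norm w)"])
    show "((\<lambda>y. h y - D z \<bullet> y) has_derivative (\<lambda>v. (D x - D z) \<bullet> v)) (at x)" for x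
      unfolding inner_diff_left by (intro has_derivative_diff d(1) has_derivative_inner_right has_derivative_ident)
    show "norm (D x - D z) \<le> C * norm w" if "x \<in> cball z (norm w)" for x
    proof -
      have "norm (x - z) \<le> norm w" using that by (simp add: dist_norm norm_minus_commute)
      from mult_left_mono[OF this d(5)] show ?thesis using d(4)[of x z] by linarith
    qed
  qed (auto simp: dist_norm)
  then show ?thesis by (simp add: inner_add_right power2_eq_square algebra_simps)
qed

section \<open>Integrals against the transition laws\<close>

locale sd_semigroup = polar_levy \<sigma> k \<nu>
  for \<sigma> :: "'a::euclidean_space measure" and k \<nu> +
  fixes b :: 'a and \<mu>X :: "'a measure" and \<mu> :: "real \<Rightarrow> 'a measure" and \<epsilon> :: real
  assumes prob_X: "prob_space \<mu>X" and sets_X: "sets \<mu>X = sets borel"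
    and prob_\<mu>: "\<And>t. 0 \<le> t \<Longrightarrow> prob_space (\<mu> t)" and sets_\<mu>: "\<And>t. 0 \<le> t \<Longrightarrow> sets (\<mu> t) = sets borel"
    and cf_X: "\<And>\<xi>. cf \<mu>X \<xi> = exp (levy_exponent b \<xi>)"
    and cf_\<mu>: "\<And>t \<xi>. 0 \<le> t \<Longrightarrow> cf (\<mu> t) \<xi> = cf \<mu>X \<xi> / cf \<mu>X (exp (- t) *\<^sub>R \<xi>)"
    and \<epsilon>: "0 < \<epsilon>" "\<epsilon> < 1"
    and moment: "integrable \<mu>X (\<lambda>x. norm x powr \<epsilon>)"
begin

declare sets_X [measurable_cong]

sublocale X: prob_space \<mu>X by (rule prob_X)

text \<open>The semigroup without its contraction of the starting point, so that continuity and
  measurability are settled in a free variable \<open>z\<close>. Vector values allow the same facts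
  to be used for gradients.\<close>

definition Q :: "real \<Rightarrow> ('a \<Rightarrow> 'b::euclidean_space) \<Rightarrow> 'a \<Rightarrow> 'b" where
  "Q t h z = (\<integral>y. h (z + y) \<partial>\<mu> t)"

lemma integrable_\<mu>:
  fixes h :: "'a \<Rightarrow> 'b::euclidean_space"
  assumes "0 \<le> t" "continuous_on UNIV h" "\<And>x. norm (h x) \<le> B"
  shows "integrable (\<mu> t) (\<lambda>y. h (z + y))"
proof -
  interpret prob_space "\<mu> t" by (rule prob_\<mu>) fact
  note [measurable_cong] = sets_\<mu>[OF assms(1)]
  have [measurable]: "h \<in> borel_measurable borel"
    by (rule borel_measurable_continuous_onI) fact
  show ?thesis by (rule integrable_bounded_continuous[of _ B]) (use assms in auto)
qed

lemma norm_Q_le: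
  fixes h :: "'a \<Rightarrow> 'b::euclidean_space"
  assumes "0 \<le> t" "\<And>x. norm (h x) \<le> B"
  shows "norm (Q t h z) \<le> B"
proof -
  interpret prob_space "\<mu> t" by (rule prob_\<mu>) fact
  have "0 \<le> B" using assms(2)[of 0] norm_ge_zero by (rule order_trans[rotated])
  have "norm (Q t h z) \<le> (\<integral>y. norm (h (z + y)) \<partial>\<mu> t)"
    unfolding Q_def by (rule integral_norm_bound)
  also have "\<dots> \<le> (\<integral>y. B \<partial>\<mu> t)"
    using assms \<open>0 \<le> B\<close> by (intro integral_mono') auto
  finally show ?thesis by (simp add: prob_space)
qed

lemma Q_tendsto:
  fixes f :: "nat \<Rightarrow> 'a \<Rightarrow> 'b::euclidean_space"
  assumes t: "0 \<le> t" and f: "\<And>n. continuous_on UNIV (f n)" "\<And>n x. norm (f n x) \<le> B"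
    and g: "continuous_on UNIV g" and l: "\<And>y. (\<lambda>n. f n (z n + y)) \<longlonglongrightarrow> g (w + y)"
  shows "(\<lambda>n. Q t (f n) (z n)) \<longlonglongrightarrow> Q t g w"
proof -
  interpret prob_space "\<mu> t" by (rule prob_\<mu>) fact
  note [measurable_cong] = sets_\<mu>[OF t]
  have [measurable]: "f n \<in> borel_measurable borel" "g \<in> borel_measurable borel" for n
    by (rule borel_measurable_continuous_onI[OF f(1)], rule borel_measurable_continuous_onI[OF g])
  show ?thesis
    unfolding Q_def by (rule integral_dominated_convergence[where w="\<lambda>_. B"]) (use f l in auto)
qed

lemma continuous_Q:
  fixes h :: "'a \<Rightarrow> 'b::euclidean_space"
  assumes "0 \<le> t" "continuous_on UNIV h" "\<And>x. norm (h x) \<le> B"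
  shows "continuous_on UNIV (Q t h)"
proof -
  have "(\<lambda>n. h (z n + y)) \<longlonglongrightarrow> h (w + y)" if "z \<longlonglongrightarrow> w" for z w y
    using assms(2) that
    by (intro continuous_on_tendsto_compose[OF assms(2)] tendsto_intros) auto
  then show ?thesis
    using Q_tendsto[of t "\<lambda>_. h" B h] assms
    by (auto simp: continuous_on_sequentially comp_def)
qed

lemma Q_cos:
  assumes t: "0 \<le> t"
  shows "Q t (\<lambda>x. cos (\<xi> \<bullet> x + \<theta>)) z = Re (iexp (\<xi> \<bullet> z + \<theta>) * cf (\<mu> t) \<xi>)"
proof -
  have "Q t (\<lambda>x. cos (\<xi> \<bullet> x + \<theta>)) z = (\<integral>y. cos (\<xi> \<bullet> y + (\<xi> \<bullet> z + \<theta>)) \<partial>\<mu> t)"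
    unfolding Q_def by (simp add: inner_add_right ac_simps)
  also have "\<dots> = Re (iexp (\<xi> \<bullet> z + \<theta>) * cf (\<mu> t) \<xi>)"
    by (rule integral_cos_eq_cf[OF prob_\<mu>[OF t] sets_\<mu>[OF t]])
  finally show ?thesis .
qed

lemma cf_X_measurable [measurable]: "cf \<mu>X \<in> borel_measurable borel"
  by (rule borel_measurable_continuous_onI[OF continuous_cf[OF prob_X sets_X]])

text \<open>The laws \<open>\<mu> t\<close> are given separately for each \<open>t\<close>, without
  any assumed measurability in \<open>t\<close>. For cosines it comes from the quotient formula for
  the characteristic function, and pointwise limits carry it to all bounded continuous
  functions.\<close>

lemma Q_measurable_real:
  fixes h :: "'a \<Rightarrow> real"
  assumes h: "continuous_on UNIV h" "\<And>x. \<bar>h x\<bar> \<le> B"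
  shows "(\<lambda>p. Q (fst p) h (snd p)) \<in> borel_measurable (nonneg_time \<Otimes>\<^sub>M borel)"
proof -
  note [measurable] = id_nonneg_time_borel
  let ?N = "nonneg_time \<Otimes>\<^sub>M (borel :: 'a measure)"
  let ?P = "\<lambda>h::'a \<Rightarrow> real. continuous_on UNIV h \<and> (\<exists>B. \<forall>x. \<bar>h x\<bar> \<le> B) \<and> (\<lambda>p. Q (fst p) h (snd p)) \<in> borel_measurable ?N"
  have sp: "0 \<le> fst p" if "p \<in> space ?N" for p
    using that by (auto simp: space_pair_measure)
  have "?P h"
  proof (rule bounded_continuous_induct[where P="?P"])
    fix \<xi> :: 'a and \<theta>
    have "(\<lambda>p. Re (iexp (\<xi> \<bullet> snd p + \<theta>) * (cf \<mu>X \<xi> / cf \<mu>X (exp (- fst p) *\<^sub>R \<xi>)))) \<in> borel_measurable ?N"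
      by measurable
    then have "(\<lambda>p. Q (fst p) (\<lambda>x. cos (\<xi> \<bullet> x + \<theta>)) (snd p)) \<in> borel_measurable ?N"
      by (rule measurable_cong[THEN iffD1, rotated]) (use sp in \<open>simp add: Q_cos cf_\<mu>\<close>)
    then show "?P (\<lambda>x. cos (\<xi> \<bullet> x + \<theta>))"
      by (auto intro!: continuous_intros exI[of _ 1])
  next
    fix f g a b assume f: "?P f" and g: "?P g"
    obtain F G where FG: "\<And>x. \<bar>f x\<bar> \<le> F" "\<And>x. \<bar>g x\<bar> \<le> G" using f g by blast
    then have bd: "\<bar>a * f x + b * g x\<bar> \<le> \<bar>a\<bar> * F + \<bar>b\<bar> * G" for x
      by (intro order_trans[OF abs_triangle_ineq] add_mono) (auto simp: abs_mult intro: mult_left_mono)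
    have "Q (fst p) (\<lambda>x. a * f x + b * g x) (snd p) = a * Q (fst p) f (snd p) + b * Q (fst p) g (snd p)"
      if "p \<in> space ?N" for p
      using integrable_\<mu>[OF sp[OF that], of f F] integrable_\<mu>[OF sp[OF that], of g G] f g FG
      by (simp add: Q_def)
    moreover have "(\<lambda>p. a * Q (fst p) f (snd p) + b * Q (fst p) g (snd p)) \<in> borel_measurable ?N"
      using f g by (intro borel_measurable_add borel_measurable_times) auto
    ultimately have "(\<lambda>p. Q (fst p) (\<lambda>x. a * f x + b * g x) (snd p)) \<in> borel_measurable ?N"
      by (subst measurable_cong) auto
    then show "?P (\<lambda>x. a * f x + b * g x)"
      using f g bd by (auto intro!: continuous_intros)
  next
    fix f :: "nat \<Rightarrow> 'a \<Rightarrow> real" and g C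
    assume f: "\<And>n. ?P (f n)" and C: "\<And>n x. \<bar>f n x\<bar> \<le> C"
      and l: "\<And>x. (\<lambda>n. f n x) \<longlonglongrightarrow> g x" and g: "continuous_on UNIV g"
    have "(\<lambda>p. Q (fst p) g (snd p)) \<in> borel_measurable ?N"
    proof (rule borel_measurable_LIMSEQ_metric)
      show "(\<lambda>p. Q (fst p) (f n) (snd p)) \<in> borel_measurable ?N" for n using f by blast
      show "(\<lambda>n. Q (fst p) (f n) (snd p)) \<longlonglongrightarrow> Q (fst p) g (snd p)" if "p \<in> space ?N" for p
        by (rule Q_tendsto[of _ f C]) (use sp[OF that] f C g l in auto)
    qed
    moreover have "\<bar>g x\<bar> \<le> C" for x
      by (rule LIMSEQ_le_const2[OF tendsto_rabs[OF l]]) (use C in auto)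
    ultimately show "?P g" using g by auto
  qed (use h in auto)
  then show ?thesis by simp
qed

lemma Q_inner:
  fixes h :: "'a \<Rightarrow> 'b::euclidean_space"
  assumes "0 \<le> t" "continuous_on UNIV h" "\<And>x. norm (h x) \<le> B"
  shows "Q t h z \<bullet> v = Q t (\<lambda>x. h x \<bullet> v) z"
  unfolding Q_def by (rule integral_inner_left[symmetric]) (use integrable_\<mu>[OF assms] in auto)

lemma Q_measurable:
  fixes h :: "'a \<Rightarrow> 'b::euclidean_space"
  assumes h: "continuous_on UNIV h" "\<And>x. norm (h x) \<le> B"
    and f: "f \<in> measurable M nonneg_time" and g: "g \<in> borel_measurable M"
  shows "(\<lambda>w. Q (f w) h (g w)) \<in> borel_measurable M"
proof -
  have "(\<lambda>p. Q (fst p) h (snd p)) \<in> borel_measurable (nonneg_time \<Otimes>\<^sub>M borel)"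
  proof (rule borel_measurable_euclidean_space[THEN iffD2], rule ballI)
    fix i :: 'b assume i: "i \<in> Basis"
    have "\<bar>h x \<bullet> i\<bar> \<le> B" for x
      using Basis_le_norm[OF i, of "h x"] h(2)[of x] by linarith
    then have "(\<lambda>p. Q (fst p) (\<lambda>x. h x \<bullet> i) (snd p)) \<in> borel_measurable (nonneg_time \<Otimes>\<^sub>M borel)"
      by (intro Q_measurable_real[of _ B] continuous_intros h)
    then show "(\<lambda>p. Q (fst p) h (snd p) \<bullet> i) \<in> borel_measurable (nonneg_time \<Otimes>\<^sub>M borel)"
      by (rule measurable_cong[THEN iffD1, rotated]) (auto simp: space_pair_measure Q_inner[OF _ h])
  qed
  from measurable_compose[OF measurable_Pair[OF f g] this] show ?thesis by simp
qed

lemma cf_X_nonzero: "cf \<mu>X \<xi> \<noteq> 0"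
  by (simp add: cf_X)

text \<open>The law of \<open>X\<close> is invariant: \<open>X\<close> and \<open>e\<^sup>-\<^sup>t X' + X\<^sub>t\<close> have the same characteristic function.\<close>

lemma invariant_law:
  fixes h :: "'a \<Rightarrow> real"
  assumes t: "0 \<le> t" and h: "continuous_on UNIV h" "\<And>x. \<bar>h x\<bar> \<le> B"
  shows "(\<integral>x. h x \<partial>\<mu>X) = (\<integral>x. Q t h (exp (- t) *\<^sub>R x) \<partial>\<mu>X)"
proof -
  interpret M: prob_space "\<mu> t" by (rule prob_\<mu>[OF t])
  interpret XM: pair_prob_space \<mu>X "\<mu> t" ..
  note [measurable_cong] = sets_\<mu>[OF t]
  have [measurable]: "h \<in> borel_measurable borel" by (rule borel_measurable_continuous_onI[OF h(1)])
  let ?f = "\<lambda>p. exp (- t) *\<^sub>R fst p + snd p"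
  let ?\<rho> = "distr (\<mu>X \<Otimes>\<^sub>M \<mu> t) borel ?f"
  have "prob_space ?\<rho>" by (rule XM.prob_space_distr) measurable
  moreover have "cf ?\<rho> \<xi> = cf \<mu>X \<xi>" for \<xi>
  proof -
    have int: "integrable (\<mu>X \<Otimes>\<^sub>M \<mu> t) (\<lambda>p. iexp (\<xi> \<bullet> (exp (- t) *\<^sub>R fst p + snd p)))"
      by (rule XM.P.integrable_const_bound[of _ 1]) auto
    have "cf ?\<rho> \<xi> = (\<integral>p. iexp (\<xi> \<bullet> (exp (- t) *\<^sub>R fst p + snd p)) \<partial>(\<mu>X \<Otimes>\<^sub>M \<mu> t))"
      unfolding cf_def by (subst integral_distr) auto
    also have "\<dots> = (\<integral>x. \<integral>y. iexp (\<xi> \<bullet> (exp (- t) *\<^sub>R x + y)) \<partial>\<mu> t \<partial>\<mu>X)"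
      using XM.integral_fst'[OF int] by simp
    also have "\<dots> = (\<integral>x. iexp ((exp (- t) *\<^sub>R \<xi>) \<bullet> x) * cf (\<mu> t) \<xi> \<partial>\<mu>X)"
      unfolding cf_def by (simp add: inner_add_right distrib_left exp_add)
    also have "\<dots> = cf \<mu>X (exp (- t) *\<^sub>R \<xi>) * cf (\<mu> t) \<xi>"
      unfolding cf_def by simp
    also have "\<dots> = cf \<mu>X \<xi>"
      using cf_X_nonzero by (simp add: cf_\<mu>[OF t])
    finally show ?thesis .
  qed
  ultimately have "(\<integral>x. h x \<partial>\<mu>X) = (\<integral>x. h x \<partial>?\<rho>)"
    by (intro cf_eq_imp_integral_eq[OF prob_X sets_X _ _ _ h]) auto
  also have "\<dots> = (\<integral>p. h (?f p) \<partial>(\<mu>X \<Otimes>\<^sub>M \<mu> t))"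
    by (subst integral_distr) auto
  also have "\<dots> = (\<integral>x. \<integral>y. h (exp (- t) *\<^sub>R x + y) \<partial>\<mu> t \<partial>\<mu>X)"
  proof -
    have "integrable (\<mu>X \<Otimes>\<^sub>M \<mu> t) (\<lambda>p. h (?f p))"
      by (rule XM.P.integrable_const_bound[of _ B]) (use h in auto)
    from XM.integral_fst'[OF this] show ?thesis by simp
  qed
  finally show ?thesis unfolding Q_def .
qed

section \<open>Exponential ergodicity\<close>

definition P :: "real \<Rightarrow> ('a \<Rightarrow> 'b::euclidean_space) \<Rightarrow> 'a \<Rightarrow> 'b" where
  "P t h x = Q t h (exp (- t) *\<^sub>R x)"

text \<open>The factor 4 is the 2 of \<open>P_contraction\<close> times the 2 of the quasi-triangle
  inequality \<open>norm_diff_powr_le\<close>.\<close>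

definition ergodic_const :: "'a \<Rightarrow> real" where
  "ergodic_const x = 4 * (norm x powr \<epsilon> + (\<integral>y. norm y powr \<epsilon> \<partial>\<mu>X))"

lemma min_le_powr: "0 \<le> a \<Longrightarrow> min 1 a \<le> a powr \<epsilon>"
proof (cases "a \<le> 1")
  case True
  assume "0 \<le> a"
  then show ?thesis
    using powr_mono'[of \<epsilon> 1 a] \<epsilon> True by simp
next
  case False
  then show ?thesis using ge_one_powr_ge_zero[of a \<epsilon>] \<epsilon> by simp
qed

lemma norm_diff_powr_le: "norm (x - y) powr \<epsilon> \<le> 2 * (norm x powr \<epsilon> + norm (y::'a) powr \<epsilon>)"
proof -
  have "norm (x - y) \<le> 2 * max (norm x) (norm y)"
    using norm_triangle_ineq4[of x y] by simp
  then have "norm (x - y) powr \<epsilon> \<le> (2 * max (norm x) (norm y)) powr \<epsilon>"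
    using \<epsilon> by (intro powr_mono2) auto
  also have "\<dots> = 2 powr \<epsilon> * max (norm x) (norm y) powr \<epsilon>"
    by (rule powr_mult)
  also have "\<dots> \<le> 2 * (norm x powr \<epsilon> + norm y powr \<epsilon>)"
  proof (rule mult_mono)
    show "2 powr \<epsilon> \<le> (2::real)"
      using powr_mono[of \<epsilon> 1 "2::real"] \<epsilon> by simp
    show "max (norm x) (norm y) powr \<epsilon> \<le> norm x powr \<epsilon> + norm y powr \<epsilon>"
      by (cases "norm x \<le> norm y") (auto simp: max_def)
  qed auto
  finally show ?thesis .
qed

text \<open>Both starting points are moved by the same noise, so their distance shrinks
  deterministically. Boundedness alone gives 2C and the Lipschitz bound gives C times the distance;
  the common factor 2C covers both.\<close>

lemma P_contraction:
  fixes h :: "'a \<Rightarrow> real"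
  assumes t: "0 \<le> t" and h: "continuous_on UNIV h" "\<And>x. \<bar>h x\<bar> \<le> C" "\<And>x y. \<bar>h x - h y\<bar> \<le> C * norm (x - y)"
  shows "\<bar>P t h x - P t h y\<bar> \<le> 2 * C * min 1 (exp (- t) * norm (x - y))"
proof -
  have C: "0 \<le> C" using h(2)[of 0] by linarith
  have i: "integrable (\<mu> t) (\<lambda>y. h (z + y))" for z
    by (rule integrable_\<mu>[OF t h(1)]) (use h(2) in auto)
  \<comment> \<open>With base point 0 and the translation put into the integrand, a pointwise bound
    passes to the integral by \<open>norm_Q_le\<close>.\<close>
  have "P t h x - P t h y = Q t (\<lambda>w. h (exp (- t) *\<^sub>R x + w) - h (exp (- t) *\<^sub>R y + w)) 0"
    unfolding P_def Q_def using i by simp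
  also have "\<bar>\<dots>\<bar> \<le> 2 * C * min 1 (exp (- t) * norm (x - y))"
    unfolding real_norm_def[symmetric]
  proof (rule norm_Q_le[OF t])
    fix w
    have 1: "\<bar>h (exp (- t) *\<^sub>R x + w) - h (exp (- t) *\<^sub>R y + w)\<bar> \<le> 2 * C"
      using h(2)[of "exp (- t) *\<^sub>R x + w"] h(2)[of "exp (- t) *\<^sub>R y + w"] by linarith
    have "\<bar>h (exp (- t) *\<^sub>R x + w) - h (exp (- t) *\<^sub>R y + w)\<bar> \<le> C * norm (exp (- t) *\<^sub>R (x - y))"
      using h(3)[of "exp (- t) *\<^sub>R x + w" "exp (- t) *\<^sub>R y + w"] by (simp add: scaleR_diff_right)
    then have 2: "\<bar>h (exp (- t) *\<^sub>R x + w) - h (exp (- t) *\<^sub>R y + w)\<bar> \<le> C * (exp (- t) * norm (x - y))"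
      by simp
    have "C * (exp (- t) * norm (x - y)) \<le> 2 * (C * (exp (- t) * norm (x - y)))"
      using C by simp
    then show "norm (h (exp (- t) *\<^sub>R x + w) - h (exp (- t) *\<^sub>R y + w)) \<le> 2 * C * min 1 (exp (- t) * norm (x - y))"
      using 1 2 by (auto simp: min_def)
  qed
  finally show ?thesis .
qed

lemma P_ergodic:
  fixes h :: "'a \<Rightarrow> real"
  assumes t: "0 \<le> t" and h: "continuous_on UNIV h" "\<And>x. \<bar>h x\<bar> \<le> C" "\<And>x y. \<bar>h x - h y\<bar> \<le> C * norm (x - y)"
  shows "\<bar>P t h x - (\<integral>y. h y \<partial>\<mu>X)\<bar> \<le> C * ergodic_const x * exp (- (\<epsilon> * t))"
proof -
  have C: "0 \<le> C" using h(2)[of 0] by linarith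
  have Pc: "continuous_on UNIV (P t h)"
    unfolding P_def by (rule continuous_on_compose2[OF continuous_Q[OF t h(1), of C]]) (use h in \<open>auto intro!: continuous_intros\<close>)
  have [measurable]: "P t h \<in> borel_measurable borel"
    by (rule borel_measurable_continuous_onI[OF Pc])
  have iP: "integrable \<mu>X (P t h)"
    by (rule X.integrable_bounded_continuous[of _ C]) (use norm_Q_le[OF t, of h C] h in \<open>auto simp: P_def\<close>)
  have bd: "\<bar>P t h x - P t h y\<bar> \<le> C * 4 * exp (- (\<epsilon> * t)) * (norm x powr \<epsilon> + norm y powr \<epsilon>)" for y
  proof -
    have "\<bar>P t h x - P t h y\<bar> \<le> 2 * C * min 1 (exp (- t) * norm (x - y))"
      by (rule P_contraction[OF t h])
    also have "\<dots> \<le> 2 * C * (exp (- t) * norm (x - y)) powr \<epsilon>"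
      using C by (intro mult_left_mono min_le_powr) auto
    also have "\<dots> = 2 * C * (exp (- (\<epsilon> * t)) * norm (x - y) powr \<epsilon>)"
      by (simp add: powr_mult exp_powr_real mult.commute)
    also have "\<dots> \<le> 2 * C * (exp (- (\<epsilon> * t)) * (2 * (norm x powr \<epsilon> + norm y powr \<epsilon>)))"
      using C by (intro mult_left_mono norm_diff_powr_le) auto
    finally show ?thesis by (simp add: algebra_simps)
  qed
  \<comment> \<open>By invariance the mean of \<open>h\<close> is also the mean of
    \<open>P t h\<close>, so only differences of \<open>P t h\<close> between two points
    remain.\<close>
  have "P t h x - (\<integral>y. h y \<partial>\<mu>X) = (\<integral>y. P t h x - P t h y \<partial>\<mu>X)"
    using iP invariant_law[OF t h(1,2)] by (simp add: P_def[symmetric] X.prob_space)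
  also have "norm \<dots> \<le> (\<integral>y. norm (P t h x - P t h y) \<partial>\<mu>X)"
    by (rule integral_norm_bound)
  also have "\<dots> \<le> (\<integral>y. C * 4 * exp (- (\<epsilon> * t)) * (norm x powr \<epsilon> + norm y powr \<epsilon>) \<partial>\<mu>X)"
    using iP moment bd by (intro integral_mono) auto
  also have "\<dots> = C * ergodic_const x * exp (- (\<epsilon> * t))"
    using moment by (simp add: ergodic_const_def X.prob_space algebra_simps)
  finally show ?thesis by simp
qed

end

subsection \<open>The Stein identity\<close>

context sd_semigroup
begin

section \<open>Regularity of time integrals of the semigroup\<close>

lemma P_measurable:
  fixes h :: "'a \<Rightarrow> 'b::euclidean_space"
  assumes h: "continuous_on UNIV h" "\<And>x. norm (h x) \<le> B"
  shows "(\<lambda>t. P t h x) \<in> borel_measurable nonneg_time"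
    and "(\<lambda>p. P (fst p) h (x + snd p)) \<in> borel_measurable (nonneg_time \<Otimes>\<^sub>M \<nu>')"
    and "(\<lambda>p. P (fst p) h x) \<in> borel_measurable (nonneg_time \<Otimes>\<^sub>M \<nu>')"
proof -
  note [measurable] = id_nonneg_time_borel
  show "(\<lambda>t. P t h x) \<in> borel_measurable nonneg_time"
    "(\<lambda>p. P (fst p) h (x + snd p)) \<in> borel_measurable (nonneg_time \<Otimes>\<^sub>M \<nu>')"
    "(\<lambda>p. P (fst p) h x) \<in> borel_measurable (nonneg_time \<Otimes>\<^sub>M \<nu>')"
    unfolding P_def by (rule Q_measurable[OF h]; measurable)+
qed

lemma norm_P_le:
  fixes h :: "'a \<Rightarrow> 'b::euclidean_space"
  shows "0 \<le> t \<Longrightarrow> (\<And>x. norm (h x) \<le> B) \<Longrightarrow> norm (P t h x) \<le> B"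
  unfolding P_def by (rule norm_Q_le)

lemma P_tendsto:
  fixes f :: "nat \<Rightarrow> 'a \<Rightarrow> 'b::euclidean_space"
  assumes "0 \<le> t" "\<And>n. continuous_on UNIV (f n)" "\<And>n x. norm (f n x) \<le> B"
    and "continuous_on UNIV g" and "\<And>y. (\<lambda>n. f n y) \<longlonglongrightarrow> g y"
  shows "(\<lambda>n. P t (f n) x) \<longlonglongrightarrow> P t g x"
  unfolding P_def by (rule Q_tendsto) (use assms in auto)

lemma continuous_P:
  fixes h :: "'a \<Rightarrow> 'b::euclidean_space"
  assumes "0 \<le> t" "continuous_on UNIV h" "\<And>x. norm (h x) \<le> B"
  shows "continuous_on UNIV (P t h)"
  unfolding P_def by (rule continuous_on_compose2[OF continuous_Q[OF assms]]) (auto intro!: continuous_intros)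

lemma P_has_gradient:
  fixes h :: "'a \<Rightarrow> real"
  assumes t: "0 \<le> t" and h: "\<And>x. (h has_derivative (\<lambda>v. D x \<bullet> v)) (at x)" "\<And>x. \<bar>h x\<bar> \<le> B"
    and D: "continuous_on UNIV D" "\<And>x. norm (D x) \<le> C"
  shows "(P t h has_derivative (\<lambda>v. (exp (- t) *\<^sub>R P t D x) \<bullet> v)) (at x)"
proof -
  interpret prob_space "\<mu> t" by (rule prob_\<mu>[OF t])
  note [measurable_cong] = sets_\<mu>[OF t]
  have hc: "continuous_on UNIV h"
    by (rule has_derivative_continuous_on[of _ _ "\<lambda>y v. D y \<bullet> v"]) (use h in auto)
  have [measurable]: "D \<in> borel_measurable borel" by (rule borel_measurable_continuous_onI[OF D(1)])
  have C: "0 \<le> C" using D(2)[of 0] norm_ge_zero by (rule order_trans[rotated])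
  have "((\<lambda>x. \<integral>y. h (exp (- t) *\<^sub>R x + y) \<partial>\<mu> t) has_derivative
      (\<lambda>v. (\<integral>y. exp (- t) *\<^sub>R D (exp (- t) *\<^sub>R x + y) \<partial>\<mu> t) \<bullet> v)) (at x)"
  proof (rule integral_has_gradient[where S=UNIV and g="\<lambda>_. C"])
    show "((\<lambda>x. h (exp (- t) *\<^sub>R x + w)) has_derivative (\<lambda>v. (exp (- t) *\<^sub>R D (exp (- t) *\<^sub>R y + w)) \<bullet> v)) (at y)" for y w
    proof -
      have "((\<lambda>x. exp (- t) *\<^sub>R x + w) has_derivative (\<lambda>v. exp (- t) *\<^sub>R v)) (at y)"
        by (auto intro!: derivative_eq_intros)
      from has_derivative_compose[OF this h(1)] show ?thesis by simp
    qed
    show "integrable (\<mu> t) (\<lambda>y. h (exp (- t) *\<^sub>R x + y))" for x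
      by (rule integrable_\<mu>[OF t hc]) (use h(2) in auto)
    show "norm (exp (- t) *\<^sub>R D (exp (- t) *\<^sub>R y + w)) \<le> C" for y w
      using mult_mono[of "exp (- t)" 1 "norm (D (exp (- t) *\<^sub>R y + w))" C] D(2) t C by simp
  qed auto
  then show ?thesis
    by (simp add: P_def[abs_def] Q_def)
qed

text \<open>Stated so as to serve twice: \<open>c = 0\<close> with \<open>m\<close> the mean of
  \<open>h\<close> yields the gradient of the solution, \<open>c = 1\<close> with \<open>m\<close>
  zero yields its second derivative. The factor \<open>exp (- t)\<close> gained by differentiation
  makes the domination integrable even for \<open>c = 0\<close>.\<close>

lemma integral_P_has_gradient:
  fixes h :: "'a \<Rightarrow> real"
  assumes c: "0 \<le> c" and h: "\<And>x. (h has_derivative (\<lambda>v. D x \<bullet> v)) (at x)" "\<And>x. \<bar>h x\<bar> \<le> B"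
    and D: "continuous_on UNIV D" "\<And>x. norm (D x) \<le> C"
    and int: "\<And>x. integrable nonneg_time (\<lambda>t. exp (- (c * t)) * P t h x - m t)"
  shows "((\<lambda>x. \<integral>t. exp (- (c * t)) * P t h x - m t \<partial>nonneg_time) has_derivative
    (\<lambda>v. (\<integral>t. exp (- ((c + 1) * t)) *\<^sub>R P t D x \<partial>nonneg_time) \<bullet> v)) (at x)"
proof (rule integral_has_gradient[where S=UNIV and g="\<lambda>t. C * exp (- ((c + 1) * t))"])
  note [measurable] = id_nonneg_time_borel P_measurable(1)[OF D]
  have e: "exp (- (c * t)) * exp (- t) = exp (- ((c + 1) * t))" for t :: real
    by (simp add: exp_add[symmetric] algebra_simps)
  show "((\<lambda>y. exp (- (c * t)) * P t h y - m t) has_derivative (\<lambda>v. (exp (- ((c + 1) * t)) *\<^sub>R P t D y) \<bullet> v)) (at y)"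
    if "t \<in> space nonneg_time" for y t
  proof -
    have t: "0 \<le> t" using that by simp
    from has_derivative_diff[OF has_derivative_mult_right[OF P_has_gradient[OF t h D]] has_derivative_const]
    show ?thesis by (simp add: e[symmetric] mult.assoc)
  qed
  show "(\<lambda>t. exp (- ((c + 1) * t)) *\<^sub>R P t D x) \<in> borel_measurable nonneg_time" by measurable
  show "norm (exp (- ((c + 1) * t)) *\<^sub>R P t D y) \<le> C * exp (- ((c + 1) * t))" if "t \<in> space nonneg_time" for y t
    using norm_P_le[of t D C y] D(2) that by simp
  show "integrable nonneg_time (\<lambda>t. C * exp (- ((c + 1) * t)))"
    using c by (intro integrable_mult_right integrable_exp_nonneg_time) simp
qed (use int in auto)

lemma integrable_exp_P:
  fixes h :: "'a \<Rightarrow> 'b::euclidean_space"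
  assumes c: "0 < c" and h: "continuous_on UNIV h" "\<And>x. norm (h x) \<le> B"
  shows "integrable nonneg_time (\<lambda>t. exp (- (c * t)) *\<^sub>R P t h x)"
proof (rule Bochner_Integration.integrable_bound)
  note [measurable] = id_nonneg_time_borel P_measurable(1)[OF h]
  show "(\<lambda>t. exp (- (c * t)) *\<^sub>R P t h x) \<in> borel_measurable nonneg_time" by measurable
  show "integrable nonneg_time (\<lambda>t. B * exp (- (c * t)))"
    using c by (intro integrable_mult_right integrable_exp_nonneg_time)
  show "AE t in nonneg_time. norm (exp (- (c * t)) *\<^sub>R P t h x) \<le> norm (B * exp (- (c * t)))"
    using norm_P_le[of _ h B x] h(2) by (intro AE_I2) (auto simp: abs_mult intro: order_trans[OF _ abs_ge_self])
qed

text \<open>Source of the constants in the result: \<open>c = 1\<close> bounds the gradient of the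
  solution by 1, \<open>c = 2\<close> its second derivative by 1/2.\<close>

lemma norm_integral_exp_P_le:
  fixes h :: "'a \<Rightarrow> 'b::euclidean_space"
  assumes c: "0 < c" and h: "continuous_on UNIV h" "\<And>x. norm (h x) \<le> B"
  shows "norm (\<integral>t. exp (- (c * t)) *\<^sub>R P t h x \<partial>nonneg_time) \<le> B / c"
proof -
  have "norm (\<integral>t. exp (- (c * t)) *\<^sub>R P t h x \<partial>nonneg_time) \<le> (\<integral>t. norm (exp (- (c * t)) *\<^sub>R P t h x) \<partial>nonneg_time)"
    by (rule integral_norm_bound)
  also have "\<dots> \<le> (\<integral>t. B * exp (- (c * t)) \<partial>nonneg_time)"
  proof (rule integral_mono)
    show "norm (exp (- (c * t)) *\<^sub>R P t h x) \<le> B * exp (- (c * t))" if "t \<in> space nonneg_time" for t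
      using norm_P_le[of t h B x] h(2) that by simp
    show "integrable nonneg_time (\<lambda>t. B * exp (- (c * t)))"
      using c by (intro integrable_mult_right integrable_exp_nonneg_time)
  qed (rule integrable_norm[OF integrable_exp_P[OF c h]])
  also have "\<dots> = B * (1 / c)"
    by (rule has_bochner_integral_integral_eq, intro has_bochner_integral_mult_right has_bochner_integral_exp c)
  finally show ?thesis by simp
qed

lemma continuous_integral_exp_P:
  fixes h :: "'a \<Rightarrow> 'b::euclidean_space"
  assumes c: "0 < c" and h: "continuous_on UNIV h" "\<And>x. norm (h x) \<le> B"
  shows "continuous_on UNIV (\<lambda>x. \<integral>t. exp (- (c * t)) *\<^sub>R P t h x \<partial>nonneg_time)"
proof -
  note [measurable] = id_nonneg_time_borel P_measurable(1)[OF h]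
  have "(\<lambda>n. \<integral>t. exp (- (c * t)) *\<^sub>R P t h (X n) \<partial>nonneg_time) \<longlonglongrightarrow> (\<integral>t. exp (- (c * t)) *\<^sub>R P t h x \<partial>nonneg_time)"
    if X: "X \<longlonglongrightarrow> x" for X x
  proof (rule integral_dominated_convergence)
    show "integrable nonneg_time (\<lambda>t. B * exp (- (c * t)))"
      using c by (intro integrable_mult_right integrable_exp_nonneg_time)
    show "AE t in nonneg_time. norm (exp (- (c * t)) *\<^sub>R P t h (X n)) \<le> B * exp (- (c * t))" for n
      using norm_P_le[of _ h B "X n"] h(2) by (intro AE_I2) auto
    show "AE t in nonneg_time. (\<lambda>n. exp (- (c * t)) *\<^sub>R P t h (X n)) \<longlonglongrightarrow> exp (- (c * t)) *\<^sub>R P t h x"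
    proof (rule AE_I2)
      fix t assume "t \<in> space nonneg_time"
      then have "continuous_on UNIV (P t h)" by (intro continuous_P[OF _ h]) auto
      then show "(\<lambda>n. exp (- (c * t)) *\<^sub>R P t h (X n)) \<longlonglongrightarrow> exp (- (c * t)) *\<^sub>R P t h x"
        using X by (intro tendsto_intros continuous_on_tendsto_compose[of UNIV "P t h"]) auto
    qed
  qed measurable
  then show ?thesis
    by (auto simp: continuous_on_sequentially comp_def)
qed

text \<open>Compensated increment of \<open>P t h\<close>, whose gradient at \<open>x\<close> is
  \<open>exp (- t) *\<^sub>R P t D x\<close>.\<close>

definition jump :: "('a \<Rightarrow> real) \<Rightarrow> ('a \<Rightarrow> 'a) \<Rightarrow> 'a \<Rightarrow> real \<Rightarrow> 'a \<Rightarrow> real" where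
  "jump h D x t u = P t h (x + u) - P t h x - ((exp (- t) *\<^sub>R P t D x) \<bullet> u) * indicator (cball 0 1) u"

text \<open>Free of \<open>x\<close>, and dependent on the test function only through
  \<open>C\<close>; it can therefore dominate a whole approximating sequence.\<close>

definition jump_bound :: "real \<Rightarrow> real \<times> 'a \<Rightarrow> real" where
  "jump_bound C p = 2 * C * (min 1 ((exp (- fst p) * norm (snd p))\<^sup>2) +
    indicator {1<..} (norm (snd p)) * min 1 (exp (- fst p) * norm (snd p)))"

lemma integrable_jump_bound: "integrable (nonneg_time \<Otimes>\<^sub>M \<nu>') (jump_bound C)"
  unfolding jump_bound_def
  by (intro integrable_mult_right Bochner_Integration.integrable_add integrable_flow_min integrable_flow_large)

lemma smooth_data_lipschitz: "smooth_data C h D \<Longrightarrow> \<bar>h x - h y\<bar> \<le> C * norm (x - y)"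
  by (rule lipschitz_of_gradient[of h D UNIV]) (auto dest: smooth_dataD)

text \<open>The truncation looks at \<open>u\<close>, not at the contracted jump. For
  \<open>norm u > 1\<close> no linear term is subtracted and the contraction estimate is used;
  otherwise the second-order Taylor bound applies, and the contracted jump has norm at most
  1.\<close>

lemma jump_le:
  assumes h: "smooth_data C h D" and t: "0 \<le> t"
  shows "\<bar>jump h D x t u\<bar> \<le> jump_bound C (t, u)"
proof (cases "norm u \<le> 1")
  case False
  have "\<bar>P t h (x + u) - P t h x\<bar> \<le> 2 * C * min 1 (exp (- t) * norm u)"
    using P_contraction[OF t smooth_data_continuous(1)[OF h] smooth_dataD(2)[OF h] smooth_data_lipschitz[OF h], of "x + u" x] by simp
  also have "\<dots> \<le> jump_bound C (t, u)"
    using False smooth_dataD(5)[OF h] by (auto simp: jump_bound_def intro!: mult_left_mono)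
  finally show ?thesis
    using False by (simp add: jump_def)
next
  case True
  let ?z = "exp (- t) *\<^sub>R x" and ?w = "exp (- t) *\<^sub>R u"
  note c = smooth_data_continuous[OF h] and d = smooth_dataD[OF h]
  have ih: "integrable (\<mu> t) (\<lambda>y. h (z + y))" for z
    by (rule integrable_\<mu>[OF t c(1), of C]) (use d(2) in simp)
  have iD: "integrable (\<mu> t) (\<lambda>y. D (z + y))" for z
    by (rule integrable_\<mu>[OF t c(2) d(3)])
  have "jump h D x t u = Q t (\<lambda>y. h (?z + y + ?w) - h (?z + y) - D (?z + y) \<bullet> ?w) 0"
    using True ih[of ?z] ih[of "?z + ?w"] iD[of ?z]
    by (simp add: jump_def P_def Q_def scaleR_add_right ac_simps)
  also have "\<bar>\<dots>\<bar> \<le> C * (norm ?w)\<^sup>2"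
    unfolding real_norm_def[symmetric]
    by (rule norm_Q_le[OF t], unfold real_norm_def, rule smooth_data_taylor[OF h])
  also have "\<dots> \<le> jump_bound C (t, u)"
  proof -
    have "exp (- t) * norm u \<le> 1 * 1" using True t by (intro mult_mono) auto
    then have "(exp (- t) * norm u)\<^sup>2 \<le> 1" by (intro power_le_one) auto
    then show ?thesis using True d(5) by (simp add: jump_bound_def)
  qed
  finally show ?thesis .
qed

lemma jump_measurable:
  assumes h: "smooth_data C h D"
  shows "(\<lambda>p. jump h D x (fst p) (snd p)) \<in> borel_measurable (nonneg_time \<Otimes>\<^sub>M \<nu>')"
proof -
  note [measurable] = P_measurable[OF smooth_data_continuous(2)[OF h] smooth_dataD(3)[OF h]]
  have [measurable]: "(\<lambda>p. P (fst p) h (x + snd p)) \<in> borel_measurable (nonneg_time \<Otimes>\<^sub>M \<nu>')"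
    "(\<lambda>p. P (fst p) h x) \<in> borel_measurable (nonneg_time \<Otimes>\<^sub>M \<nu>')" for x
    by (rule P_measurable[OF smooth_data_continuous(1)[OF h], of C]; use smooth_dataD(2)[OF h] in simp)+
  have [measurable]: "(\<lambda>p. fst p) \<in> borel_measurable (nonneg_time \<Otimes>\<^sub>M \<nu>')"
    by (rule measurable_compose[OF measurable_fst id_nonneg_time_borel])
  have [measurable]: "cball 0 1 \<in> sets (borel :: 'a measure)" by simp
  show ?thesis unfolding jump_def by measurable
qed

lemma integrable_jump:
  assumes h: "smooth_data C h D"
  shows "integrable (nonneg_time \<Otimes>\<^sub>M \<nu>') (\<lambda>p. jump h D x (fst p) (snd p))"
proof (rule Bochner_Integration.integrable_bound[OF integrable_jump_bound[of C] jump_measurable[OF h]])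
  show "AE p in nonneg_time \<Otimes>\<^sub>M \<nu>'. norm (jump h D x (fst p) (snd p)) \<le> norm (jump_bound C p)"
  proof (rule AE_I2)
    fix p :: "real \<times> 'a" assume "p \<in> space (nonneg_time \<Otimes>\<^sub>M \<nu>')"
    then have "0 \<le> fst p" by (auto simp: space_pair_measure)
    from jump_le[OF h this, of x "snd p"] show "norm (jump h D x (fst p) (snd p)) \<le> norm (jump_bound C p)"
      by simp
  qed
qed

text \<open>The Stein equation before the order of time and jumps is chosen. The sign is opposite to
  that of the final equation, because the solution is minus a time integral.\<close>

definition stein_identity :: "('a \<Rightarrow> real) \<Rightarrow> ('a \<Rightarrow> 'a) \<Rightarrow> 'a \<Rightarrow> bool" where
  "stein_identity h D x \<longleftrightarrow>
    (\<integral>t. exp (- t) *\<^sub>R P t D x \<partial>nonneg_time) \<bullet> (b_tilde b \<sigma> k - x) +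
    (\<integral>p. jump h D x (fst p) (snd p) \<partial>(nonneg_time \<Otimes>\<^sub>M \<nu>')) = (\<integral>y. h y \<partial>\<mu>X) - h x"

lemma P_lincomb:
  fixes f g :: "'a \<Rightarrow> 'b::euclidean_space"
  assumes "0 \<le> t" "continuous_on UNIV f" "\<And>x. norm (f x) \<le> B" "continuous_on UNIV g" "\<And>x. norm (g x) \<le> C"
  shows "P t (\<lambda>x. a *\<^sub>R f x + c *\<^sub>R g x) x = a *\<^sub>R P t f x + c *\<^sub>R P t g x"
  using integrable_\<mu>[OF assms(1-3)] integrable_\<mu>[OF assms(1,4,5)] by (simp add: P_def Q_def)

lemma integrable_X:
  fixes h :: "'a \<Rightarrow> real"
  assumes "continuous_on UNIV h" "\<And>x. \<bar>h x\<bar> \<le> B"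
  shows "integrable \<mu>X h"
proof -
  have [measurable]: "h \<in> borel_measurable borel" by (rule borel_measurable_continuous_onI) fact
  show ?thesis by (rule X.integrable_bounded_continuous[of _ B]) (use assms in auto)
qed

lemma smooth_data_lincomb:
  assumes f: "smooth_data C f D" and g: "smooth_data C' g E"
  shows "smooth_data (\<bar>a\<bar> * C + \<bar>c\<bar> * C') (\<lambda>x. a * f x + c * g x) (\<lambda>x. a *\<^sub>R D x + c *\<^sub>R E x)"
  unfolding smooth_data_def
proof (intro conjI allI)
  note df = smooth_dataD[OF f] and dg = smooth_dataD[OF g]
  fix x y
  show "((\<lambda>x. a * f x + c * g x) has_derivative (\<lambda>v. (a *\<^sub>R D x + c *\<^sub>R E x) \<bullet> v)) (at x)"
    unfolding inner_add_left inner_scaleR_left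
    by (intro has_derivative_add has_derivative_mult_right df(1) dg(1))
  show "\<bar>a * f x + c * g x\<bar> \<le> \<bar>a\<bar> * C + \<bar>c\<bar> * C'"
    using df(2) dg(2) by (intro order_trans[OF abs_triangle_ineq] add_mono) (auto simp: abs_mult intro: mult_left_mono)
  show "norm (a *\<^sub>R D x + c *\<^sub>R E x) \<le> \<bar>a\<bar> * C + \<bar>c\<bar> * C'"
    using df(3) dg(3) by (intro order_trans[OF norm_triangle_ineq] add_mono) (auto intro: mult_left_mono)
  have "a *\<^sub>R D x + c *\<^sub>R E x - (a *\<^sub>R D y + c *\<^sub>R E y) = a *\<^sub>R (D x - D y) + c *\<^sub>R (E x - E y)"
    by (simp add: algebra_simps)
  also have "norm \<dots> \<le> \<bar>a\<bar> * (C * norm (x - y)) + \<bar>c\<bar> * (C' * norm (x - y))"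
    using df(4) dg(4) by (intro order_trans[OF norm_triangle_ineq] add_mono) (auto intro: mult_left_mono)
  finally show "norm (a *\<^sub>R D x + c *\<^sub>R E x - (a *\<^sub>R D y + c *\<^sub>R E y)) \<le> (\<bar>a\<bar> * C + \<bar>c\<bar> * C') * norm (x - y)"
    by (simp add: algebra_simps)
qed

lemma integrable_drift:
  assumes h: "smooth_data C h D"
  shows "integrable nonneg_time (\<lambda>t. exp (- t) *\<^sub>R P t D x)"
  using integrable_exp_P[of 1 D C x] smooth_data_continuous[OF h] smooth_dataD[OF h] by simp

lemma stein_identity_lincomb:
  assumes f: "smooth_data C f D" "stein_identity f D x" and g: "smooth_data C' g E" "stein_identity g E x"
  shows "stein_identity (\<lambda>x. a * f x + c * g x) (\<lambda>x. a *\<^sub>R D x + c *\<^sub>R E x) x"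
proof -
  note df = smooth_dataD[OF f(1)] smooth_data_continuous[OF f(1)] and dg = smooth_dataD[OF g(1)] smooth_data_continuous[OF g(1)]
  have PD: "P t (\<lambda>x. a *\<^sub>R D x + c *\<^sub>R E x) x = a *\<^sub>R P t D x + c *\<^sub>R P t E x" if "0 \<le> t" for t x
    by (rule P_lincomb[OF that df(7,3) dg(7,3)])
  have Ph: "P t (\<lambda>x. a * f x + c * g x) x = a * P t f x + c * P t g x" if "0 \<le> t" for t x
    using P_lincomb[OF that df(6) _ dg(6), of C C' a c x] df(2) dg(2) by simp
  have 1: "(\<integral>t. exp (- t) *\<^sub>R P t (\<lambda>x. a *\<^sub>R D x + c *\<^sub>R E x) x \<partial>nonneg_time) =
      a *\<^sub>R (\<integral>t. exp (- t) *\<^sub>R P t D x \<partial>nonneg_time) + c *\<^sub>R (\<integral>t. exp (- t) *\<^sub>R P t E x \<partial>nonneg_time)"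
  proof -
    have "(\<integral>t. exp (- t) *\<^sub>R P t (\<lambda>x. a *\<^sub>R D x + c *\<^sub>R E x) x \<partial>nonneg_time) =
        (\<integral>t. a *\<^sub>R (exp (- t) *\<^sub>R P t D x) + c *\<^sub>R (exp (- t) *\<^sub>R P t E x) \<partial>nonneg_time)"
      by (rule Bochner_Integration.integral_cong) (auto simp: PD scaleR_add_right mult.commute)
    then show ?thesis
      using integrable_drift[OF f(1), of x] integrable_drift[OF g(1), of x] by (simp del: scaleR_scaleR)
  qed
  have 2: "(\<integral>p. jump (\<lambda>x. a * f x + c * g x) (\<lambda>x. a *\<^sub>R D x + c *\<^sub>R E x) x (fst p) (snd p) \<partial>(nonneg_time \<Otimes>\<^sub>M \<nu>')) =
      a * (\<integral>p. jump f D x (fst p) (snd p) \<partial>(nonneg_time \<Otimes>\<^sub>M \<nu>')) + c * (\<integral>p. jump g E x (fst p) (snd p) \<partial>(nonneg_time \<Otimes>\<^sub>M \<nu>'))"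
  proof -
    have "(\<integral>p. jump (\<lambda>x. a * f x + c * g x) (\<lambda>x. a *\<^sub>R D x + c *\<^sub>R E x) x (fst p) (snd p) \<partial>(nonneg_time \<Otimes>\<^sub>M \<nu>')) =
        (\<integral>p. a * jump f D x (fst p) (snd p) + c * jump g E x (fst p) (snd p) \<partial>(nonneg_time \<Otimes>\<^sub>M \<nu>'))"
      by (rule Bochner_Integration.integral_cong)
        (auto simp: space_pair_measure jump_def PD Ph inner_add_left algebra_simps)
    then show ?thesis
      using integrable_jump[OF f(1), of x] integrable_jump[OF g(1), of x] by simp
  qed
  have 3: "(\<integral>y. a * f y + c * g y \<partial>\<mu>X) = a * (\<integral>y. f y \<partial>\<mu>X) + c * (\<integral>y. g y \<partial>\<mu>X)"
    using integrable_X[OF df(6,2)] integrable_X[OF dg(6,2)] by simp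
  show ?thesis
    using arg_cong[OF f(2)[unfolded stein_identity_def], of "\<lambda>r. a * r"] arg_cong[OF g(2)[unfolded stein_identity_def], of "\<lambda>r. c * r"]
    unfolding stein_identity_def 1 2 3 inner_add_left inner_scaleR_left by (simp add: algebra_simps)
qed

text \<open>Dominated convergence in each of the three integrals, with the dominating functions
  \<open>C * exp (- t)\<close>, \<open>jump_bound C\<close> and the constant \<open>C\<close>; this
  is where the common constant pays off.\<close>

lemma stein_identity_limit:
  assumes f: "\<And>n. smooth_data C (f n) (D n)" "\<And>n. stein_identity (f n) (D n) x"
    and h: "smooth_data C h E" and l: "\<And>y. (\<lambda>n. f n y) \<longlonglongrightarrow> h y" "\<And>y. (\<lambda>n. D n y) \<longlonglongrightarrow> E y"
  shows "stein_identity h E x"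
proof -
  note df = smooth_dataD[OF f(1)] smooth_data_continuous[OF f(1)] and dh = smooth_dataD[OF h] smooth_data_continuous[OF h]
  note [measurable] = id_nonneg_time_borel
  have Pf: "(\<lambda>n. P t (f n) z) \<longlonglongrightarrow> P t h z" if "0 \<le> t" for t z
    by (rule P_tendsto[OF that df(6) _ dh(6) l(1), of C]) (use df(2) in simp)
  have PD: "(\<lambda>n. P t (D n) z) \<longlonglongrightarrow> P t E z" if "0 \<le> t" for t z
    by (rule P_tendsto[OF that df(7) df(3) dh(7) l(2)])
  have 1: "(\<lambda>n. \<integral>t. exp (- t) *\<^sub>R P t (D n) x \<partial>nonneg_time) \<longlonglongrightarrow> (\<integral>t. exp (- t) *\<^sub>R P t E x \<partial>nonneg_time)"
  proof (rule integral_dominated_convergence)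
    show "integrable nonneg_time (\<lambda>t. C * exp (- (1 * t)))"
      by (intro integrable_mult_right integrable_exp_nonneg_time) simp
    show "AE t in nonneg_time. norm (exp (- t) *\<^sub>R P t (D n) x) \<le> C * exp (- (1 * t))" for n
      using norm_P_le[where h="D n" and B=C and x=x, OF _ df(3)] by (intro AE_I2) auto
    show "AE t in nonneg_time. (\<lambda>n. exp (- t) *\<^sub>R P t (D n) x) \<longlonglongrightarrow> exp (- t) *\<^sub>R P t E x"
      by (intro AE_I2 tendsto_intros PD) auto
  qed (rule borel_measurable_integrable, rule integrable_drift[OF h] integrable_drift[OF f(1)])+
  have 2: "(\<lambda>n. \<integral>p. jump (f n) (D n) x (fst p) (snd p) \<partial>(nonneg_time \<Otimes>\<^sub>M \<nu>')) \<longlonglongrightarrow>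
      (\<integral>p. jump h E x (fst p) (snd p) \<partial>(nonneg_time \<Otimes>\<^sub>M \<nu>'))"
  proof (rule integral_dominated_convergence[where w="jump_bound C"])
    show "AE p in nonneg_time \<Otimes>\<^sub>M \<nu>'. norm (jump (f n) (D n) x (fst p) (snd p)) \<le> jump_bound C p" for n
      using jump_le[OF f(1)] by (intro AE_I2) (auto simp: space_pair_measure)
    show "AE p in nonneg_time \<Otimes>\<^sub>M \<nu>'. (\<lambda>n. jump (f n) (D n) x (fst p) (snd p)) \<longlonglongrightarrow> jump h E x (fst p) (snd p)"
      unfolding jump_def by (intro AE_I2 tendsto_intros PD Pf) (auto simp: space_pair_measure)
  qed (rule jump_measurable[OF h] jump_measurable[OF f(1)] integrable_jump_bound)+
  have 3: "(\<lambda>n. \<integral>y. f n y \<partial>\<mu>X) \<longlonglongrightarrow> (\<integral>y. h y \<partial>\<mu>X)"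
  proof (rule integral_dominated_convergence[where w="\<lambda>_. C"])
    show "h \<in> borel_measurable \<mu>X" "f n \<in> borel_measurable \<mu>X" for n
      using borel_measurable_integrable[OF integrable_X[OF dh(6,2)]] borel_measurable_integrable[OF integrable_X[OF df(6,2)]] by auto
  qed (use df(2) l(1) in auto)
  have "(\<lambda>n. (\<integral>t. exp (- t) *\<^sub>R P t (D n) x \<partial>nonneg_time) \<bullet> (b_tilde b \<sigma> k - x) +
      (\<integral>p. jump (f n) (D n) x (fst p) (snd p) \<partial>(nonneg_time \<Otimes>\<^sub>M \<nu>'))) \<longlonglongrightarrow>
      (\<integral>t. exp (- t) *\<^sub>R P t E x \<partial>nonneg_time) \<bullet> (b_tilde b \<sigma> k - x) +
      (\<integral>p. jump h E x (fst p) (snd p) \<partial>(nonneg_time \<Otimes>\<^sub>M \<nu>'))"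
    by (intro tendsto_intros 1 2)
  moreover have "(\<lambda>n. (\<integral>y. f n y \<partial>\<mu>X) - f n x) \<longlonglongrightarrow> (\<integral>y. h y \<partial>\<mu>X) - h x"
    by (intro tendsto_intros 3 l)
  ultimately show ?thesis
    using f(2) unfolding stein_identity_def by (simp add: LIMSEQ_unique)
qed

text \<open>The derivative is written as a cosine with shifted phase, so that \<open>Q_cos\<close>
  evaluates the semigroup on the gradient as well.\<close>

lemma has_derivative_cos_inner:
  "((\<lambda>x. cos (\<xi> \<bullet> x + \<theta>)) has_derivative (\<lambda>v. (cos (\<xi> \<bullet> x + (\<theta> + pi / 2)) *\<^sub>R \<xi>) \<bullet> v)) (at (x::'a))"
proof -
  have "cos (\<xi> \<bullet> x + (\<theta> + pi / 2)) = - sin (\<xi> \<bullet> x + \<theta>)"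
    by (simp add: add.assoc[symmetric] cos_add)
  then show ?thesis
    by (auto intro!: derivative_eq_intros)
qed

lemma smooth_data_cos:
  "smooth_data (1 + norm \<xi> + (norm \<xi>)\<^sup>2) (\<lambda>x. cos (\<xi> \<bullet> x + \<theta>)) (\<lambda>x::'a. cos (\<xi> \<bullet> x + (\<theta> + pi / 2)) *\<^sub>R \<xi>)"
  unfolding smooth_data_def
proof (intro conjI allI has_derivative_cos_inner)
  fix x y :: 'a
  have sq: "0 \<le> (norm \<xi>)\<^sup>2" by simp
  show "\<bar>cos (\<xi> \<bullet> x + \<theta>)\<bar> \<le> 1 + norm \<xi> + (norm \<xi>)\<^sup>2"
    using abs_cos_le_one[of "\<xi> \<bullet> x + \<theta>"] sq norm_ge_zero[of \<xi>] by linarith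
  have le: "norm (cos (\<xi> \<bullet> z + \<phi>) *\<^sub>R \<xi>) \<le> norm \<xi>" for z and \<phi>
    by (auto intro!: mult_left_le_one_le)
  then show "norm (cos (\<xi> \<bullet> x + (\<theta> + pi / 2)) *\<^sub>R \<xi>) \<le> 1 + norm \<xi> + (norm \<xi>)\<^sup>2"
    using sq by (smt (verit))
  have "\<bar>cos (\<xi> \<bullet> x + (\<theta> + pi / 2)) - cos (\<xi> \<bullet> y + (\<theta> + pi / 2))\<bar> \<le> norm \<xi> * norm (x - y)"
    by (rule lipschitz_of_gradient[of "\<lambda>x. cos (\<xi> \<bullet> x + (\<theta> + pi / 2))", OF has_derivative_cos_inner, of UNIV]) (use le in auto)
  then have "norm ((cos (\<xi> \<bullet> x + (\<theta> + pi / 2)) - cos (\<xi> \<bullet> y + (\<theta> + pi / 2))) *\<^sub>R \<xi>) \<le> norm \<xi> * norm (x - y) * norm \<xi>"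
    by (simp add: mult_right_mono)
  also have "\<dots> \<le> (1 + norm \<xi> + (norm \<xi>)\<^sup>2) * norm (x - y)"
    by (simp add: algebra_simps power2_eq_square)
  finally show "norm (cos (\<xi> \<bullet> x + (\<theta> + pi / 2)) *\<^sub>R \<xi> - cos (\<xi> \<bullet> y + (\<theta> + pi / 2)) *\<^sub>R \<xi>) \<le> (1 + norm \<xi> + (norm \<xi>)\<^sup>2) * norm (x - y)"
    by (simp add: scaleR_diff_left)
qed

end

lemma gradient_unique:
  assumes "(f has_derivative (\<lambda>v. D \<bullet> v)) (at x)" "(f has_derivative (\<lambda>v. E \<bullet> v)) (at (x::'b::euclidean_space))"
  shows "D = E"
proof -
  have "(\<lambda>v. D \<bullet> v) = (\<lambda>v. E \<bullet> v)"
    using has_derivative_unique[OF assms] .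
  then have "D \<bullet> v = E \<bullet> v" for v by (rule fun_cong)
  then show ?thesis by (metis inner_commute vector_eq_ldot)
qed

context sd_semigroup
begin

text \<open>For a cosine the semigroup is the real part of an explicit exponential
  \<open>Z t\<close>, and drift plus jumps at time \<open>t\<close> is the real part of its time
  derivative. Integrating over time leaves the limit at infinity minus the value at 0.\<close>

lemma stein_identity_cos:
  "stein_identity (\<lambda>x. cos (\<xi> \<bullet> x + \<theta>)) (\<lambda>x. cos (\<xi> \<bullet> x + (\<theta> + pi / 2)) *\<^sub>R \<xi>) x"
proof -
  let ?h = "\<lambda>x. cos (\<xi> \<bullet> x + \<theta>)" and ?D = "\<lambda>x. cos (\<xi> \<bullet> x + (\<theta> + pi / 2)) *\<^sub>R \<xi>"
  let ?b = "b_tilde b \<sigma> k"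
  note sm = smooth_data_cos[of \<xi> \<theta>]
  \<comment> \<open>The difference of exponents is a logarithm of the characteristic function of
    \<open>\<mu> t\<close>, given by the Levy-Khintchine form, so no branch has to be
    chosen.\<close>
  define w where "w t = \<i> * complex_of_real (exp (- t) * (\<xi> \<bullet> x) + \<theta>) + (levy_exponent b \<xi> - levy_exponent b (exp (- t) *\<^sub>R \<xi>))" for t
  define Z where "Z t = exp (w t)" for t
  define Z' where "Z' t = Z t * (generator_exponent ?b (exp (- t) *\<^sub>R \<xi>) - \<i> * complex_of_real (exp (- t) * (\<xi> \<bullet> x)))" for t
  have Q: "Q t (\<lambda>y. cos (\<xi> \<bullet> y + \<phi>)) (exp (- t) *\<^sub>R (x + u)) =
      Re (Z t * iexp (\<phi> - \<theta>) * iexp ((exp (- t) *\<^sub>R \<xi>) \<bullet> u))" if "0 \<le> t" for t \<phi> u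
  proof -
    have "iexp (\<xi> \<bullet> (exp (- t) *\<^sub>R (x + u)) + \<phi>) * cf (\<mu> t) \<xi> =
        Z t * iexp (\<phi> - \<theta>) * iexp ((exp (- t) *\<^sub>R \<xi>) \<bullet> u)"
      unfolding cf_\<mu>[OF that] cf_X Z_def w_def exp_diff[symmetric] exp_add[symmetric]
      by (rule arg_cong[of _ _ exp]) (simp add: inner_add_right algebra_simps)
    then show ?thesis unfolding Q_cos[OF that] by (simp only:)
  qed
  have Ph: "P t ?h (x + u) = Re (Z t * iexp ((exp (- t) *\<^sub>R \<xi>) \<bullet> u))" if "0 \<le> t" for t u
    unfolding P_def Q[OF that] by simp
  have Phx: "P t ?h x = Re (Z t)" if "0 \<le> t" for t
    using Ph[OF that, of 0] by simp
  have PD: "P t ?D x = Re (\<i> * Z t) *\<^sub>R \<xi>" if "0 \<le> t" for t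
  proof -
    have "continuous_on UNIV (\<lambda>y. cos (\<xi> \<bullet> y + (\<theta> + pi / 2)))"
      by (intro continuous_intros)
    then have "P t ?D x = Q t (\<lambda>y. cos (\<xi> \<bullet> y + (\<theta> + pi / 2))) (exp (- t) *\<^sub>R x) *\<^sub>R \<xi>"
      unfolding P_def Q_def using integrable_\<mu>[OF that, of "\<lambda>y. cos (\<xi> \<bullet> y + (\<theta> + pi / 2))" 1]
      by (intro integral_scaleR_left) auto
    also have "Q t (\<lambda>y. cos (\<xi> \<bullet> y + (\<theta> + pi / 2))) (exp (- t) *\<^sub>R x) = Re (Z t * iexp (pi / 2))"
      using Q[OF that, of "\<theta> + pi / 2" 0] by simp
    also have "iexp (pi / 2) = \<i>"
      using cis_pi_half by (simp add: cis_conv_exp)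
    finally show ?thesis by (simp add: mult.commute)
  qed
  have jump: "jump ?h ?D x t u = Re (Z t * levy_integrand (exp (- t) *\<^sub>R \<xi>) u)" if "0 \<le> t" for t u
    unfolding jump_def Ph[OF that] Phx[OF that] PD[OF that] levy_integrand_def
    by (auto simp: indicator_def algebra_simps)
  \<comment> \<open>The jump integral contributes the Levy part of the symbol and the drift term the
    rest, including the derivative of the phase that comes from contracting
    \<open>x\<close>.\<close>
  have gen: "(exp (- t) *\<^sub>R P t ?D x) \<bullet> (?b - x) + (\<integral>u. jump ?h ?D x t u \<partial>\<nu>') = Re (Z' t)" if "0 \<le> t" for t
  proof -
    have "(\<integral>u. jump ?h ?D x t u \<partial>\<nu>') = Re (Z t * (\<integral>u. levy_integrand (exp (- t) *\<^sub>R \<xi>) u \<partial>\<nu>'))"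
      unfolding jump[OF that] using integrable_levy_integrand(2)
      by (subst integral_Re) auto
    moreover have "(exp (- t) *\<^sub>R P t ?D x) \<bullet> (?b - x) =
        Re (Z t * (\<i> * complex_of_real (?b \<bullet> (exp (- t) *\<^sub>R \<xi>)) - \<i> * complex_of_real (exp (- t) * (\<xi> \<bullet> x))))"
      unfolding PD[OF that] by (simp add: inner_diff_right inner_commute[of \<xi>] algebra_simps)
    ultimately show ?thesis
      unfolding Z'_def generator_exponent_def by (simp add: algebra_simps)
  qed
  have w': "(w has_vector_derivative (generator_exponent ?b (exp (- t) *\<^sub>R \<xi>) - \<i> * complex_of_real (exp (- t) * (\<xi> \<bullet> x)))) (at t)"
    if t: "0 < t" for t
  proof -
    have "((\<lambda>t. exp (- t) * (\<xi> \<bullet> x) + \<theta>) has_real_derivative - (exp (- t) * (\<xi> \<bullet> x))) (at t)"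
      by (auto intro!: derivative_eq_intros)
    then have "((\<lambda>t. \<i> * complex_of_real (exp (- t) * (\<xi> \<bullet> x) + \<theta>)) has_vector_derivative \<i> * complex_of_real (- (exp (- t) * (\<xi> \<bullet> x)))) (at t)"
      by (intro has_vector_derivative_mult_right has_vector_derivative_of_real)
    from has_vector_derivative_add[OF this has_vector_derivative_diff[OF has_vector_derivative_const[of "levy_exponent b \<xi>"]
          levy_exponent_has_vector_derivative[OF t, of b \<xi>]]]
    show ?thesis unfolding w_def[abs_def] by (simp add: algebra_simps)
  qed
  have Z: "(Z has_vector_derivative Z' t) (at t)" if "0 < t" for t
    using field_vector_diff_chain_at[OF w'[OF that] DERIV_exp]
    by (simp add: Z_def[abs_def] Z'_def comp_def mult.commute)
  have ReZ: "((\<lambda>t. Re (Z t)) has_vector_derivative Re (Z' t)) (at t)" if "0 < t" for t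
    by (rule bounded_linear.has_vector_derivative[OF bounded_linear_Re Z[OF that]])
  have cont: "isCont (\<lambda>t. Re (Z' t)) t" if "0 < t" for t
  proof -
    have "isCont Z t"
      using Z[OF that] by (rule has_vector_derivative_continuous)
    moreover have "isCont (\<lambda>t. generator_exponent ?b (exp (- t) *\<^sub>R \<xi>)) t"
      using continuous_on_compose2[OF continuous_generator_exponent[of ?b], of UNIV "\<lambda>t. exp (- t) *\<^sub>R \<xi>"]
      by (simp add: continuous_on_eq_continuous_at continuous_intros)
    ultimately show ?thesis
      unfolding Z'_def by (intro isCont_Re isCont_mult isCont_diff) (auto intro!: continuous_intros)
  qed
  have iJ: "integrable nonneg_time (\<lambda>t. \<integral>u. jump ?h ?D x t u \<partial>\<nu>')"
    using TN.integrable_fst'[OF integrable_jump[OF sm, of x]] by simp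
  have iD: "integrable nonneg_time (\<lambda>t. (exp (- t) *\<^sub>R P t ?D x) \<bullet> (?b - x))"
    by (rule integrable_inner_left) (use integrable_drift[OF sm] in simp)
  have gen': "(exp (- t) *\<^sub>R P t ?D x) \<bullet> (?b - x) + (\<integral>u. jump ?h ?D x t u \<partial>\<nu>') = Re (Z' t)"
    if "t \<in> space nonneg_time" for t
    by (rule gen) (use that in simp)
  have iZ: "integrable nonneg_time (\<lambda>t. Re (Z' t))"
    by (rule Bochner_Integration.integrable_cong[OF refl gen', THEN iffD1, OF _ Bochner_Integration.integrable_add[OF iD iJ]])
  have "(\<integral>t. exp (- t) *\<^sub>R P t ?D x \<partial>nonneg_time) \<bullet> (?b - x) +
      (\<integral>p. jump ?h ?D x (fst p) (snd p) \<partial>(nonneg_time \<Otimes>\<^sub>M \<nu>')) =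
      (\<integral>t. (exp (- t) *\<^sub>R P t ?D x) \<bullet> (?b - x) \<partial>nonneg_time) + (\<integral>t. \<integral>u. jump ?h ?D x t u \<partial>\<nu>' \<partial>nonneg_time)"
    using TN.integral_fst'[OF integrable_jump[OF sm, of x]] integral_inner_left[OF integrable_drift[OF sm, of x], of "?b - x"]
    by (simp del: inner_scaleR_left)
  also have "\<dots> = (\<integral>t. Re (Z' t) \<partial>nonneg_time)"
    unfolding Bochner_Integration.integral_add[OF iD iJ, symmetric]
    by (rule Bochner_Integration.integral_cong[OF refl gen'])
  \<comment> \<open>The open half-line suffices: the derivative of \<open>Z\<close> is known for
    positive times, and the boundary values enter as one-sided limits.\<close>
  also have "\<dots> = (LBINT t=0..\<infinity>. Re (Z' t))"
  proof -
    have si: "set_integrable lborel {0..} (\<lambda>t. Re (Z' t))"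
      using iZ by (simp only: integrable_nonneg_time_iff)
    then have "set_integrable lborel {0<..} (\<lambda>t. Re (Z' t))"
      by (rule set_integrable_subset) auto
    with si have "set_borel_measurable lborel {0..} (\<lambda>t. Re (Z' t))" "set_borel_measurable lborel {0<..} (\<lambda>t. Re (Z' t))"
      unfolding set_integrable_def set_borel_measurable_def by (auto dest: borel_measurable_integrable)
    moreover have "AE t in lborel. (t \<in> {0<..}) = (t \<in> {0::real..})"
      using AE_lborel_singleton[of 0] by eventually_elim auto
    ultimately show ?thesis
      unfolding integral_nonneg_time interval_lebesgue_integral_0_infty by (intro set_integral_cong_set) auto
  qed
  also have "\<dots> = (\<integral>y. ?h y \<partial>\<mu>X) - ?h x"
  proof (rule interval_integral_FTC_integrable[where F="\<lambda>t. Re (Z t)"])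
    show "set_integrable lborel (einterval 0 \<infinity>) (\<lambda>t. Re (Z' t))"
      using iZ unfolding integrable_nonneg_time_iff
      by (rule set_integrable_subset) (auto simp: einterval_def)
    \<comment> \<open>Continuity at 0 is obtained from the characteristic function of
      \<open>X\<close>, which is continuous and has no zero.\<close>
    have "((\<lambda>t. Re (Z t)) \<longlongrightarrow> ?h x) (at_right 0)"
    proof -
      have Z_eq: "Z t = iexp (exp (- t) * (\<xi> \<bullet> x) + \<theta>) * (cf \<mu>X \<xi> / cf \<mu>X (exp (- t) *\<^sub>R \<xi>))" for t
        by (simp add: Z_def w_def cf_X exp_add exp_diff)
      have "continuous_on UNIV (\<lambda>t. cf \<mu>X (exp (- t) *\<^sub>R \<xi>))"
        by (rule continuous_on_compose2[OF continuous_cf[OF prob_X sets_X]]) (auto intro!: continuous_intros)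
      then have "isCont Z 0"
        unfolding Z_eq[abs_def] using cf_X_nonzero
        by (intro continuous_intros) (auto simp: continuous_on_eq_continuous_at)
      then have "isCont (\<lambda>t. Re (Z t)) 0" by (rule isCont_Re)
      moreover have "Re (Z 0) = ?h x"
        by (simp add: Z_def w_def Re_exp)
      ultimately have "((\<lambda>t. Re (Z t)) \<longlongrightarrow> ?h x) (at 0)"
        by (simp add: isCont_def)
      then show ?thesis by (rule tendsto_mono[rotated]) (simp add: at_le)
    qed
    then show "(((\<lambda>t. Re (Z t)) \<circ> real_of_ereal) \<longlongrightarrow> ?h x) (at_right 0)"
      by (simp add: ereal_tendsto_simps zero_ereal_def)
    \<comment> \<open>The value at infinity is the mean under \<open>\<mu>X\<close>, by the
      exponential ergodicity of the semigroup.\<close>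
    have "((\<lambda>t. Re (Z t) - (\<integral>y. ?h y \<partial>\<mu>X)) \<longlongrightarrow> 0) at_top"
    proof (rule Lim_null_comparison)
      let ?C = "1 + norm \<xi> + (norm \<xi>)\<^sup>2"
      show "\<forall>\<^sub>F t in at_top. norm (Re (Z t) - (\<integral>y. ?h y \<partial>\<mu>X)) \<le> ?C * ergodic_const x * exp (- (\<epsilon> * t))"
        using eventually_ge_at_top[of 0]
      proof eventually_elim
        case (elim t)
        then show ?case
          using P_ergodic[OF elim smooth_data_continuous(1)[OF sm] smooth_dataD(2)[OF sm] smooth_data_lipschitz[OF sm], of x]
          by (simp add: Phx)
      qed
      have "filterlim (\<lambda>t. - (\<epsilon> * t)) at_bot at_top"
        using \<epsilon> by (simp add: filterlim_uminus_at_bot filterlim_tendsto_pos_mult_at_top[OF tendsto_const] filterlim_ident)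
      then have "((\<lambda>t. ?C * ergodic_const x * exp (- (\<epsilon> * t))) \<longlongrightarrow> ?C * ergodic_const x * 0) at_top"
        by (intro tendsto_intros filterlim_compose[OF exp_at_bot])
      then show "((\<lambda>t. ?C * ergodic_const x * exp (- (\<epsilon> * t))) \<longlongrightarrow> 0) at_top" by simp
    qed
    then have "((\<lambda>t. Re (Z t)) \<longlongrightarrow> (\<integral>y. ?h y \<partial>\<mu>X)) at_top"
      by (simp add: LIM_zero_iff)
    then show "(((\<lambda>t. Re (Z t)) \<circ> real_of_ereal) \<longlongrightarrow> (\<integral>y. ?h y \<partial>\<mu>X)) (at_left \<infinity>)"
      by (simp add: ereal_tendsto_simps)
  qed (use ReZ cont in auto)
  finally show ?thesis unfolding stein_identity_def .
qed

lemma stein_identity_trig_poly: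
  "f \<in> trig_poly \<Longrightarrow> \<exists>C D. smooth_data C f D \<and> (\<forall>x. stein_identity f D x)"
proof (induction rule: trig_poly.induct)
  case (cos \<xi> \<theta>)
  show ?case using smooth_data_cos stein_identity_cos by blast
next
  case (lin f g a c)
  then obtain C D C' E where f: "smooth_data C f D" "\<And>x. stein_identity f D x"
    and g: "smooth_data C' g E" "\<And>x. stein_identity g E x" by blast
  show ?case
    using smooth_data_lincomb[OF f(1) g(1), of a c] stein_identity_lincomb[OF f(1,2) g(1,2), where a=a and c=c] by blast
qed

text \<open>The constant is doubled because \<open>kernel_conv_lipschitz\<close> may double the
  Lipschitz constant of the gradient; \<open>h\<close> itself is then regarded with the larger
  constant too.\<close>

lemma stein_identity_compact_support:
  assumes h: "smooth_data C h D" and supp: "\<And>y. R < norm y \<Longrightarrow> h y = 0" "\<And>y. R < norm y \<Longrightarrow> D y = 0"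
  shows "stein_identity h D x"
proof -
  note d = smooth_dataD[OF h] and c = smooth_data_continuous[OF h]
  obtain N where N: "max 1 R \<le> real N" using real_arch_simple by blast
  then have N': "0 < n + N" "R \<le> real (n + N)" for n by auto
  have C: "C \<le> 2 * C" using d(5) by simp
  have Bh: "norm (h y) \<le> C" for y using d(2)[of y] by simp
  have der: "(kernel_conv (n + N) h has_derivative (\<lambda>v. kernel_conv (n + N) D y \<bullet> v)) (at y)" for n y
    by (rule kernel_conv_has_gradient[OF d(1) c(2) supp d(3) N'(1)])
  show ?thesis
  proof (rule stein_identity_limit[where f="\<lambda>n. kernel_conv (n + N) h" and D="\<lambda>n. kernel_conv (n + N) D" and C="2 * C"])
    fix n
    have "\<bar>kernel_conv (n + N) h y\<bar> \<le> 2 * C" for y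
      using norm_kernel_conv_le[OF c(1) supp(1) N' Bh, of n y] C by simp
    moreover have "norm (kernel_conv (n + N) D y) \<le> 2 * C" for y
      using norm_kernel_conv_le[OF c(2) supp(2) N' d(3), of n y] C by simp
    moreover have "norm (kernel_conv (n + N) D y - kernel_conv (n + N) D z) \<le> 2 * C * norm (y - z)" for y z
      by (rule kernel_conv_lipschitz[OF c(2) supp(2) N' d(4)])
    ultimately show "smooth_data (2 * C) (kernel_conv (n + N) h) (kernel_conv (n + N) D)"
      unfolding smooth_data_def using der by blast
    \<comment> \<open>The gradient data of a trigonometric polynomial come with a constant that may
      depend on \<open>n\<close>. Uniqueness of gradients identifies \<open>E\<close> with the
      convolved gradient, which has bounds uniform in \<open>n\<close>.\<close>
    obtain C' E where E: "smooth_data C' (kernel_conv (n + N) h) E" "\<And>x. stein_identity (kernel_conv (n + N) h) E x"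
      using stein_identity_trig_poly[OF kernel_conv_trig_poly[OF c(1) supp(1) N'(1)]] by blast
    have "E y = kernel_conv (n + N) D y" for y
      by (rule gradient_unique[OF smooth_dataD(1)[OF E(1)] der])
    then have "E = kernel_conv (n + N) D" by (rule ext)
    then show "stein_identity (kernel_conv (n + N) h) (kernel_conv (n + N) D) x"
      using E(2) by simp
  next
    show "(\<lambda>n. kernel_conv (n + N) h y) \<longlonglongrightarrow> h y" for y
      by (rule LIMSEQ_ignore_initial_segment, rule kernel_conv_tendsto[OF c(1) supp(1) Bh])
    show "(\<lambda>n. kernel_conv (n + N) D y) \<longlonglongrightarrow> D y" for y
      by (rule LIMSEQ_ignore_initial_segment, rule kernel_conv_tendsto[OF c(2) supp(2) d(3)])
    show "smooth_data (2 * C) h D"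
      unfolding smooth_data_def
    proof (intro conjI allI)
      fix y z
      show "norm (D y - D z) \<le> 2 * C * norm (y - z)"
        using d(4)[of y z] mult_right_mono[OF C norm_ge_zero[of "y - z"]] by linarith
      show "\<bar>h y\<bar> \<le> 2 * C" "norm (D y) \<le> 2 * C" using d(2)[of y] d(3)[of y] C by linarith+
    qed (rule d(1))
  qed
qed

section \<open>The solution and its derivatives\<close>

definition solution :: "('a \<Rightarrow> real) \<Rightarrow> 'a \<Rightarrow> real" where
  "solution h x = - (\<integral>t. P t h x - (\<integral>y. h y \<partial>\<mu>X) \<partial>nonneg_time)"

definition solution_gradient :: "('a \<Rightarrow> 'a) \<Rightarrow> 'a \<Rightarrow> 'a" where
  "solution_gradient D x = - (\<integral>t. exp (- t) *\<^sub>R P t D x \<partial>nonneg_time)"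

context
  fixes h :: "'a \<Rightarrow> real" and D C
  assumes h: "\<And>x. (h has_derivative (\<lambda>v. D x \<bullet> v)) (at x)" "\<And>x. \<bar>h x\<bar> \<le> C"
    and D: "continuous_on UNIV D" "\<And>x. norm (D x) \<le> C"
begin

lemma integrable_centered_P: "integrable nonneg_time (\<lambda>t. P t h x - (\<integral>y. h y \<partial>\<mu>X))"
proof (rule Bochner_Integration.integrable_bound)
  have hc: "continuous_on UNIV h"
    by (rule has_derivative_continuous_on[of _ _ "\<lambda>y v. D y \<bullet> v"]) (use h in auto)
  have lip: "\<bar>h x - h y\<bar> \<le> C * norm (x - y)" for x y
    by (rule lipschitz_of_gradient[OF h(1), of UNIV]) (use D in auto)
  show "integrable nonneg_time (\<lambda>t. C * ergodic_const x * exp (- (\<epsilon> * t)))"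
    using \<epsilon> by (intro integrable_mult_right integrable_exp_nonneg_time)
  show "(\<lambda>t. P t h x - (\<integral>y. h y \<partial>\<mu>X)) \<in> borel_measurable nonneg_time"
    by (intro borel_measurable_diff borel_measurable_const P_measurable(1)[OF hc, of C]) (use h in simp)
  show "AE t in nonneg_time. norm (P t h x - (\<integral>y. h y \<partial>\<mu>X)) \<le> norm (C * ergodic_const x * exp (- (\<epsilon> * t)))"
  proof (rule AE_I2)
    fix t assume "t \<in> space nonneg_time"
    then have "0 \<le> t" by simp
    from P_ergodic[OF this hc h(2) lip, of x]
    show "norm (P t h x - (\<integral>y. h y \<partial>\<mu>X)) \<le> norm (C * ergodic_const x * exp (- (\<epsilon> * t)))"
      unfolding real_norm_def by (rule order_trans[OF _ abs_ge_self])
  qed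
qed

lemma solution_has_gradient: "(solution h has_derivative (\<lambda>v. solution_gradient D x \<bullet> v)) (at x)"
proof -
  have "((\<lambda>x. \<integral>t. exp (- (0 * t)) * P t h x - (\<integral>y. h y \<partial>\<mu>X) \<partial>nonneg_time) has_derivative
      (\<lambda>v. (\<integral>t. exp (- ((0 + 1) * t)) *\<^sub>R P t D x \<partial>nonneg_time) \<bullet> v)) (at x)"
    by (rule integral_P_has_gradient[OF _ h D]) (use integrable_centered_P in simp_all)
  from has_derivative_minus[OF this] show ?thesis
    by (simp add: solution_def[abs_def] solution_gradient_def)
qed

lemma norm_solution_gradient_le: "norm (solution_gradient D x) \<le> C"
  using norm_integral_exp_P_le[of 1 D C x] D by (simp add: solution_gradient_def)

lemma continuous_solution_gradient: "continuous_on UNIV (solution_gradient D)"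
  using continuous_integral_exp_P[of 1 D C] D unfolding solution_gradient_def[abs_def]
  by (intro continuous_intros) simp

end

text \<open>Brings a fixed component of the gradient into the shape of
  \<open>integral_P_has_gradient\<close> with \<open>c = 1\<close> and \<open>m\<close> zero, which
  explains the factor 1 and the subtracted 0.\<close>

lemma solution_gradient_inner_eq:
  assumes D: "continuous_on UNIV D" "\<And>x. norm (D x) \<le> C"
  shows "solution_gradient D x \<bullet> v = - (\<integral>t. exp (- (1 * t)) * P t (\<lambda>x. D x \<bullet> v) x - 0 \<partial>nonneg_time)"
proof -
  have "(\<integral>t. exp (- t) *\<^sub>R P t D x \<partial>nonneg_time) \<bullet> v = (\<integral>t. (exp (- t) *\<^sub>R P t D x) \<bullet> v \<partial>nonneg_time)"
    using integrable_exp_P[of 1 D C x] D by (intro integral_inner_left[symmetric]) simp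
  also have "\<dots> = (\<integral>t. exp (- (1 * t)) * P t (\<lambda>x. D x \<bullet> v) x - 0 \<partial>nonneg_time)"
    by (rule Bochner_Integration.integral_cong) (auto simp: P_def Q_inner[OF _ D])
  finally show ?thesis by (simp add: solution_gradient_def)
qed

lemma solution_gradient_has_gradient:
  assumes D: "continuous_on UNIV D" "\<And>x. norm (D x) \<le> C"
    and der: "\<And>x. ((\<lambda>x. D x \<bullet> v) has_derivative (\<lambda>u. E x \<bullet> u)) (at x)"
    and E: "continuous_on UNIV E" "\<And>x. norm (E x) \<le> B"
  shows "((\<lambda>x. solution_gradient D x \<bullet> v) has_derivative (\<lambda>u. - (\<integral>t. exp (- (2 * t)) *\<^sub>R P t E x \<partial>nonneg_time) \<bullet> u)) (at x)"
proof -
  have le: "\<bar>D x \<bullet> v\<bar> \<le> C * norm v" for x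
    using Cauchy_Schwarz_ineq2[of "D x" v] mult_right_mono[OF D(2) norm_ge_zero[of v]] by (rule order_trans)
  have "((\<lambda>x. \<integral>t. exp (- (1 * t)) * P t (\<lambda>x. D x \<bullet> v) x - 0 \<partial>nonneg_time) has_derivative
      (\<lambda>u. (\<integral>t. exp (- ((1 + 1) * t)) *\<^sub>R P t E x \<partial>nonneg_time) \<bullet> u)) (at x)"
  proof (rule integral_P_has_gradient[OF _ der le E])
    have "continuous_on UNIV (\<lambda>x. D x \<bullet> v)"
      by (intro continuous_intros D)
    then show "integrable nonneg_time (\<lambda>t. exp (- (1 * t)) * P t (\<lambda>x. D x \<bullet> v) x - 0)" for x
      using integrable_exp_P[of 1 "\<lambda>x. D x \<bullet> v" "C * norm v" x] le by simp
  qed simp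
  from has_derivative_minus[OF this] show ?thesis
    unfolding solution_gradient_inner_eq[OF D] by simp
qed

text \<open>Here the product integral is read with time inside: the time integral of the semigroup
  jumps is minus the jump of the solution, so integrability over \<open>\<nu>'\<close> also follows
  from Fubini.\<close>

lemma solution_stein_equation:
  assumes h: "smooth_data C h D" and id: "stein_identity h D x"
  defines "J \<equiv> \<lambda>u. solution h (x + u) - solution h x - (solution_gradient D x \<bullet> u) * indicator (cball 0 1) u"
  shows "integrable \<nu>' J"
    and "(b_tilde b \<sigma> k - x) \<bullet> solution_gradient D x + (\<integral>u. J u \<partial>\<nu>') = h x - (\<integral>y. h y \<partial>\<mu>X)"
proof -
  note d = smooth_dataD[OF h] and c = smooth_data_continuous[OF h]
  have J: "J u = - (\<integral>t. jump h D x t u \<partial>nonneg_time)" for u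
  proof -
    have i: "integrable nonneg_time (\<lambda>t. P t h y - (\<integral>y. h y \<partial>\<mu>X))" for y
      by (rule integrable_centered_P[OF d(1,2) c(2) d(3)])
    have iD: "integrable nonneg_time (\<lambda>t. (exp (- t) *\<^sub>R P t D x) \<bullet> u)"
      by (rule integrable_inner_left) (rule integrable_drift[OF h])
    \<comment> \<open>The mean is inserted in both semigroup terms, where it cancels; only the
      centred terms are known to be integrable over time.\<close>
    have "(\<integral>t. jump h D x t u \<partial>nonneg_time) = (\<integral>t. (P t h (x + u) - (\<integral>y. h y \<partial>\<mu>X)) - (P t h x - (\<integral>y. h y \<partial>\<mu>X)) -
        ((exp (- t) *\<^sub>R P t D x) \<bullet> u) * indicator (cball 0 1) u \<partial>nonneg_time)"
      by (simp add: jump_def)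
    also have "\<dots> = (\<integral>t. P t h (x + u) - (\<integral>y. h y \<partial>\<mu>X) \<partial>nonneg_time) - (\<integral>t. P t h x - (\<integral>y. h y \<partial>\<mu>X) \<partial>nonneg_time) -
        (\<integral>t. (exp (- t) *\<^sub>R P t D x) \<bullet> u \<partial>nonneg_time) * indicator (cball 0 1) u"
      by (rule has_bochner_integral_integral_eq, intro has_bochner_integral_diff has_bochner_integral_mult_left
          has_bochner_integral_integrable i iD)
    also have "(\<integral>t. (exp (- t) *\<^sub>R P t D x) \<bullet> u \<partial>nonneg_time) = (\<integral>t. exp (- t) *\<^sub>R P t D x \<partial>nonneg_time) \<bullet> u"
      using integrable_drift[OF h, of x] by (intro integral_inner_left) simp
    finally show ?thesis
      by (simp add: J_def solution_def solution_gradient_def)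
  qed
  have ij: "integrable (nonneg_time \<Otimes>\<^sub>M \<nu>') (\<lambda>(t, u). jump h D x t u)"
    using integrable_jump[OF h, of x] by (simp add: split_beta')
  show "integrable \<nu>' J"
    unfolding J[abs_def] using TN.integrable_snd[OF ij] by simp
  have "(\<integral>u. J u \<partial>\<nu>') = - (\<integral>p. jump h D x (fst p) (snd p) \<partial>(nonneg_time \<Otimes>\<^sub>M \<nu>'))"
    unfolding J using TN.integral_snd[OF ij] by (simp add: split_beta')
  then show "(b_tilde b \<sigma> k - x) \<bullet> solution_gradient D x + (\<integral>u. J u \<partial>\<nu>') = h x - (\<integral>y. h y \<partial>\<mu>X)"
    using id by (simp add: stein_identity_def solution_gradient_def inner_commute[of "b_tilde b \<sigma> k - x"])
qed

end

subsection \<open>Gradients and iterated derivatives\<close>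

lemma gradient_eqI:
  assumes "(f has_derivative (\<lambda>v. D \<bullet> v)) (at x)"
  shows "gradient f x = D" "iter_deriv f [v] x = D \<bullet> v"
proof -
  have iff: "GDERIV f x :> E \<longleftrightarrow> (f has_derivative (\<lambda>v. E \<bullet> v)) (at x)" for E
    by (simp add: gderiv_def inner_commute)
  show "gradient f x = D"
    unfolding gradient_def iff by (rule the_equality, rule assms, rule gradient_unique[OF _ assms])
  show "iter_deriv f [v] x = D \<bullet> v"
    using frechet_derivative_at[OF assms] by simp
qed

text \<open>The derivative is represented by the sum of \<open>f' b *\<^sub>R b\<close> over the
  basis; this existence is what makes the definite description \<open>gradient\<close>
  meaningful.\<close>

lemma has_derivative_gradient:
  assumes "f differentiable (at (x::'a::euclidean_space))"
  shows "(f has_derivative (\<lambda>v. gradient f x \<bullet> v)) (at x)"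
proof -
  obtain f' where f': "(f has_derivative f') (at x)"
    using assms by (auto simp: differentiable_def)
  define D where "D = (\<Sum>b\<in>Basis. f' b *\<^sub>R b)"
  interpret f': linear f' using f' by (rule has_derivative_linear)
  have "f' v = D \<bullet> v" for v
  proof -
    have "f' v = f' (\<Sum>b\<in>Basis. (v \<bullet> b) *\<^sub>R b)" by (simp add: euclidean_representation)
    also have "\<dots> = (\<Sum>b\<in>Basis. (v \<bullet> b) * f' b)" by (simp add: f'.sum f'.scaleR)
    also have "\<dots> = D \<bullet> v" by (simp add: D_def inner_sum_left inner_commute[of v] mult.commute)
    finally show ?thesis .
  qed
  then have "f' = (\<lambda>v. D \<bullet> v)" by (rule ext)
  then have "(f has_derivative (\<lambda>v. D \<bullet> v)) (at x)" using f' by simp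
  then show ?thesis by (simp add: gradient_eqI(1))
qed

lemma norm_le_of_unit_inner:
  fixes D :: "'a::euclidean_space"
  assumes "\<And>v. norm v = 1 \<Longrightarrow> \<bar>D \<bullet> v\<bar> \<le> c" "0 \<le> c"
  shows "norm D \<le> c"
proof (cases "D = 0")
  case False
  have "D \<bullet> (D /\<^sub>R norm D) = norm D"
    using False by (simp add: power2_norm_eq_inner[symmetric] power2_eq_square)
  then show ?thesis using assms(1)[of "D /\<^sub>R norm D"] False by simp
qed (use assms in simp)

lemma deriv_bound_le_iff:
  assumes "0 \<le> c"
  shows "deriv_bound l f \<le> ennreal c \<longleftrightarrow>
    (\<forall>x vs. length vs = l \<longrightarrow> (\<forall>v\<in>set vs. norm v = 1) \<longrightarrow> \<bar>iter_deriv f vs x\<bar> \<le> c)"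
  using assms unfolding deriv_bound_def form_norm_def by (auto simp: SUP_le_iff)

lemma cont_diff_mono: "m \<le> n \<Longrightarrow> cont_diff n h \<Longrightarrow> cont_diff m h"
  unfolding cont_diff_def using order_trans less_le_trans by blast

text \<open>The components of the gradient are the evaluations of the next iterated derivative at
  basis vectors, whose continuity is part of \<open>cont_diff\<close>.\<close>

lemma cont_diff_has_gradient:
  assumes "cont_diff (Suc n) h" "length vs \<le> n"
  shows "(iter_deriv h vs has_derivative (\<lambda>v. gradient (iter_deriv h vs) x \<bullet> v)) (at x)"
    and "continuous_on UNIV (gradient (iter_deriv h vs))"
proof -
  show der: "(iter_deriv h vs has_derivative (\<lambda>v. gradient (iter_deriv h vs) x \<bullet> v)) (at x)" for x
    using assms by (intro has_derivative_gradient) (auto simp: cont_diff_def)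
  show "continuous_on UNIV (gradient (iter_deriv h vs))"
  proof (subst continuous_on_componentwise, rule ballI)
    fix b :: 'a assume "b \<in> Basis"
    have "continuous_on UNIV (iter_deriv h (b # vs))"
      using assms by (auto simp: cont_diff_def simp del: iter_deriv.simps)
    moreover have "iter_deriv h (b # vs) x = gradient (iter_deriv h vs) x \<bullet> b" for x
      using gradient_eqI(2)[OF der, of b] by simp
    ultimately show "continuous_on UNIV (\<lambda>x. gradient (iter_deriv h vs) x \<bullet> b)"
      by (simp del: iter_deriv.simps)
  qed
qed

lemma H_class_data:
  assumes h: "h \<in> H_class n" and n: "1 \<le> n"
  shows "(h has_derivative (\<lambda>v. gradient h x \<bullet> v)) (at x)" "\<bar>h x\<bar> \<le> 1"
    "continuous_on UNIV (gradient h)" "norm (gradient h x) \<le> 1"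
proof -
  have cd: "cont_diff (Suc 0) h"
    using h n by (intro cont_diff_mono[of "Suc 0" n]) (auto simp: H_class_def)
  show der: "(h has_derivative (\<lambda>v. gradient h x \<bullet> v)) (at x)" for x
    using cont_diff_has_gradient(1)[OF cd, of "[]"] by simp
  show "continuous_on UNIV (gradient h)"
    using cont_diff_has_gradient(2)[OF cd, of "[]"] by simp
  have "deriv_bound l h \<le> ennreal 1" if "l \<le> n" for l
    using h that by (simp add: H_class_def)
  from iffD1[OF deriv_bound_le_iff[OF zero_le_one] this]
  have b: "\<bar>iter_deriv h vs x\<bar> \<le> 1" if "length vs \<le> n" "\<forall>v\<in>set vs. norm v = 1" for vs x
    using that by blast
  show "\<bar>h x\<bar> \<le> 1"
    using b[of "[]"] by simp
  show "norm (gradient h x) \<le> 1"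
  proof (rule norm_le_of_unit_inner)
    fix v :: 'a assume "norm v = 1"
    then show "\<bar>gradient h x \<bullet> v\<bar> \<le> 1"
      using b[of "[v]" x] n by (simp add: gradient_eqI(2)[OF der] del: iter_deriv.simps)
  qed simp
qed

text \<open>\<open>E v\<close> is the second derivative in the direction \<open>v\<close>. The
  operator norm controls it for unit \<open>v\<close>; uniqueness of gradients gives homogeneity in
  \<open>v\<close>, hence the bound \<open>norm v\<close>. Testing increments of the gradient
  against unit vectors yields the Lipschitz constant 1.\<close>

lemma H_class_data2:
  assumes h: "h \<in> H_class 2"
  defines "E \<equiv> \<lambda>v. gradient (\<lambda>x. gradient h x \<bullet> v)"
  shows "((\<lambda>x. gradient h x \<bullet> v) has_derivative (\<lambda>u. E v x \<bullet> u)) (at x)"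
    "continuous_on UNIV (E v)" "norm (E v x) \<le> norm v" "smooth_data 1 h (gradient h)"
proof -
  note d = H_class_data[OF h]
  have cd: "cont_diff (Suc 1) h"
    using h by (simp add: H_class_def numeral_2_eq_2)
  have eq: "iter_deriv h [v] = (\<lambda>x. gradient h x \<bullet> v)" for v
    using gradient_eqI(2)[OF d(1)] by (simp add: fun_eq_iff del: iter_deriv.simps)
  show der: "((\<lambda>x. gradient h x \<bullet> v) has_derivative (\<lambda>u. E v x \<bullet> u)) (at x)" for v x
    using cont_diff_has_gradient(1)[OF cd, of "[v]" x] by (simp add: E_def eq del: iter_deriv.simps)
  show "continuous_on UNIV (E v)"
    using cont_diff_has_gradient(2)[OF cd, of "[v]"] by (simp add: E_def eq del: iter_deriv.simps)
  have "deriv_bound 2 h \<le> ennreal 1"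
    using h by (simp add: H_class_def)
  from iffD1[OF deriv_bound_le_iff[OF zero_le_one] this, rule_format, of "[u, v]" x for u v x]
  have b: "\<bar>iter_deriv h [u, v] x\<bar> \<le> 1" if "norm u = 1" "norm v = 1" for u v x
    using that by (auto simp del: iter_deriv.simps)
  have unit: "norm (E v x) \<le> 1" if "norm v = 1" for v x
  proof (rule norm_le_of_unit_inner)
    fix u :: 'a assume u: "norm u = 1"
    have "iter_deriv h [u, v] x = iter_deriv (iter_deriv h [v]) [u] x" by simp
    also have "\<dots> = E v x \<bullet> u"
      unfolding eq by (rule gradient_eqI(2)[OF der])
    finally show "\<bar>E v x \<bullet> u\<bar> \<le> 1" using b[OF u that, of x] by simp
  qed simp
  show "norm (E v x) \<le> norm v"
  proof (cases "v = 0")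
    case True
    have "E v x = 0"
      using gradient_unique[OF der[of v x], of 0] True by simp
    then show ?thesis by simp
  next
    case False
    define w where "w = v /\<^sub>R norm v"
    have w: "norm w = 1" using False by (simp add: w_def)
    have v: "v = norm v *\<^sub>R w" using False by (simp add: w_def)
    have "((\<lambda>x. norm v * (gradient h x \<bullet> w)) has_derivative (\<lambda>u. norm v * (E w x \<bullet> u))) (at x)"
      by (rule has_derivative_mult_right[OF der])
    moreover have "(\<lambda>x. gradient h x \<bullet> v) = (\<lambda>x. norm v * (gradient h x \<bullet> w))"
      using arg_cong[OF v, of "\<lambda>z. gradient h y \<bullet> z" for y] by (simp add: fun_eq_iff)
    moreover have "(\<lambda>u. (norm v *\<^sub>R E w x) \<bullet> u) = (\<lambda>u. norm v * (E w x \<bullet> u))"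
      by (simp add: fun_eq_iff)
    ultimately have "((\<lambda>x. gradient h x \<bullet> v) has_derivative (\<lambda>u. (norm v *\<^sub>R E w x) \<bullet> u)) (at x)"
      by (simp only:)
    then have "E v x = norm v *\<^sub>R E w x"
      by (rule gradient_unique[OF der])
    then show ?thesis using unit[OF w, of x] mult_left_mono[of _ 1 "norm v"] by simp
  qed
  have "norm (gradient h x - gradient h y) \<le> norm (x - y)" for x y
  proof (rule norm_le_of_unit_inner)
    fix v :: 'a assume v: "norm v = 1"
    have "\<bar>gradient h x \<bullet> v - gradient h y \<bullet> v\<bar> \<le> 1 * norm (x - y)"
      by (rule lipschitz_of_gradient[OF der, of UNIV]) (use unit[OF v] in auto)
    then show "\<bar>(gradient h x - gradient h y) \<bullet> v\<bar> \<le> norm (x - y)"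
      by (simp add: inner_diff_left)
  qed simp
  then show "smooth_data 1 h (gradient h)"
    unfolding smooth_data_def using d by simp
qed

lemma Cc_infty_support:
  assumes h: "h \<in> Cc_infty" and D: "\<And>x. (h has_derivative (\<lambda>v. D x \<bullet> v)) (at x)"
  shows "\<exists>R. (\<forall>y. R < norm y \<longrightarrow> h y = 0) \<and> (\<forall>y. R < norm y \<longrightarrow> D y = 0)"
proof -
  have "bounded (closure {x. h x \<noteq> 0})"
    using h by (intro compact_imp_bounded) (simp add: Cc_infty_def)
  then obtain R where "\<forall>x\<in>closure {x. h x \<noteq> 0}. norm x \<le> R"
    by (auto simp: bounded_iff)
  note bd = this
  have R: "h y = 0" if "R < norm y" for y
  proof (rule ccontr)
    assume "h y \<noteq> 0"
    then have "y \<in> closure {x. h x \<noteq> 0}" by (intro subsetD[OF closure_subset]) simp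
    then show False using bd that by fastforce
  qed
  have "D y = 0" if y: "R < norm y" for y
  proof (rule gradient_unique[OF D])
    have op: "open {y::'a. R < norm y}"
      by (intro open_Collect_less continuous_intros)
    have "((\<lambda>_::'a. 0::real) has_derivative (\<lambda>v. 0 \<bullet> v)) (at y)" by simp
    from has_derivative_transform_within_open[OF this op, of h]
    show "(h has_derivative (\<lambda>v. 0 \<bullet> v)) (at y)"
      using y R by simp
  qed
  with R show ?thesis by blast
qed

section \<open>The solution attached to the random vectors\<close>

theorem theorem4p1:
  fixes M :: "'w measure" and X :: "'w \<Rightarrow> 'a::euclidean_space" and \<mu>X :: "'a measure"
    and N :: "real \<Rightarrow> 'v measure" and Xt :: "real \<Rightarrow> 'v \<Rightarrow> 'a" and \<mu> :: "real \<Rightarrow> 'a measure"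
    and b :: 'a and \<nu> \<sigma> :: "'a measure" and k :: "'a \<Rightarrow> real \<Rightarrow> real"
    and \<epsilon> \<beta>1 \<beta>2 \<beta>3 :: real
  assumes "prob_space M" and "X \<in> borel_measurable M" and "\<mu>X = distr M borel X"
    and "nondegenerate \<mu>X"
    and "sd_without_gaussian \<mu>X b \<nu> \<sigma> k"
    and "\<And>x. x \<in> sphere 0 1 \<Longrightarrow> continuous_on {0<..} (k x)"
    and "\<And>r. r > 0 \<Longrightarrow> continuous_on (sphere 0 1) (\<lambda>x. k x r)"
    and "\<And>x. x \<in> sphere 0 1 \<Longrightarrow> ((\<lambda>r. r\<^sup>2 * k x r) \<longlongrightarrow> 0) (at_right 0)"
    and "\<And>x. x \<in> sphere 0 1 \<Longrightarrow> (k x \<longlongrightarrow> 0) at_top"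
    and "0 < \<epsilon>" and "\<epsilon> < 1"
    and "(\<integral>\<^sup>+w. ennreal (norm (X w) powr \<epsilon>) \<partial>M) < \<infinity>"
    and "\<beta>1 > 0" and "\<beta>2 > 0" and "0 < \<beta>3" and "\<beta>3 < 1"
    and "gamma1 \<sigma> k \<beta>1 < \<infinity>" and "gamma2 \<sigma> k \<beta>2 < \<infinity>" and "gamma3 \<sigma> k \<beta>3 < \<infinity>"
    and "\<And>t. t \<ge> 0 \<Longrightarrow> prob_space (N t)"
    and "\<And>t. t \<ge> 0 \<Longrightarrow> Xt t \<in> borel_measurable (N t)"
    and "\<And>t. t \<ge> 0 \<Longrightarrow> \<mu> t = distr (N t) borel (Xt t)"
    and "\<And>t \<xi>. t \<ge> 0 \<Longrightarrow> cf (\<mu> t) \<xi> = cf \<mu>X \<xi> / cf \<mu>X (exp (- t) *\<^sub>R \<xi>)"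
    and "(SUP t\<in>{0..}. \<integral>\<^sup>+w. ennreal (norm (Xt t w) powr \<epsilon>) \<partial>N t) < \<infinity>"
  shows
    "(\<forall>h \<in> H_class 1.
        (\<forall>x. set_integrable lborel {0..} (\<lambda>t. P_nu \<mu> t h x - (LINT w|M. h (X w)))) \<and>
        cont_diff 1 (stein_solution \<mu> M X h) \<and>
        deriv_bound 1 (stein_solution \<mu> M X h) \<le> 1) \<and>
     (\<forall>h \<in> H_class 2 \<inter> Cc_infty.
        cont_diff 2 (stein_solution \<mu> M X h) \<and>
        deriv_bound 2 (stein_solution \<mu> M X h) \<le> ennreal (1 / 2) \<and>
        (\<forall>x. let f = stein_solution \<mu> M X h;
                 jump = (\<lambda>u. f (x + u) - f x - (gradient f x \<bullet> u) * indicator (cball 0 1) u)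
             in integrable (nu_tilde \<sigma> k) jump \<and>
                (b_tilde b \<sigma> k - x) \<bullet> gradient f x + (LINT u|nu_tilde \<sigma> k. jump u)
                  = h x - (LINT w|M. h (X w))))"
proof -
  have sd: "levy_measure \<nu>" "finite_measure \<sigma>" "sets \<sigma> = sets (restrict_space borel (sphere 0 1))"
      "\<And>x r. x \<in> sphere 0 1 \<Longrightarrow> 0 < r \<Longrightarrow> 0 \<le> k x r" "\<And>x. x \<in> sphere 0 1 \<Longrightarrow> antimono_on {0<..} (k x)"
      "\<And>r. 0 < r \<Longrightarrow> (\<lambda>x. k x r) \<in> borel_measurable \<sigma>"
    and nu: "\<nu> = polar_measure \<sigma> (\<lambda>x. density lborel (\<lambda>r. indicator {0<..} r * ennreal (k x r / r)))"
    and cf: "\<And>\<xi>. cf \<mu>X \<xi> = exp (\<i> * complex_of_real (b \<bullet> \<xi>) +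
        (CLINT u|\<nu>. iexp (\<xi> \<bullet> u) - 1 - \<i> * complex_of_real (\<xi> \<bullet> u) * indicator (cball 0 1) u))"
    using assms(5) unfolding sd_without_gaussian_def by blast+
  note [measurable] = assms(2)
  interpret polar_levy \<sigma> k \<nu>
    by (intro polar_levy.intro polar_family.intro polar_levy_axioms.intro sd nu assms(6,9))
  have moment: "integrable \<mu>X (\<lambda>x. norm x powr \<epsilon>)"
    using assms(12) unfolding assms(3)
    by (intro integrableI_nonneg) (auto simp: nn_integral_distr)
  interpret sd_semigroup \<sigma> k \<nu> b \<mu>X \<mu> \<epsilon>
  proof (intro sd_semigroup.intro sd_semigroup_axioms.intro polar_levy_axioms)
    show "prob_space \<mu>X"
      unfolding assms(3) by (rule prob_space.prob_space_distr[OF assms(1,2)])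
    show "prob_space (\<mu> t)" if "0 \<le> t" for t
      unfolding assms(22)[OF that] by (rule prob_space.prob_space_distr[OF assms(20)[OF that] assms(21)[OF that]])
    show "cf \<mu>X \<xi> = exp (levy_exponent b \<xi>)" for \<xi>
      unfolding cf levy_exponent_def levy_integrand_def ..
    show "sets (\<mu> t) = sets borel" if "0 \<le> t" for t
      unfolding assms(22)[OF that] by simp
    show "sets \<mu>X = sets borel"
      unfolding assms(3) by simp
  qed (fact assms(10,11,23) moment)+
  have mean: "(LINT w|M. h (X w)) = (\<integral>y. h y \<partial>\<mu>X)" if "continuous_on UNIV h" for h :: "'a \<Rightarrow> real"
    unfolding assms(3) using borel_measurable_continuous_onI[OF that] by (subst integral_distr) auto
  have P: "P_nu \<mu> t h x = P t h x" for t h x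
    by (simp add: P_nu_def P_def Q_def)
  have sol: "stein_solution \<mu> M X h = solution h" if "continuous_on UNIV h" for h
    by (simp add: fun_eq_iff stein_solution_def solution_def P mean[OF that] integral_nonneg_time)
  have cont: "continuous_on UNIV h" if "h \<in> H_class n" "1 \<le> n" for h :: "'a \<Rightarrow> real" and n
    by (rule has_derivative_continuous_on[of _ _ "\<lambda>y v. gradient h y \<bullet> v"]) (use H_class_data[OF that] in auto)
  show ?thesis
  proof (intro conjI ballI)
    fix h :: "'a \<Rightarrow> real" assume h: "h \<in> H_class 1"
    note d = H_class_data[OF h order_refl]
    let ?f = "solution h" and ?g = "solution_gradient (gradient h)"
    have f: "stein_solution \<mu> M X h = ?f"
      by (rule sol[OF cont[OF h order_refl]])
    have der: "(?f has_derivative (\<lambda>v. ?g x \<bullet> v)) (at x)" for x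
      by (rule solution_has_gradient[OF d(1,2,3,4)])
    have it: "iter_deriv ?f [v] = (\<lambda>x. ?g x \<bullet> v)" for v
      using gradient_eqI(2)[OF der] by (simp add: fun_eq_iff del: iter_deriv.simps)
    have gc: "continuous_on UNIV ?g"
      by (rule continuous_solution_gradient[OF d(1,2,3,4)])
    show "\<forall>x. set_integrable lborel {0..} (\<lambda>t. P_nu \<mu> t h x - (LINT w|M. h (X w)))"
      using integrable_centered_P[OF d(1,2,3,4)]
      by (simp add: P mean[OF cont[OF h order_refl]] integrable_nonneg_time_iff)
    show "cont_diff 1 (stein_solution \<mu> M X h)"
      unfolding f cont_diff_def
    proof (intro conjI allI impI)
      fix vs :: "'a list" and x
      assume "length vs < 1"
      then show "iter_deriv ?f vs differentiable (at x)"
        using der by (auto simp: differentiable_def)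
    next
      fix vs :: "'a list"
      assume "length vs \<le> 1"
      then consider "vs = []" | v where "vs = [v]" by (cases vs) auto
      then show "continuous_on UNIV (iter_deriv ?f vs)"
      proof cases
        case 1
        have "continuous_on UNIV ?f"
          by (rule has_derivative_continuous_on[of _ _ "\<lambda>y v. ?g y \<bullet> v"]) (use der in auto)
        then show ?thesis using 1 by simp
      next
        case 2
        then show ?thesis using it gc by (auto intro!: continuous_intros simp del: iter_deriv.simps)
      qed
    qed
    show "deriv_bound 1 (stein_solution \<mu> M X h) \<le> 1"
    proof -
      have "\<bar>?g x \<bullet> v\<bar> \<le> 1" if "norm v = 1" for x v
        using Cauchy_Schwarz_ineq2[of "?g x" v] norm_solution_gradient_le[OF d(1,2,3,4), of x] that by simp
      then have "deriv_bound 1 ?f \<le> ennreal 1"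
        by (subst deriv_bound_le_iff) (auto simp: length_Suc_conv it simp del: iter_deriv.simps)
      then show ?thesis by (simp add: f)
    qed
  next
    fix h :: "'a \<Rightarrow> real" assume "h \<in> H_class 2 \<inter> Cc_infty"
    then have h: "h \<in> H_class 2" and hc: "h \<in> Cc_infty" by auto
    have "1 \<le> (2::nat)" by simp
    note d = H_class_data[OF h this] and c = cont[OF h this]
    note d2 = H_class_data2[OF h]
    let ?D = "gradient h" and ?E = "\<lambda>v. gradient (\<lambda>x. gradient h x \<bullet> v)"
    let ?f = "solution h" and ?g = "solution_gradient ?D"
    define S where "S v x = - (\<integral>t. exp (- (2 * t)) *\<^sub>R P t (?E v) x \<partial>nonneg_time)" for v x
    have f: "stein_solution \<mu> M X h = ?f" by (rule sol[OF c])
    have der: "(?f has_derivative (\<lambda>v. ?g x \<bullet> v)) (at x)" for x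
      by (rule solution_has_gradient[OF d(1,2,3,4)])
    have it: "iter_deriv ?f [v] = (\<lambda>x. ?g x \<bullet> v)" for v
      using gradient_eqI(2)[OF der] by (simp add: fun_eq_iff del: iter_deriv.simps)
    \<comment> \<open>Differentiability is checked on the evaluation at a fixed \<open>v\<close>, so
      the second derivative is a gradient \<open>S v\<close> for each direction separately.\<close>
    have der2: "(iter_deriv ?f [v] has_derivative (\<lambda>u. S v x \<bullet> u)) (at x)" for v x
      unfolding it S_def by (rule solution_gradient_has_gradient[OF d(3,4) d2(1,2,3)])
    have it2: "iter_deriv ?f [u, v] = (\<lambda>x. S v x \<bullet> u)" for u v
      using gradient_eqI(2)[OF der2] by (simp add: fun_eq_iff)
    have Sc: "continuous_on UNIV (S v)" for v
      unfolding S_def[abs_def] by (intro continuous_intros continuous_integral_exp_P[OF _ d2(2,3)]) simp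
    \<comment> \<open>Two derivatives gain \<open>exp (- (2 * t))\<close>, whose time integral is
      1/2.\<close>
    have Sn: "norm (S v x) \<le> norm v / 2" for v x
      unfolding S_def norm_minus_cancel by (rule norm_integral_exp_P_le[OF _ d2(2,3)]) simp
    show "cont_diff 2 (stein_solution \<mu> M X h)"
      unfolding f cont_diff_def
    proof (intro conjI allI impI)
      fix vs :: "'a list" and x
      assume "length vs < 2"
      then consider "vs = []" | v where "vs = [v]"
        by (cases vs) (auto simp: less_Suc_eq numeral_2_eq_2)
      then show "iter_deriv ?f vs differentiable (at x)"
        using der der2 by cases (auto simp: differentiable_def simp del: iter_deriv.simps(2))
    next
      fix vs :: "'a list"
      assume "length vs \<le> 2"
      then consider "vs = []" | v where "vs = [v]" | u v where "vs = [u, v]"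
        by (auto simp: le_Suc_eq numeral_2_eq_2 length_Suc_conv)
      then show "continuous_on UNIV (iter_deriv ?f vs)"
      proof cases
        case 1
        have "continuous_on UNIV ?f"
          by (rule has_derivative_continuous_on[of _ _ "\<lambda>y v. ?g y \<bullet> v"]) (use der in auto)
        then show ?thesis using 1 by simp
      next
        case 2
        then show ?thesis
          using it continuous_solution_gradient[OF d(1,2,3,4)] by (auto intro!: continuous_intros simp del: iter_deriv.simps)
      next
        case 3
        then show ?thesis using it2 Sc by (auto intro!: continuous_intros simp del: iter_deriv.simps)
      qed
    qed
    show "deriv_bound 2 (stein_solution \<mu> M X h) \<le> ennreal (1 / 2)"
    proof -
      have "\<bar>S v x \<bullet> u\<bar> \<le> 1 / 2" if "norm u = 1" "norm v = 1" for x u v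
        using Cauchy_Schwarz_ineq2[of "S v x" u] Sn[of v x] that by simp
      then show ?thesis
        unfolding f by (subst deriv_bound_le_iff) (auto simp: length_Suc_conv numeral_2_eq_2 it2 simp del: iter_deriv.simps)
    qed
    obtain R where R: "\<And>y. R < norm y \<Longrightarrow> h y = 0" "\<And>y. R < norm y \<Longrightarrow> ?D y = 0"
      using Cc_infty_support[OF hc d(1)] by blast
    have grad: "gradient ?f x = ?g x" for x
      by (rule gradient_eqI(1)[OF der])
    show "\<forall>x. let f = stein_solution \<mu> M X h;
                 jump = (\<lambda>u. f (x + u) - f x - (gradient f x \<bullet> u) * indicator (cball 0 1) u)
             in integrable (nu_tilde \<sigma> k) jump \<and>
                (b_tilde b \<sigma> k - x) \<bullet> gradient f x + (LINT u|nu_tilde \<sigma> k. jump u)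
                  = h x - (LINT w|M. h (X w))"
      unfolding f Let_def grad mean[OF c]
      by (intro allI conjI solution_stein_equation[OF d2(4)] stein_identity_compact_support[OF d2(4) R])
  qed
qed

end
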